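(* A mixed state $\rho$ of two qubits is entangled if and only if there exists a trace-preserving LOCC operation $\Lambda$ (from two qubits to two qubits) such that the processed state has fidelity $F(\Lambda(\rho))>\tfrac12$.
   Context: A state of two qubits is a positive semidefinite operator of trace one on $\mathbb{C}^2\otimes\mathbb{C}^2$; it is separable if it is a convex combination of product states and entangled otherwise. The fidelity (maximal singlet fraction) is $F(\rho)=\max_{|\psi\rangle}\langle\psi|\rho|\psi\rangle$, the maximum being over all maximally entangled unit vectors, i.e. $|\psi\rangle=(U\otimes V)(|00\rangle+|11\rangle)/\sqrt2$ with $U,V$ unitary. A trace-preserving LOCC operation is a completely positive trace-preserving map realized by finitely many rounds of local quantum operations (local instruments) by the two parties, each of which may depend on classical communication of earlier outcomes. *)

theory Defs
  imports "Jordan_Normal_Form.Schur_Decomposition"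
begin

text \<open>
  Operators on \<open>\<complex>\<^sup>d\<close> are complex matrices in \<open>carrier_mat d d\<close>. A composite system
  \<open>\<complex>\<^sup>m \<otimes> \<complex>\<^sup>n\<close> is \<open>\<complex>\<^sup>m\<^sup>n\<close>, the product basis vector \<open>|a\<rangle> \<otimes> |b\<rangle>\<close> having
  index \<open>a * n + b\<close>.
\<close>

definition tensor_mat :: "complex mat \<Rightarrow> complex mat \<Rightarrow> complex mat" where
  "tensor_mat A B = mat (dim_row A * dim_row B) (dim_col A * dim_col B)
     (\<lambda>(i, j). A $$ (i div dim_row B, j div dim_col B) * B $$ (i mod dim_row B, j mod dim_col B))"

definition tensor_vec :: "complex vec \<Rightarrow> complex vec \<Rightarrow> complex vec" where
  "tensor_vec v w = vec (dim_vec v * dim_vec w)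
     (\<lambda>i. v $ (i div dim_vec w) * w $ (i mod dim_vec w))"

definition mat_trace :: "complex mat \<Rightarrow> complex" where
  "mat_trace A = (\<Sum>i<dim_row A. A $$ (i, i))"

definition mat_family_sum ::
  "nat \<Rightarrow> nat \<Rightarrow> ('i \<Rightarrow> complex mat) \<Rightarrow> 'i set \<Rightarrow> complex mat" where
  "mat_family_sum m n A I = mat m n (\<lambda>ij. \<Sum>k\<in>I. A k $$ ij)"

text \<open>\<open>quad_form A v\<close> is \<open>\<langle>v|A|v\<rangle>\<close>.\<close>

definition quad_form :: "complex mat \<Rightarrow> complex vec \<Rightarrow> complex" where
  "quad_form A v = (A *\<^sub>v v) \<bullet>c v"

text \<open>
  The order on \<open>complex\<close> is that of \<^theory>\<open>HOL-Library.Complex_Order\<close>: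
  \<open>0 \<le> z\<close> says that \<open>z\<close> is real and nonnegative.
\<close>

definition pos_semidef :: "nat \<Rightarrow> complex mat \<Rightarrow> bool" where
  "pos_semidef d A \<longleftrightarrow>
     A \<in> carrier_mat d d \<and> mat_adjoint A = A \<and> (\<forall>v\<in>carrier_vec d. 0 \<le> quad_form A v)"

definition density_operator :: "nat \<Rightarrow> complex mat \<Rightarrow> bool" where
  "density_operator d \<rho> \<longleftrightarrow> pos_semidef d \<rho> \<and> mat_trace \<rho> = 1"

definition separable_state :: "nat \<Rightarrow> nat \<Rightarrow> complex mat \<Rightarrow> bool" where
  "separable_state dA dB \<rho> \<longleftrightarrow>
     (\<exists>(N::nat) (p :: nat \<Rightarrow> real) \<alpha> \<beta>.
        (\<forall>k<N. 0 \<le> p k \<and> density_operator dA (\<alpha> k) \<and> density_operator dB (\<beta> k)) \<and>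
        (\<Sum>k<N. p k) = 1 \<and>
        \<rho> = mat_family_sum (dA * dB) (dA * dB)
              (\<lambda>k. complex_of_real (p k) \<cdot>\<^sub>m tensor_mat (\<alpha> k) (\<beta> k)) {..<N})"

definition entangled_state :: "nat \<Rightarrow> nat \<Rightarrow> complex mat \<Rightarrow> bool" where
  "entangled_state dA dB \<rho> \<longleftrightarrow> density_operator (dA * dB) \<rho> \<and> \<not> separable_state dA dB \<rho>"

definition unitary_mat :: "nat \<Rightarrow> complex mat \<Rightarrow> bool" where
  "unitary_mat d U \<longleftrightarrow>
     U \<in> carrier_mat d d \<and> mat_adjoint U * U = 1\<^sub>m d \<and> U * mat_adjoint U = 1\<^sub>m d"

definition bell_vec :: "complex vec" where
  "bell_vec = complex_of_real (1 / sqrt 2) \<cdot>\<^sub>v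
     (tensor_vec (unit_vec 2 0) (unit_vec 2 0) + tensor_vec (unit_vec 2 1) (unit_vec 2 1))"

definition max_entangled_vecs :: "complex vec set" where
  "max_entangled_vecs = {tensor_mat U V *\<^sub>v bell_vec | U V. unitary_mat 2 U \<and> unitary_mat 2 V}"

text \<open>
  The supremum is a maximum, since the maximally entangled unit vectors form a compact set.
  The real part only serves to obtain a real number: \<open>quad_form \<rho> \<psi>\<close> is real for Hermitian \<open>\<rho>\<close>.
\<close>

definition fidelity :: "complex mat \<Rightarrow> real" where
  "fidelity \<rho> = (SUP \<psi>\<in>max_entangled_vecs. Re (quad_form \<rho> \<psi>))"

text \<open>
  \<open>apply_left m n k \<Phi>\<close> is \<open>\<Phi> \<otimes> id\<^sub>k\<close> and \<open>apply_right k m n \<Phi>\<close> is \<open>id\<^sub>k \<otimes> \<Phi>\<close>, for a linear map \<open>\<Phi>\<close>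
  from \<open>m \<times> m\<close> to \<open>n \<times> n\<close> matrices: \<open>\<Phi>\<close> is applied to each of the \<open>m \<times> m\<close> blocks obtained by
  fixing the row and column indices of the factor \<open>\<complex>\<^sup>k\<close>.
\<close>

definition apply_left ::
  "nat \<Rightarrow> nat \<Rightarrow> nat \<Rightarrow> (complex mat \<Rightarrow> complex mat) \<Rightarrow> complex mat \<Rightarrow> complex mat" where
  "apply_left m n k \<Phi> X = mat (n * k) (n * k)
     (\<lambda>(r, s). \<Phi> (mat m m (\<lambda>(i, j). X $$ (i * k + r mod k, j * k + s mod k))) $$ (r div k, s div k))"

definition apply_right ::
  "nat \<Rightarrow> nat \<Rightarrow> nat \<Rightarrow> (complex mat \<Rightarrow> complex mat) \<Rightarrow> complex mat \<Rightarrow> complex mat" where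
  "apply_right k m n \<Phi> X = mat (k * n) (k * n)
     (\<lambda>(r, s). \<Phi> (mat m m (\<lambda>(i, j). X $$ ((r div n) * m + i, (s div n) * m + j))) $$ (r mod n, s mod n))"

definition linear_superop :: "nat \<Rightarrow> nat \<Rightarrow> (complex mat \<Rightarrow> complex mat) \<Rightarrow> bool" where
  "linear_superop m n \<Phi> \<longleftrightarrow>
     (\<forall>X\<in>carrier_mat m m. \<Phi> X \<in> carrier_mat n n) \<and>
     (\<forall>X\<in>carrier_mat m m. \<forall>Y\<in>carrier_mat m m. \<Phi> (X + Y) = \<Phi> X + \<Phi> Y) \<and>
     (\<forall>c. \<forall>X\<in>carrier_mat m m. \<Phi> (c \<cdot>\<^sub>m X) = c \<cdot>\<^sub>m \<Phi> X)"

definition completely_positive :: "nat \<Rightarrow> nat \<Rightarrow> (complex mat \<Rightarrow> complex mat) \<Rightarrow> bool" where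
  "completely_positive m n \<Phi> \<longleftrightarrow>
     linear_superop m n \<Phi> \<and>
     (\<forall>k X. pos_semidef (m * k) X \<longrightarrow> pos_semidef (n * k) (apply_left m n k \<Phi> X))"

definition cptp :: "nat \<Rightarrow> nat \<Rightarrow> (complex mat \<Rightarrow> complex mat) \<Rightarrow> bool" where
  "cptp m n \<Phi> \<longleftrightarrow>
     completely_positive m n \<Phi> \<and> (\<forall>X\<in>carrier_mat m m. mat_trace (\<Phi> X) = mat_trace X)"

text \<open>
  An instrument with outcomes \<open>j < N\<close>: completely positive maps whose sum preserves the trace.
\<close>

definition instrument ::
  "nat \<Rightarrow> nat \<Rightarrow> nat \<Rightarrow> (nat \<Rightarrow> complex mat \<Rightarrow> complex mat) \<Rightarrow> bool" where
  "instrument m n N E \<longleftrightarrow>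
     (\<forall>j<N. completely_positive m n (E j)) \<and>
     (\<forall>X\<in>carrier_mat m m. (\<Sum>j<N. mat_trace (E j X)) = mat_trace X)"

text \<open>
  \<open>locc_protocol eA eB dA dB \<Lambda>\<close>: the map \<open>\<Lambda>\<close> from \<open>\<complex>\<^sup>d\<^sup>A \<otimes> \<complex>\<^sup>d\<^sup>B\<close> to \<open>\<complex>\<^sup>e\<^sup>A \<otimes> \<complex>\<^sup>e\<^sup>B\<close> is realized by
  finitely many rounds. In a round one party applies an instrument to its own factor, which may
  change the dimension of that factor, and announces the outcome \<open>j\<close>; the remaining protocol
  \<open>\<Lambda> j\<close> may depend on it. The channel realized is the sum over all outcomes.
\<close>

inductive locc_protocol ::
  "nat \<Rightarrow> nat \<Rightarrow> nat \<Rightarrow> nat \<Rightarrow> (complex mat \<Rightarrow> complex mat) \<Rightarrow> bool"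
  for eA eB :: nat where
  finish: "locc_protocol eA eB eA eB (\<lambda>X. X)"
| alice: "instrument dA dA' N E \<Longrightarrow>
    (\<And>j. j < N \<Longrightarrow> locc_protocol eA eB dA' dB (\<Lambda> j)) \<Longrightarrow>
    locc_protocol eA eB dA dB
      (\<lambda>X. mat_family_sum (eA * eB) (eA * eB) (\<lambda>j. \<Lambda> j (apply_left dA dA' dB (E j) X)) {..<N})"
| bob: "instrument dB dB' N E \<Longrightarrow>
    (\<And>j. j < N \<Longrightarrow> locc_protocol eA eB dA dB' (\<Lambda> j)) \<Longrightarrow>
    locc_protocol eA eB dA dB
      (\<lambda>X. mat_family_sum (eA * eB) (eA * eB) (\<lambda>j. \<Lambda> j (apply_right dA dB dB' (E j) X)) {..<N})"

definition tp_locc :: "nat \<Rightarrow> nat \<Rightarrow> nat \<Rightarrow> nat \<Rightarrow> (complex mat \<Rightarrow> complex mat) \<Rightarrow> bool" where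
  "tp_locc dA dB eA eB \<Lambda> \<longleftrightarrow> cptp (dA * dB) (eA * eB) \<Lambda> \<and> locc_protocol eA eB dA dB \<Lambda>"

end

theory Submission
  imports Defs
begin

text \<open>
  LOCC maps preserve the cone of sums of products of positive operators, and on this cone a
  maximally entangled vector has expectation at most half the trace. This settles one direction.

  For the other direction, write \<open>\<rho> = N * mat_adjoint N\<close> where, by Takagi's factorization, the
  symmetric matrix \<open>transpose_mat N * spin_flip * N\<close> is diagonal with entries \<open>l i \<ge> 0\<close>. The
  determinant of the partial transpose of \<open>\<rho>\<close> is a polynomial in the \<open>l i\<close>; if the partial transpose
  is positive, no \<open>l i\<close> exceeds the sum of the others, and then Wootters' construction
  writes \<open>\<rho>\<close> as a mixture of four product vectors. So an entangled \<open>\<rho>\<close> has a vector \<open>\<phi>\<close> with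
  negative expectation in the partial transpose. Reading \<open>\<phi>\<close> as a filter \<open>K\<close> for Alice turns this
  expectation into that of the swap operator, whose only negative eigenvector is the singlet, in
  the filtered state. The singlet fraction therefore exceeds half the success probability;
  replacing the state by a product state with singlet fraction \<open>1/2\<close> on failure keeps the total
  above \<open>1/2\<close>.
\<close>

section \<open>Positive semidefinite matrices\<close>

text \<open>Takagi's form is the right normal form because of two facts. Replacing \<open>N\<close>
  by \<open>N * V\<close> with \<open>V\<close> unitary leaves \<open>N * mat_adjoint N\<close>
  unchanged but changes \<open>transpose_mat N * spin_flip * N\<close> by the congruence
  \<open>transpose_mat V * _ * V\<close>. And the diagonal of that matrix measures how far the
  columns of \<open>N\<close> are from being product vectors. So the task is to make the diagonal
  vanish by a congruence, which is possible when phases can be attached to the \<open>l i\<close> so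
  that they sum to zero, that is, when they are the sides of a closed quadrilateral.

  The determinant alone decides this: of the four factors \<open>(\<Sum>j. l j) - 2 * l i\<close> at
  most one can be negative, so a nonnegative product forces all four to be nonnegative.

  On the other side, the swap operator is the identity minus twice the projector onto the singlet.
  Its expectation in an unnormalized state is the trace minus twice the singlet expectation, so a
  negative value is already the strict inequality wanted, without any optimization over
  filters.\<close>

lemma mat_adjoint_carrier [simp]:
  "A \<in> carrier_mat m n \<Longrightarrow> mat_adjoint A \<in> carrier_mat n m"
  unfolding mat_adjoint_def by auto

lemma dim_mat_adjoint [simp]:
  "dim_row (mat_adjoint A) = dim_col A" "dim_col (mat_adjoint A) = dim_row A"
  unfolding mat_adjoint_def by auto

lemma index_mat_adjoint [simp]:
  fixes A :: "complex mat"
  shows "i < dim_col A \<Longrightarrow> j < dim_row A \<Longrightarrow> mat_adjoint A $$ (i, j) = cnj (A $$ (j, i))"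
  unfolding mat_adjoint_def by (simp add: mat_of_rows_index)

lemma mat_adjoint_adjoint [simp]: "mat_adjoint (mat_adjoint A) = (A :: complex mat)"
  by (rule eq_matI) auto

lemma index_mult_mat_sum:
  "i < dim_row A \<Longrightarrow> j < dim_col B \<Longrightarrow> dim_row B = dim_col A \<Longrightarrow>
    (A * B) $$ (i, j) = (\<Sum>k<dim_col A. A $$ (i, k) * B $$ (k, j))"
  by (simp add: scalar_prod_def atLeast0LessThan)

lemma index_mult_mat_vec_sum:
  "i < dim_row A \<Longrightarrow> dim_vec v = dim_col A \<Longrightarrow>
    (A *\<^sub>v v) $ i = (\<Sum>k<dim_col A. A $$ (i, k) * v $ k)"
  by (simp add: scalar_prod_def atLeast0LessThan)

lemma mult_mat_vec_carrier_iff [simp]: "A *\<^sub>v v \<in> carrier_vec n \<longleftrightarrow> dim_row A = n"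
  by (simp only: carrier_dim_vec dim_mult_mat_vec)

lemma mult_mat_carrier_iff [simp]:
  "A * B \<in> carrier_mat m n \<longleftrightarrow> dim_row A = m \<and> dim_col B = n"
  by (metis carrier_matD carrier_matI index_mult_mat(2,3))

lemma mat_adjoint_mult:
  fixes A B :: "complex mat"
  assumes "A \<in> carrier_mat m n" "B \<in> carrier_mat n p"
  shows "mat_adjoint (A * B) = mat_adjoint B * mat_adjoint A"
  using assms
  by (intro eq_matI) (auto simp: index_mult_mat_sum mult.commute simp del: index_mult_mat(1))

lemma mat_adjoint_one [simp]: "mat_adjoint (1\<^sub>m n) = (1\<^sub>m n :: complex mat)"
  by (rule eq_matI) auto

lemma quad_form_sum:
  assumes "A \<in> carrier_mat n n" "v \<in> carrier_vec n"
  shows "quad_form A v = (\<Sum>i<n. \<Sum>j<n. cnj (v $ i) * A $$ (i, j) * v $ j)"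
proof -
  have "quad_form A v = (\<Sum>i<n. (A *\<^sub>v v) $ i * cnj (v $ i))"
    using assms unfolding quad_form_def scalar_prod_def by (simp add: atLeast0LessThan)
  also have "\<dots> = (\<Sum>i<n. \<Sum>j<n. cnj (v $ i) * A $$ (i, j) * v $ j)"
    using assms
    by (intro sum.cong refl) (simp add: index_mult_mat_vec_sum sum_distrib_left sum_distrib_right mult_ac
        del: index_mult_mat_vec)
  finally show ?thesis .
qed

lemma inner_adjoint:
  fixes M :: "complex mat"
  assumes "M \<in> carrier_mat m n" "x \<in> carrier_vec n" "y \<in> carrier_vec m"
  shows "(M *\<^sub>v x) \<bullet>c y = x \<bullet>c (mat_adjoint M *\<^sub>v y)"
proof -
  have "(M *\<^sub>v x) \<bullet>c y = (\<Sum>i<m. \<Sum>j<n. M $$ (i, j) * x $ j * cnj (y $ i))"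
    using assms by (simp add: scalar_prod_def atLeast0LessThan index_mult_mat_vec_sum
        sum_distrib_right del: index_mult_mat_vec)
  also have "\<dots> = (\<Sum>j<n. \<Sum>i<m. M $$ (i, j) * x $ j * cnj (y $ i))"
    by (rule sum.swap)
  also have "\<dots> = x \<bullet>c (mat_adjoint M *\<^sub>v y)"
    using assms by (auto simp: scalar_prod_def atLeast0LessThan index_mult_mat_vec_sum
        sum_distrib_left mult_ac simp del: index_mult_mat_vec intro!: sum.cong)
  finally show ?thesis .
qed

lemma quad_form_conjugation:
  assumes "A \<in> carrier_mat n n" "M \<in> carrier_mat m n" "v \<in> carrier_vec m"
  shows "quad_form (M * A * mat_adjoint M) v = quad_form A (mat_adjoint M *\<^sub>v v)"
proof -
  have M': "mat_adjoint M \<in> carrier_mat n m"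
    using assms by simp
  have "(M * A * mat_adjoint M) *\<^sub>v v = (M * A) *\<^sub>v (mat_adjoint M *\<^sub>v v)"
    using assms M' by (intro assoc_mult_mat_vec) auto
  also have "\<dots> = M *\<^sub>v (A *\<^sub>v (mat_adjoint M *\<^sub>v v))"
    using assms M' by (intro assoc_mult_mat_vec) auto
  finally have eq: "(M * A * mat_adjoint M) *\<^sub>v v = M *\<^sub>v (A *\<^sub>v (mat_adjoint M *\<^sub>v v))" .
  show ?thesis
    unfolding quad_form_def eq by (rule inner_adjoint) (use assms in auto)
qed

lemma hermitian_conjugation:
  assumes "A \<in> carrier_mat n n" "M \<in> carrier_mat m n" "mat_adjoint A = A"
  shows "mat_adjoint (M * A * mat_adjoint M) = M * A * mat_adjoint (M :: complex mat)"
proof -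
  have "mat_adjoint (M * A * mat_adjoint M) = M * mat_adjoint (M * A)"
    using assms by (subst mat_adjoint_mult[of _ m n _ m]) auto
  also have "mat_adjoint (M * A) = A * mat_adjoint M"
    using assms by (subst mat_adjoint_mult[of _ m n _ n]) auto
  also have "M * (A * mat_adjoint M) = M * A * mat_adjoint M"
    using assms by (intro assoc_mult_mat[symmetric]) auto
  finally show ?thesis .
qed

lemma pos_semidef_conjugation:
  assumes "pos_semidef n A" "M \<in> carrier_mat m n"
  shows "pos_semidef m (M * A * mat_adjoint M)"
  using assms unfolding pos_semidef_def
  by (auto simp: hermitian_conjugation quad_form_conjugation)

lemma pos_semidef_zero: "pos_semidef n (0\<^sub>m n n)"
  unfolding pos_semidef_def by (auto simp: quad_form_sum[of _ n])

lemma pos_semidef_add: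
  assumes "pos_semidef n A" "pos_semidef n B"
  shows "pos_semidef n (A + B)"
  unfolding pos_semidef_def
proof (intro conjI ballI)
  have c: "A \<in> carrier_mat n n" "B \<in> carrier_mat n n"
    and h: "mat_adjoint A = A" "mat_adjoint B = B"
    using assms unfolding pos_semidef_def by auto
  show "A + B \<in> carrier_mat n n" using c by auto
  have "mat_adjoint (A + B) = mat_adjoint A + mat_adjoint B"
    using c by (intro eq_matI) auto
  then show "mat_adjoint (A + B) = A + B"
    by (simp only: h)
  fix v :: "complex vec" assume v: "v \<in> carrier_vec n"
  have "quad_form (A + B) v = quad_form A v + quad_form B v"
    using c v by (simp add: quad_form_sum[of _ n] ring_distribs sum.distrib)
  then show "0 \<le> quad_form (A + B) v"
    using assms v unfolding pos_semidef_def by auto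
qed

lemma index_mat_family_sum [simp]:
  "i < m \<Longrightarrow> j < n \<Longrightarrow> mat_family_sum m n A I $$ (i, j) = (\<Sum>k\<in>I. A k $$ (i, j))"
  by (simp add: mat_family_sum_def)

lemma dim_mat_family_sum [simp]:
  "dim_row (mat_family_sum m n A I) = m" "dim_col (mat_family_sum m n A I) = n"
  by (simp_all add: mat_family_sum_def)

lemma mat_family_sum_carrier [simp]: "mat_family_sum m n A I \<in> carrier_mat m n"
  by (simp add: mat_family_sum_def)

lemma mat_family_sum_empty: "mat_family_sum m n A {} = 0\<^sub>m m n"
  by (rule eq_matI) auto

lemma mat_family_sum_insert:
  assumes "finite I" "k \<notin> I" "A k \<in> carrier_mat m n"
  shows "mat_family_sum m n A (insert k I) = A k + mat_family_sum m n A I"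
  using assms by (intro eq_matI) auto

lemma pos_semidef_family_sum:
  assumes "finite I" "\<And>k. k \<in> I \<Longrightarrow> pos_semidef n (A k)"
  shows "pos_semidef n (mat_family_sum n n A I)"
  using assms
proof (induction I)
  case empty
  then show ?case by (simp add: mat_family_sum_empty pos_semidef_zero)
next
  case (insert k I)
  then have "mat_family_sum n n A (insert k I) = A k + mat_family_sum n n A I"
    by (intro mat_family_sum_insert) (auto simp: pos_semidef_def)
  with insert show ?case by (simp add: pos_semidef_add)
qed

lemma pos_semidef_one: "pos_semidef n (1\<^sub>m n)"
  unfolding pos_semidef_def
  by (auto simp: quad_form_def intro: conjugate_square_ge_0_vec)

lemma pos_semidef_gram:
  assumes "M \<in> carrier_mat n k"
  shows "pos_semidef n (M * mat_adjoint M)"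
  using pos_semidef_conjugation[OF pos_semidef_one assms] assms by simp

section \<open>Unitary congruence\<close>

lemma unitary_matD:
  assumes "unitary_mat n U"
  shows "U \<in> carrier_mat n n" "mat_adjoint U * U = 1\<^sub>m n" "U * mat_adjoint U = 1\<^sub>m n"
  using assms by (auto simp: unitary_mat_def)

text \<open>For square matrices a left inverse is also a right inverse.\<close>

lemma unitary_matI:
  assumes "U \<in> carrier_mat n n" "mat_adjoint U * U = 1\<^sub>m n"
  shows "unitary_mat n U"
  using assms mat_mult_left_right_inverse[of "mat_adjoint U" n U] by (auto simp: unitary_mat_def)

lemma unitary_mat_mult:
  assumes "unitary_mat n U" "unitary_mat n V"
  shows "unitary_mat n (U * V)"
proof (rule unitary_matI)
  note U = unitary_matD[OF assms(1)] and V = unitary_matD[OF assms(2)]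
  show "U * V \<in> carrier_mat n n" using U V by auto
  have "mat_adjoint (U * V) * (U * V) = mat_adjoint V * (mat_adjoint U * U) * V"
    using U(1) V(1) by (simp add: mat_adjoint_mult[of U n n V n] assoc_mult_mat[of _ n n _ n _ n])
  then show "mat_adjoint (U * V) * (U * V) = 1\<^sub>m n"
    using U V by simp
qed

lemma inner_self_eq: "v \<bullet>c v = complex_of_real (\<Sum>i<dim_vec v. (cmod (v $ i))\<^sup>2)"
  by (simp add: scalar_prod_def atLeast0LessThan complex_norm_square del: of_real_power)

lemma nonzero_vec_norm_pos:
  assumes "v \<noteq> 0\<^sub>v (dim_vec v)"
  shows "(\<Sum>i<dim_vec v. (cmod (v $ i))\<^sup>2) > 0"
proof -
  obtain i where "i < dim_vec v" "v $ i \<noteq> 0"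
    using assms by (metis eq_vecI index_zero_vec)
  then show ?thesis by (intro sum_pos2[of _ i]) auto
qed

lemma normalize_vec:
  assumes "v \<in> carrier_vec n" "v \<noteq> 0\<^sub>v n"
  obtains r :: real where "r > 0" "(complex_of_real r \<cdot>\<^sub>v v) \<bullet>c (complex_of_real r \<cdot>\<^sub>v v) = 1"
proof -
  define s where "s = (\<Sum>i<dim_vec v. (cmod (v $ i))\<^sup>2)"
  have s: "s > 0" using nonzero_vec_norm_pos[of v] assms by (auto simp: s_def)
  have eq: "(complex_of_real c \<cdot>\<^sub>v v) \<bullet>c (complex_of_real c \<cdot>\<^sub>v v) = complex_of_real (c\<^sup>2 * s)" for c
    by (simp add: inner_self_eq s_def norm_mult power_mult_distrib sum_distrib_left)
  have "(1 / sqrt s)\<^sup>2 * s = 1"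
    using s by (simp add: power_divide)
  then show ?thesis using s eq[of "1 / sqrt s"] by (intro that[of "1 / sqrt s"]) (simp_all only: divide_simps, simp_all)
qed

text \<open>Complete \<open>u\<close> to a basis, orthogonalize, and rescale:
  \<open>gram_schmidt\<close> yields orthogonal vectors that need not have norm 1.\<close>

lemma unitary_mat_with_first_col:
  assumes u: "u \<in> carrier_vec n" and u1: "u \<bullet>c u = 1"
  obtains U where "unitary_mat n U" "col U 0 = u"
proof -
  interpret cof_vec_space n "TYPE(complex)" .
  have n: "n \<noteq> 0" using u u1 by (cases n) (auto simp: scalar_prod_def)
  have u0: "u \<noteq> 0\<^sub>v n" using u u1 by auto
  define b where "b = basis_completion u"
  define ws where "ws = gram_schmidt n b"
  from basis_completion[OF u u0, folded b_def]
  have b: "distinct b" "\<not> lin_dep (set b)" "set b \<subseteq> carrier_vec n" "hd b = u" "length b = n"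
    by auto
  then obtain vs where bv: "b = u # vs" using n by (cases b) auto
  from gram_schmidt_result[OF b(3,1,2) refl, folded ws_def]
  have ws: "set ws \<subseteq> carrier_vec n" "corthogonal ws" "length ws = n" by (auto simp: b)
  from gram_schmidt_hd[OF u, of vs, folded bv] have "hd ws = u" unfolding ws_def .
  then have ws0: "ws ! 0 = u" using ws(3) n by (cases ws) auto
  have carr: "ws ! i \<in> carrier_vec n" if "i < n" for i
    using that ws by auto
  have nz: "ws ! i \<bullet>c ws ! i \<noteq> 0" if "i < n" for i
    using corthogonalD[OF ws(2), of i i] that ws(3) by simp
  then have "ws ! i \<noteq> 0\<^sub>v n" if "i < n" for i
    using that by force
  then have "\<exists>r. r > 0 \<and> (complex_of_real r \<cdot>\<^sub>v ws ! i) \<bullet>c (complex_of_real r \<cdot>\<^sub>v ws ! i) = 1" if "i < n" for i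
    using normalize_vec[OF carr[OF that]] that by metis
  then obtain r where r: "\<And>i. i < n \<Longrightarrow>
      (complex_of_real (r i) \<cdot>\<^sub>v ws ! i) \<bullet>c (complex_of_real (r i) \<cdot>\<^sub>v ws ! i) = 1" by metis
  \<comment> \<open>Index 0 keeps \<open>u\<close> itself, which already has norm 1, so that the
    first column is exactly \<open>u\<close>.\<close>
  define us where "us i = (if i = 0 then u else complex_of_real (r i) \<cdot>\<^sub>v ws ! i)" for i
  define U where "U = mat n n (\<lambda>(i, j). us j $ i)"
  have usc: "us i \<in> carrier_vec n" if "i < n" for i
    using that carr u by (auto simp: us_def)
  have orth: "us i \<bullet>c us j = 0" if "i < n" "j < n" "i \<noteq> j" for i j
  proof -
    have "ws ! i \<bullet>c ws ! j = 0"
      using corthogonalD[OF ws(2), of i j] that ws(3) by simp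
    moreover have "\<exists>c. us i = c \<cdot>\<^sub>v ws ! i" for i
    proof (cases "i = 0")
      case True
      then have "us i = 1 \<cdot>\<^sub>v ws ! i" by (simp add: us_def ws0)
      then show ?thesis by blast
    qed (auto simp: us_def)
    then obtain c d where "us i = c \<cdot>\<^sub>v ws ! i" "us j = d \<cdot>\<^sub>v ws ! j" by metis
    moreover have "dim_vec (ws ! i) = n" "dim_vec (ws ! j) = n"
      using carr that by auto
    ultimately show ?thesis
      by (simp add: conjugate_smult_vec)
  qed
  have norm1: "us i \<bullet>c us i = 1" if "i < n" for i
    using r[OF that] u1 by (auto simp: us_def)
  have "(mat_adjoint U * U) $$ (i, j) = us j \<bullet>c us i" if "i < n" "j < n" for i j
    using that usc[OF that(1)] unfolding U_def
    by (subst index_mult_mat_sum) (auto simp: scalar_prod_def atLeast0LessThan mult.commute)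
  then have "mat_adjoint U * U = 1\<^sub>m n"
    using orth norm1 by (intro eq_matI) (auto simp: U_def)
  then have "unitary_mat n U"
    by (intro unitary_matI) (auto simp: U_def)
  moreover have "col U 0 = u"
    using n u by (intro eq_vecI) (auto simp: U_def us_def)
  ultimately show ?thesis by (rule that)
qed

section \<open>Diagonalization by unitary congruence\<close>

lemma mat_adjoint_four_block:
  assumes "A \<in> carrier_mat nr1 nc1" "B \<in> carrier_mat nr1 nc2"
    "C \<in> carrier_mat nr2 nc1" "D \<in> carrier_mat nr2 nc2"
  shows "mat_adjoint (four_block_mat A B C D) =
    four_block_mat (mat_adjoint A) (mat_adjoint C) (mat_adjoint B) (mat_adjoint (D :: complex mat))"
  using assms by (intro eq_matI) auto

lemma unitary_four_block:
  assumes "unitary_mat n V"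
  shows "unitary_mat (Suc n) (four_block_mat (1\<^sub>m 1) (0\<^sub>m 1 n) (0\<^sub>m n 1) V)"
    (is "unitary_mat _ ?W")
proof (rule unitary_matI)
  note V = unitary_matD[OF assms]
  show "?W \<in> carrier_mat (Suc n) (Suc n)" using V by auto
  have z: "mat_adjoint (0\<^sub>m k m) = (0\<^sub>m m k :: complex mat)" for k m
    by (rule eq_matI) auto
  have "mat_adjoint ?W = four_block_mat (1\<^sub>m 1) (0\<^sub>m 1 n) (0\<^sub>m n 1) (mat_adjoint V)"
    using V by (subst mat_adjoint_four_block) (auto simp: z)
  moreover have "\<dots> * ?W = four_block_mat (1\<^sub>m 1) (0\<^sub>m 1 n) (0\<^sub>m n 1) (1\<^sub>m n)"
    using V by (subst mult_four_block_mat[of _ 1 1 _ n _ n _ _ 1 _ n]) auto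
  ultimately show "mat_adjoint ?W * ?W = 1\<^sub>m (Suc n)"
    by (simp del: One_nat_def) (rule eq_matI; auto)
qed

text \<open>For \<open>f\<close> the identity this is the transpose, for \<open>f = cnj\<close> the
  adjoint. The parameter lets one deflation argument serve both the spectral theorem for Hermitian
  matrices and Takagi's factorization of symmetric ones.\<close>

definition star :: "(complex \<Rightarrow> complex) \<Rightarrow> complex mat \<Rightarrow> complex mat" where
  "star f A = transpose_mat (map_mat f A)"

lemma star_id: "star (\<lambda>x. x) A = transpose_mat A"
  unfolding star_def by (rule eq_matI) auto

lemma star_cnj: "star cnj A = mat_adjoint A"
  unfolding star_def by (rule eq_matI) auto

lemma dim_star [simp]: "dim_row (star f A) = dim_col A" "dim_col (star f A) = dim_row A"
  by (simp_all add: star_def)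

lemma star_carrier [simp]: "A \<in> carrier_mat m n \<Longrightarrow> star f A \<in> carrier_mat n m"
  by (simp add: star_def)

lemma index_star [simp]:
  "i < dim_col A \<Longrightarrow> j < dim_row A \<Longrightarrow> star f A $$ (i, j) = f (A $$ (j, i))"
  by (simp add: star_def)

context
  fixes f :: "complex \<Rightarrow> complex"
  assumes f: "f = (\<lambda>x. x) \<or> f = cnj"
begin

lemma automorphism:
  "f (x + y) = f x + f y" "f (x * y) = f x * f y" "f 0 = 0" "f 1 = 1" "f (sum g I) = (\<Sum>i\<in>I. f (g i))"
  "f (f x) = x" "f (cnj x) = cnj (f x)"
  using f by auto

lemma star_mult:
  assumes "A \<in> carrier_mat m n" "B \<in> carrier_mat n p"
  shows "star f (A * B) = star f B * star f A"
  using assms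
  by (intro eq_matI) (auto simp: index_mult_mat_sum automorphism mult.commute simp del: index_mult_mat(1))

lemma star_conjugation:
  assumes "A \<in> carrier_mat n n" "U \<in> carrier_mat n n" "star f A = A"
  shows "star f (star f U * A * U) = star f U * A * U"
proof -
  have "star f (star f U) = U" by (rule eq_matI) (auto simp: automorphism)
  moreover have "star f (star f U * A * U) = star f U * star f (star f U * A)"
    using assms by (intro star_mult) auto
  moreover have "star f (star f U * A) = star f A * star f (star f U)"
    using assms by (intro star_mult) auto
  moreover have "star f U * (A * U) = star f U * A * U"
    using assms by (intro assoc_mult_mat[symmetric]) auto
  ultimately show ?thesis by (simp only: assms(3))
qed

text \<open>The equation \<open>ev\<close> says that \<open>u\<close> is an eigenvector if
  \<open>f = cnj\<close>, and that \<open>A\<close> maps \<open>u\<close> to a multiple of its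
  conjugate if \<open>f\<close> is the identity. In both cases column 0 of
  \<open>star f U * A * U\<close> is \<open>\<mu>\<close> times column 0 of
  \<open>mat_adjoint U * U\<close>, up to \<open>f\<close> and conjugation, hence
  \<open>\<mu>\<close> followed by zeros. The symmetry \<open>star f M = M\<close> then clears row 0
  as well.\<close>

lemma congruence_deflation:
  assumes A: "A \<in> carrier_mat (Suc n) (Suc n)" "star f A = A"
    and u: "u \<in> carrier_vec (Suc n)" "u \<bullet>c u = 1"
    and ev: "A *\<^sub>v u = \<mu> \<cdot>\<^sub>v map_vec (\<lambda>x. cnj (f x)) u"
  obtains U B where "unitary_mat (Suc n) U" "B \<in> carrier_mat n n" "star f B = B"
    "star f U * A * U = four_block_mat (mat 1 1 (\<lambda>_. \<mu>)) (0\<^sub>m 1 n) (0\<^sub>m n 1) B"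
proof -
  obtain U where U: "unitary_mat (Suc n) U" and col: "col U 0 = u"
    using unitary_mat_with_first_col[OF u] by blast
  note Uc = unitary_matD[OF U]
  define M where "M = star f U * A * U"
  have Mc: "M \<in> carrier_mat (Suc n) (Suc n)" using Uc A by (auto simp: M_def)
  have sM: "star f M = M"
    unfolding M_def by (rule star_conjugation) (use A Uc in auto)
  have col0: "M $$ (i, 0) = (if i = 0 then \<mu> else 0)" if "i < Suc n" for i
  proof -
    have "M = star f U * (A * U)"
      unfolding M_def using Uc A by (intro assoc_mult_mat) auto
    then have "M $$ (i, 0) = (\<Sum>k<Suc n. f (U $$ (k, i)) * (A * U) $$ (k, 0))"
      using Uc A that by (simp add: index_mult_mat_sum del: index_mult_mat(1) sum.lessThan_Suc)
    also have "\<dots> = (\<Sum>k<Suc n. f (U $$ (k, i)) * (\<mu> * cnj (f (U $$ (k, 0)))))"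
    proof (intro sum.cong refl)
      fix k assume k: "k \<in> {..<Suc n}"
      have "(A * U) $$ (k, 0) = (A *\<^sub>v u) $ k"
        using k Uc A col by auto
      also have "\<dots> = \<mu> * cnj (f (U $$ (k, 0)))"
        unfolding ev using k u Uc by (auto simp flip: col)
      finally show "f (U $$ (k, i)) * (A * U) $$ (k, 0) = f (U $$ (k, i)) * (\<mu> * cnj (f (U $$ (k, 0))))"
        by simp
    qed
    also have "\<dots> = \<mu> * f (cnj ((mat_adjoint U * U) $$ (i, 0)))"
      using Uc(1) that by (simp add: index_mult_mat_sum automorphism sum_distrib_left mult_ac
          del: index_mult_mat(1) sum.lessThan_Suc)
    also have "\<dots> = (if i = 0 then \<mu> else 0)"
      using that by (simp add: Uc(2) automorphism)
    finally show ?thesis .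
  qed
  have row0: "M $$ (0, i) = (if i = 0 then \<mu> else 0)" if "i < Suc n" for i
  proof -
    have "M $$ (0, i) = star f M $$ (0, i)" by (simp add: sM)
    also have "\<dots> = f (M $$ (i, 0))" using Mc that by auto
    finally show ?thesis using col0 that by (auto simp: automorphism)
  qed
  define B where "B = mat n n (\<lambda>(i, j). M $$ (Suc i, Suc j))"
  have B: "B \<in> carrier_mat n n" by (simp add: B_def)
  have sB: "star f B = B"
  proof (rule eq_matI)
    fix i j assume "i < dim_row B" "j < dim_col B"
    then have ij: "i < n" "j < n" by (auto simp: B_def)
    have "star f B $$ (i, j) = star f M $$ (Suc i, Suc j)"
      using Mc ij by (auto simp: B_def)
    then show "star f B $$ (i, j) = B $$ (i, j)"
      using ij by (simp add: sM B_def)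
  qed (auto simp: B_def)
  have "M = four_block_mat (mat 1 1 (\<lambda>_. \<mu>)) (0\<^sub>m 1 n) (0\<^sub>m n 1) B"
  proof (rule eq_matI)
    fix i j
    assume "i < dim_row (four_block_mat (mat 1 1 (\<lambda>_. \<mu>)) (0\<^sub>m 1 n) (0\<^sub>m n 1) B)"
      "j < dim_col (four_block_mat (mat 1 1 (\<lambda>_. \<mu>)) (0\<^sub>m 1 n) (0\<^sub>m n 1) B)"
    then have ij: "i < Suc n" "j < Suc n" by (auto simp: B_def)
    then show "M $$ (i, j) = four_block_mat (mat 1 1 (\<lambda>_. \<mu>)) (0\<^sub>m 1 n) (0\<^sub>m n 1) B $$ (i, j)"
      using row0[of j] col0[of i] by (cases i; cases j) (auto simp: B_def)
  qed (use Mc in \<open>auto simp: B_def\<close>)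
  then show ?thesis
    unfolding M_def by (rule that[OF U B sB])
qed

text \<open>Induction on the dimension, deflating one vector at a time; therefore \<open>ev\<close>
  is assumed for every size. The predicate \<open>R\<close> carries a property of the single values
  \<open>\<mu>\<close> over to the whole diagonal: it is trivial in the Hermitian case and
  \<open>0 \<le> \<mu>\<close> in Takagi's.\<close>

lemma congruence_diagonalization:
  assumes ev: "\<And>n A. A \<in> carrier_mat (Suc n) (Suc n) \<Longrightarrow> star f A = A \<Longrightarrow>
      \<exists>u \<mu>. u \<in> carrier_vec (Suc n) \<and> u \<bullet>c u = 1 \<and> R \<mu> \<and>
        A *\<^sub>v u = \<mu> \<cdot>\<^sub>v map_vec (\<lambda>x. cnj (f x)) u"
    and A: "A \<in> carrier_mat n n" "star f A = A"
  shows "\<exists>U d. unitary_mat n U \<and> (\<forall>i<n. R (d i)) \<and> star f U * A * U = mat_diag n d"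
  using A
proof (induction n arbitrary: A)
  case 0
  then show ?case
    by (intro exI[of _ "1\<^sub>m 0"] exI[of _ "\<lambda>_. 0"]) (auto simp: unitary_mat_def mat_diag_def intro!: eq_matI)
next
  case (Suc n)
  obtain u \<mu> where u: "u \<in> carrier_vec (Suc n)" "u \<bullet>c u = 1" "R \<mu>"
    "A *\<^sub>v u = \<mu> \<cdot>\<^sub>v map_vec (\<lambda>x. cnj (f x)) u"
    using ev[OF Suc.prems] by blast
  obtain U B where U: "unitary_mat (Suc n) U" and B: "B \<in> carrier_mat n n" "star f B = B"
    and UAU: "star f U * A * U = four_block_mat (mat 1 1 (\<lambda>_. \<mu>)) (0\<^sub>m 1 n) (0\<^sub>m n 1) B"
    using congruence_deflation[OF Suc.prems u(1,2,4)] by blast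
  obtain V d where V: "unitary_mat n V" and d: "\<forall>i<n. R (d i)" "star f V * B * V = mat_diag n d"
    using Suc.IH[OF B] by blast
  define W where "W = four_block_mat (1\<^sub>m 1) (0\<^sub>m 1 n) (0\<^sub>m n 1) V"
  have W: "unitary_mat (Suc n) W"
    unfolding W_def by (rule unitary_four_block[OF V])
  note c = unitary_matD(1)[OF U] unitary_matD(1)[OF V] unitary_matD(1)[OF W]
  have sW: "star f W = four_block_mat (1\<^sub>m 1) (0\<^sub>m 1 n) (0\<^sub>m n 1) (star f V)"
    unfolding W_def using c by (intro eq_matI) (auto simp: automorphism)
  have "star f (U * W) * A * (U * W) = star f W * (star f U * A * U) * W"
    using c Suc.prems(1)
    by (simp add: star_mult[of U "Suc n" "Suc n" W "Suc n"]
        assoc_mult_mat[of _ "Suc n" "Suc n" _ "Suc n" _ "Suc n"])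
  also have "\<dots> = four_block_mat (1\<^sub>m 1) (0\<^sub>m 1 n) (0\<^sub>m n 1) (star f V)
      * four_block_mat (mat 1 1 (\<lambda>_. \<mu>)) (0\<^sub>m 1 n) (0\<^sub>m n 1) B * W"
    by (simp only: UAU sW)
  also have "four_block_mat (1\<^sub>m 1) (0\<^sub>m 1 n) (0\<^sub>m n 1) (star f V)
      * four_block_mat (mat 1 1 (\<lambda>_. \<mu>)) (0\<^sub>m 1 n) (0\<^sub>m n 1) B
      = four_block_mat (mat 1 1 (\<lambda>_. \<mu>)) (0\<^sub>m 1 n) (0\<^sub>m n 1) (star f V * B)"
    using c B by (subst mult_four_block_mat[of _ 1 1 _ n _ n _ _ 1 _ n]) auto
  also have "\<dots> * W = four_block_mat (mat 1 1 (\<lambda>_. \<mu>)) (0\<^sub>m 1 n) (0\<^sub>m n 1) (star f V * B * V)"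
    unfolding W_def using c B by (subst mult_four_block_mat[of _ 1 1 _ n _ n _ _ 1 _ n]) auto
  also have "\<dots> = mat_diag (Suc n) (case_nat \<mu> d)"
    unfolding d(2) by (rule eq_matI) (auto simp: mat_diag_def split: nat.splits)
  finally have "star f (U * W) * A * (U * W) = mat_diag (Suc n) (case_nat \<mu> d)" .
  moreover have "\<forall>i<Suc n. R (case_nat \<mu> d i)"
    using d(1) u(3) by (auto split: nat.splits)
  ultimately show ?case
    using unitary_mat_mult[OF U W] by blast
qed

end

section \<open>Spectral theorem, Takagi's factorization and their consequences for positive
  matrices\<close>

lemma complex_eigenvector_exists:
  assumes A: "(A :: complex mat) \<in> carrier_mat (Suc n) (Suc n)"
  obtains v k where "v \<in> carrier_vec (Suc n)" "v \<noteq> 0\<^sub>v (Suc n)" "A *\<^sub>v v = k \<cdot>\<^sub>v v"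
proof -
  have "degree (char_poly A) \<noteq> 0" using degree_monic_char_poly[OF A] by simp
  then have "\<not> constant (poly (char_poly A))" by (simp add: constant_degree)
  then obtain k where "poly (char_poly A) k = 0"
    using fundamental_theorem_of_algebra by blast
  then have "eigenvalue A k" using eigenvalue_root_char_poly[OF A] by simp
  then show ?thesis using that A by (auto simp: eigenvalue_def eigenvector_def)
qed

lemma hermitian_diagonalization:
  assumes "A \<in> carrier_mat n n" "mat_adjoint A = A"
  obtains U d where "unitary_mat n U" "mat_adjoint U * A * U = mat_diag n d"
proof -
  have "\<exists>U d. unitary_mat n U \<and> (\<forall>i<n. True) \<and> star cnj U * A * U = mat_diag n d"
  proof (rule congruence_diagonalization)
    fix n and A :: "complex mat"
    assume A: "A \<in> carrier_mat (Suc n) (Suc n)"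
    obtain v k where v: "v \<in> carrier_vec (Suc n)" "v \<noteq> 0\<^sub>v (Suc n)" "A *\<^sub>v v = k \<cdot>\<^sub>v v"
      using complex_eigenvector_exists[OF A] by blast
    obtain r :: real where r: "(complex_of_real r \<cdot>\<^sub>v v) \<bullet>c (complex_of_real r \<cdot>\<^sub>v v) = 1"
      using normalize_vec[OF v(1,2)] by blast
    define u where "u = complex_of_real r \<cdot>\<^sub>v v"
    have "A *\<^sub>v u = k \<cdot>\<^sub>v u"
      using A v by (simp add: u_def mult_mat_vec[OF A v(1)] smult_smult_assoc mult.commute)
    moreover have "map_vec (\<lambda>x. cnj (cnj x)) u = u" by (rule eq_vecI) auto
    ultimately show "\<exists>u \<mu>. u \<in> carrier_vec (Suc n) \<and> u \<bullet>c u = 1 \<and> True \<and>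
        A *\<^sub>v u = \<mu> \<cdot>\<^sub>v map_vec (\<lambda>x. cnj (cnj x)) u"
      using r v(1) by (intro exI[of _ u] exI[of _ k]) (simp add: u_def)
  qed (use assms in \<open>auto simp: star_cnj\<close>)
  then show ?thesis using that by (auto simp: star_cnj)
qed

text \<open>Consider the antilinear map sending \<open>v\<close> to
  \<open>conjugate (A *\<^sub>v v)\<close>. Since \<open>A\<close> is symmetric, its square is the
  linear map \<open>mat_adjoint A * A\<close>, which has an eigenvector \<open>v\<close> with
  eigenvalue \<open>l * l\<close> for some real \<open>l \<ge> 0\<close>. With \<open>w\<close> the
  image of \<open>v\<close>, the vector \<open>w + l v\<close> is multiplied by \<open>l\<close>
  under the antilinear map, which is the claim unless that vector is zero.\<close>

lemma takagi_eigenvector: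
  fixes A :: "complex mat"
  assumes A: "A \<in> carrier_mat (Suc n) (Suc n)" "transpose_mat A = A"
  shows "\<exists>u \<mu>. u \<in> carrier_vec (Suc n) \<and> u \<bullet>c u = 1 \<and> 0 \<le> \<mu> \<and>
    A *\<^sub>v u = \<mu> \<cdot>\<^sub>v conjugate u"
proof -
  have "mat_adjoint A * A \<in> carrier_mat (Suc n) (Suc n)" using A by auto
  then obtain v k where v: "v \<in> carrier_vec (Suc n)" "v \<noteq> 0\<^sub>v (Suc n)"
    and k: "mat_adjoint A * A *\<^sub>v v = k \<cdot>\<^sub>v v"
    using complex_eigenvector_exists by blast
  define w where "w = conjugate (A *\<^sub>v v)"
  have w: "w \<in> carrier_vec (Suc n)" using A by (auto simp: w_def)
  have Aw: "A *\<^sub>v w = conjugate (k \<cdot>\<^sub>v v)"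
  proof -
    have "mat_adjoint A * A *\<^sub>v v = mat_adjoint A *\<^sub>v (A *\<^sub>v v)"
      using A v by (intro assoc_mult_mat_vec) auto
    moreover have "A $$ (i, j) = A $$ (j, i)" if "i < Suc n" "j < Suc n" for i j
      using index_transpose_mat(1)[of i A j] A that by auto
    then have "conjugate (mat_adjoint A *\<^sub>v (A *\<^sub>v v)) = A *\<^sub>v w"
      using A unfolding w_def
      by (intro eq_vecI) (auto simp: index_mult_mat_vec_sum sum_conjugate simp del: index_mult_mat_vec sum.lessThan_Suc
          intro!: sum.cong)
    ultimately show ?thesis using k by simp
  qed
  define s where "s = (\<Sum>i<Suc n. (cmod (v $ i))\<^sup>2)"
  define t where "t = (\<Sum>i<Suc n. (cmod ((A *\<^sub>v v) $ i))\<^sup>2)"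
  have s: "s > 0" using nonzero_vec_norm_pos[of v] v by (simp add: s_def)
  have t: "t \<ge> 0" by (simp add: t_def sum_nonneg del: sum.lessThan_Suc)
  \<comment> \<open>Pairing the eigenvector equation with \<open>v\<close> gives \<open>k\<close>
    times the squared norm of \<open>v\<close> on one side and the squared norm of
    \<open>A *\<^sub>v v\<close> on the other, so \<open>k\<close> is real and nonnegative.\<close>
  have "k * complex_of_real s = complex_of_real t"
  proof -
    have "(mat_adjoint A * A *\<^sub>v v) \<bullet>c v = (mat_adjoint A *\<^sub>v (A *\<^sub>v v)) \<bullet>c v"
      using A v by (subst assoc_mult_mat_vec) auto
    also have "\<dots> = (A *\<^sub>v v) \<bullet>c (A *\<^sub>v v)"
      using A v by (subst inner_adjoint[of _ "Suc n" "Suc n"]) auto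
    also have "\<dots> = complex_of_real t"
      using A by (simp add: inner_self_eq t_def del: sum.lessThan_Suc)
    finally have "(k \<cdot>\<^sub>v v) \<bullet>c v = complex_of_real t" unfolding k .
    moreover have "v \<bullet>c v = complex_of_real s"
      using v by (simp add: inner_self_eq s_def del: sum.lessThan_Suc)
    ultimately show ?thesis using v by simp
  qed
  then have kr: "k = complex_of_real (t / s)"
    using s by (simp add: field_simps)
  define l where "l = sqrt (t / s)"
  have l: "l \<ge> 0" "k = complex_of_real l * complex_of_real l"
    using s t by (simp_all add: l_def kr flip: of_real_mult)
  have "\<exists>z. z \<in> carrier_vec (Suc n) \<and> z \<noteq> 0\<^sub>v (Suc n) \<and> A *\<^sub>v z = complex_of_real l \<cdot>\<^sub>v conjugate z"
  proof (cases "w + complex_of_real l \<cdot>\<^sub>v v = 0\<^sub>v (Suc n)")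
    case False
    have "A *\<^sub>v (w + complex_of_real l \<cdot>\<^sub>v v) = conjugate (k \<cdot>\<^sub>v v) + complex_of_real l \<cdot>\<^sub>v (A *\<^sub>v v)"
      using A v w by (simp add: mult_add_distrib_mat_vec[of _ "Suc n" "Suc n"] mult_mat_vec[of _ "Suc n" "Suc n"] Aw)
    also have "\<dots> = complex_of_real l \<cdot>\<^sub>v conjugate (w + complex_of_real l \<cdot>\<^sub>v v)"
      using A v by (intro eq_vecI) (auto simp: w_def l algebra_simps simp del: index_mult_mat_vec)
    finally show ?thesis using False v w by (intro exI[of _ "w + complex_of_real l \<cdot>\<^sub>v v"]) auto
  next
    case True
    have "(A *\<^sub>v v) $ i = - (complex_of_real l * cnj (v $ i))" if "i < Suc n" for i
    proof -
      have "(w + complex_of_real l \<cdot>\<^sub>v v) $ i = 0" using True that by simp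
      then have "cnj ((A *\<^sub>v v) $ i) = - (complex_of_real l * v $ i)"
        using that A v by (simp add: w_def add_eq_0_iff2 del: index_mult_mat_vec)
      then have "cnj (cnj ((A *\<^sub>v v) $ i)) = cnj (- (complex_of_real l * v $ i))" by (simp only:)
      then show ?thesis by simp
    qed
    \<comment> \<open>Here \<open>v\<close> has the value \<open>- l\<close> instead of
      \<open>l\<close>. Multiplication by \<open>\<i>\<close> repairs the sign, because the
      conjugate of \<open>\<i> \<cdot>\<^sub>v v\<close> is \<open>- \<i>\<close> times the
      conjugate of \<open>v\<close>.\<close>
    then have "A *\<^sub>v (\<i> \<cdot>\<^sub>v v) = complex_of_real l \<cdot>\<^sub>v conjugate (\<i> \<cdot>\<^sub>v v)"
      using A v unfolding mult_mat_vec[OF A(1) v(1)] by (intro eq_vecI) (auto simp del: index_mult_mat_vec)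
    moreover have "\<i> \<cdot>\<^sub>v v \<noteq> 0\<^sub>v (Suc n)"
    proof
      assume "\<i> \<cdot>\<^sub>v v = 0\<^sub>v (Suc n)"
      then have "(\<i> \<cdot>\<^sub>v v) $ i = 0" if "i < Suc n" for i using that by simp
      then have "v $ i = 0" if "i < Suc n" for i using that v(1) by auto
      then show False using v by (auto intro: eq_vecI)
    qed
    ultimately show ?thesis using v by (intro exI[of _ "\<i> \<cdot>\<^sub>v v"]) auto
  qed
  then obtain z where z: "z \<in> carrier_vec (Suc n)" "z \<noteq> 0\<^sub>v (Suc n)"
    "A *\<^sub>v z = complex_of_real l \<cdot>\<^sub>v conjugate z" by blast
  obtain r :: real where r: "(complex_of_real r \<cdot>\<^sub>v z) \<bullet>c (complex_of_real r \<cdot>\<^sub>v z) = 1"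
    using normalize_vec[OF z(1,2)] by blast
  have "A *\<^sub>v (complex_of_real r \<cdot>\<^sub>v z) = complex_of_real l \<cdot>\<^sub>v conjugate (complex_of_real r \<cdot>\<^sub>v z)"
    unfolding mult_mat_vec[OF A(1) z(1)] z(3) by (intro eq_vecI) auto
  with r z(1) l(1) show ?thesis
    by (intro exI[of _ "complex_of_real r \<cdot>\<^sub>v z"] exI[of _ "complex_of_real l"])
      (auto simp: less_eq_complex_def)
qed

lemma takagi_factorization:
  assumes "A \<in> carrier_mat n n" "transpose_mat A = A"
  obtains U l where "unitary_mat n U" "\<forall>i<n. 0 \<le> l i"
    "transpose_mat U * A * U = mat_diag n (\<lambda>i. complex_of_real (l i))"
proof -
  have "\<exists>U d. unitary_mat n U \<and> (\<forall>i<n. 0 \<le> d i) \<and> star (\<lambda>x. x) U * A * U = mat_diag n d"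
  proof (rule congruence_diagonalization)
    fix n and A :: "complex mat"
    assume A: "A \<in> carrier_mat (Suc n) (Suc n)" "star (\<lambda>x. x) A = A"
    moreover have "map_vec (\<lambda>x. cnj x) u = conjugate u" for u by (rule eq_vecI) auto
    ultimately show "\<exists>u \<mu>. u \<in> carrier_vec (Suc n) \<and> u \<bullet>c u = 1 \<and> 0 \<le> \<mu> \<and>
        A *\<^sub>v u = \<mu> \<cdot>\<^sub>v map_vec (\<lambda>x. cnj x) u"
      using takagi_eigenvector[OF A(1)] by (simp add: star_id)
  qed (use assms in \<open>auto simp: star_id\<close>)
  then obtain U d where U: "unitary_mat n U" "\<And>i. i < n \<Longrightarrow> 0 \<le> d i" "transpose_mat U * A * U = mat_diag n d"
    by (auto simp: star_id)
  have "d i = complex_of_real (Re (d i))" if "i < n" for i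
    using U(2)[OF that] by (simp add: less_eq_complex_def complex_eq_iff)
  then have "mat_diag n d = mat_diag n (\<lambda>i. complex_of_real (Re (d i)))"
    unfolding mat_diag_def by (auto intro!: cong_mat)
  then show ?thesis
    using that[of U "\<lambda>i. Re (d i)"] U by (auto simp: less_eq_complex_def)
qed

lemma pos_semidef_diagonalization:
  assumes "pos_semidef n A"
  obtains U d where "unitary_mat n U" "\<forall>i<n. 0 \<le> d i"
    "A = U * mat_diag n (\<lambda>i. complex_of_real (d i)) * mat_adjoint U"
proof -
  have A: "A \<in> carrier_mat n n" "mat_adjoint A = A"
    using assms by (auto simp: pos_semidef_def)
  obtain U d where U: "unitary_mat n U" and d: "mat_adjoint U * A * U = mat_diag n d"
    using hermitian_diagonalization[OF A] by blast
  note Uc = unitary_matD[OF U]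
  have "pos_semidef n (mat_diag n d)"
    using pos_semidef_conjugation[OF assms, of "mat_adjoint U" n] Uc d by simp
  then have psd: "0 \<le> quad_form (mat_diag n d) (unit_vec n i)" if "i < n" for i
    using that by (simp add: pos_semidef_def)
  have d0: "0 \<le> d i" if "i < n" for i
  proof -
    have "quad_form (mat_diag n d) (unit_vec n i) = (\<Sum>k<n. \<Sum>j<n. if k = i \<and> j = i then d i else 0)"
      using that by (subst quad_form_sum[of _ n]) (auto simp: mat_diag_def unit_vec_def intro!: sum.cong)
    also have "\<dots> = (\<Sum>k<n. if k = i then d i else 0)"
      using that by (intro sum.cong) auto
    also have "\<dots> = d i" using that by simp
    finally show ?thesis using psd[OF that] by simp
  qed
  have dr: "mat_diag n d = mat_diag n (\<lambda>i. complex_of_real (Re (d i)))"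
    unfolding mat_diag_def using d0 by (auto simp: less_eq_complex_def complex_eq_iff intro!: cong_mat)
  have "U * (mat_adjoint U * A * U) * mat_adjoint U = (U * mat_adjoint U) * A * (U * mat_adjoint U)"
    using Uc(1) A(1) by (simp add: assoc_mult_mat[of _ n n _ n _ n])
  then have "A = U * mat_diag n d * mat_adjoint U"
    using Uc A(1) by (simp add: d)
  then show ?thesis
    using that[of U "\<lambda>i. Re (d i)"] U d0 dr by (auto simp: less_eq_complex_def)
qed

lemma pos_semidef_factor:
  assumes "pos_semidef n A"
  obtains M where "M \<in> carrier_mat n n" "A = M * mat_adjoint M"
proof -
  obtain U d where U: "unitary_mat n U" and d: "\<forall>i<n. 0 \<le> d i"
    and A: "A = U * mat_diag n (\<lambda>i. complex_of_real (d i)) * mat_adjoint U"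
    using pos_semidef_diagonalization[OF assms] by blast
  note Uc = unitary_matD[OF U]
  define D where "D = mat_diag n (\<lambda>i. complex_of_real (sqrt (d i)))"
  have D: "D \<in> carrier_mat n n" "mat_adjoint D = D"
    by (auto simp: D_def mat_diag_def intro!: eq_matI)
  have "D * D = mat_diag n (\<lambda>i. complex_of_real (d i))"
    unfolding D_def mat_diag_diag using d by (auto simp: mat_diag_def simp flip: of_real_mult intro!: cong_mat)
  moreover have "U * D * mat_adjoint (U * D) = U * (D * D) * mat_adjoint U"
    using Uc(1) D by (simp add: mat_adjoint_mult[of U n n D n] assoc_mult_mat[of _ n n _ n _ n])
  ultimately show ?thesis
    using that[of "U * D"] A Uc D by auto
qed

text \<open>The determinants of the two unitary factors multiply to 1, which leaves the product of
  the eigenvalues. For 4 x 4 matrices this is how positivity of the partial transpose is exploited;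
  for 2 x 2 matrices it bounds the off-diagonal entry.\<close>

lemma pos_semidef_det_nonneg:
  assumes "pos_semidef n A"
  shows "0 \<le> det A"
proof -
  obtain U d where U: "unitary_mat n U" and d: "\<forall>i<n. 0 \<le> d i"
    and A: "A = U * mat_diag n (\<lambda>i. complex_of_real (d i)) * mat_adjoint U"
    using pos_semidef_diagonalization[OF assms] by blast
  note Uc = unitary_matD[OF U]
  let ?D = "mat_diag n (\<lambda>i. complex_of_real (d i))"
  have c: "?D \<in> carrier_mat n n" "mat_adjoint U \<in> carrier_mat n n" using Uc by auto
  have "det U * det (mat_adjoint U) = 1"
    using det_mult[OF Uc(1) c(2)] Uc(3) by simp
  moreover have "det A = det U * det ?D * det (mat_adjoint U)"
    unfolding A by (simp only: det_mult[OF mult_carrier_mat[OF Uc(1) c(1)] c(2)] det_mult[OF Uc(1) c(1)])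
  ultimately have "det A = det ?D" by (simp add: mult.assoc mult.left_commute[of "det ?D"])
  also have "\<dots> = (\<Prod>i<n. complex_of_real (d i))"
    by (subst det_upper_triangular[of _ n]) (auto simp: mat_diag_def diag_mat_def prod_list_diag_prod atLeast0LessThan prod.list_conv_set_nth)
  also have "\<dots> = complex_of_real (\<Prod>i<n. d i)" by simp
  moreover have "0 \<le> (\<Prod>i<n. d i)"
    using d by (auto intro: prod_nonneg)
  ultimately show ?thesis
    by (simp add: less_eq_complex_def del: of_real_prod)
qed

section \<open>The determinant of the partial transpose\<close>

lemma sum_lessThan_4: "(\<Sum>i<(4::nat). g i) = g 0 + g 1 + g 2 + (g 3 :: 'a :: comm_monoid_add)"
  by (simp add: eval_nat_numeral)

lemma sum_lessThan_2: "(\<Sum>i<(2::nat). g i) = g 0 + (g 1 :: 'a :: comm_monoid_add)"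
  by (simp add: eval_nat_numeral)

lemma less_4_iff: "i < (4::nat) \<longleftrightarrow> i = 0 \<or> i = 1 \<or> i = 2 \<or> i = 3"
  by auto

lemma det_2:
  fixes g :: "nat \<times> nat \<Rightarrow> 'a :: comm_ring_1"
  shows "det (mat 2 2 g) = g (0, 0) * g (1, 1) - g (0, 1) * g (1, 0)"
  by (subst laplace_expansion_row[of _ 2 0])
    (auto simp: sum_lessThan_2 cofactor_def mat_delete_def det_single)

lemma det_3:
  fixes g :: "nat \<times> nat \<Rightarrow> 'a :: comm_ring_1"
  shows "det (mat 3 3 g) = g (0, 0) * (g (1, 1) * g (2, 2) - g (1, 2) * g (2, 1))
    - g (0, 1) * (g (1, 0) * g (2, 2) - g (1, 2) * g (2, 0))
    + g (0, 2) * (g (1, 0) * g (2, 1) - g (1, 1) * g (2, 0))"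
  by (subst laplace_expansion_row[of _ 3 0])
    (auto simp: algebra_simps eval_nat_numeral cofactor_def mat_delete_def det_2[unfolded numeral_2_eq_2 One_nat_def])

lemma det_4:
  fixes A :: "'a :: comm_ring_1 mat"
  assumes "A \<in> carrier_mat 4 4"
  shows "det A =
      A $$ (0,0) * (A $$ (1,1) * (A $$ (2,2) * A $$ (3,3) - A $$ (2,3) * A $$ (3,2))
        - A $$ (1,2) * (A $$ (2,1) * A $$ (3,3) - A $$ (2,3) * A $$ (3,1))
        + A $$ (1,3) * (A $$ (2,1) * A $$ (3,2) - A $$ (2,2) * A $$ (3,1)))
    - A $$ (0,1) * (A $$ (1,0) * (A $$ (2,2) * A $$ (3,3) - A $$ (2,3) * A $$ (3,2))
        - A $$ (1,2) * (A $$ (2,0) * A $$ (3,3) - A $$ (2,3) * A $$ (3,0))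
        + A $$ (1,3) * (A $$ (2,0) * A $$ (3,2) - A $$ (2,2) * A $$ (3,0)))
    + A $$ (0,2) * (A $$ (1,0) * (A $$ (2,1) * A $$ (3,3) - A $$ (2,3) * A $$ (3,1))
        - A $$ (1,1) * (A $$ (2,0) * A $$ (3,3) - A $$ (2,3) * A $$ (3,0))
        + A $$ (1,3) * (A $$ (2,0) * A $$ (3,1) - A $$ (2,1) * A $$ (3,0)))
    - A $$ (0,3) * (A $$ (1,0) * (A $$ (2,1) * A $$ (3,2) - A $$ (2,2) * A $$ (3,1))
        - A $$ (1,1) * (A $$ (2,0) * A $$ (3,2) - A $$ (2,2) * A $$ (3,0))
        + A $$ (1,2) * (A $$ (2,0) * A $$ (3,1) - A $$ (2,1) * A $$ (3,0)))"
  using assms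
  by (subst laplace_expansion_row[of _ 4 0])
    (auto simp: algebra_simps eval_nat_numeral cofactor_def mat_delete_def det_3[unfolded numeral_3_eq_3 numeral_2_eq_2 One_nat_def])

text \<open>The transposition acts on the second qubit, whose basis index is the remainder modulo
  2.\<close>

definition partial_transpose :: "complex mat \<Rightarrow> complex mat" where
  "partial_transpose \<rho> = mat 4 4 (\<lambda>(i, j). \<rho> $$ (i div 2 * 2 + j mod 2, j div 2 * 2 + i mod 2))"

text \<open>This is the tensor square of the Pauli matrix \<open>\<sigma>_y\<close>. Its bilinear
  form sends a vector \<open>z\<close> to \<open>2 * (z 1 * z 2 - z 0 * z 3)\<close>, which vanishes
  exactly on product vectors.\<close>

definition spin_flip :: "complex mat" where
  "spin_flip = mat 4 4 (\<lambda>(i, j). if i + j = 3 then if i = 0 \<or> i = 3 then - 1 else 1 else 0)"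

lemma partial_transpose_carrier [simp]: "partial_transpose \<rho> \<in> carrier_mat 4 4"
  by (simp add: partial_transpose_def)

lemma spin_flip_carrier [simp]: "spin_flip \<in> carrier_mat 4 4"
  by (simp add: spin_flip_def)

lemma dim_spin_flip [simp]: "dim_row spin_flip = 4" "dim_col spin_flip = 4"
  by (simp_all add: spin_flip_def)

lemma det_spin_flip: "det spin_flip = 1"
  by (subst det_4) (auto simp: spin_flip_def)

lemma transpose_spin_flip: "transpose_mat spin_flip = spin_flip"
  by (rule eq_matI) (auto simp: spin_flip_def)

lemma conjugate_spin_flip: "map_mat cnj spin_flip = spin_flip"
  by (rule eq_matI) (auto simp: spin_flip_def)

text \<open>For Hermitian \<open>R\<close> the transpose is the entrywise conjugate, and this is
  Wootters' spin-flipped state. Using the transpose keeps all expressions polynomial in the entries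
  of \<open>R\<close>.\<close>

lemma index_spin_flipped:
  assumes "R \<in> carrier_mat 4 4" "i < 4" "j < 4"
  shows "(spin_flip * transpose_mat R * spin_flip) $$ (i, j) =
    (if i = 0 \<or> i = 3 then - 1 else 1) * (if j = 0 \<or> j = 3 then - 1 else 1) * R $$ (3 - j, 3 - i)"
  using assms unfolding less_4_iff
  by (auto simp: index_mult_mat_sum sum_lessThan_4 spin_flip_def simp del: index_mult_mat(1))

text \<open>The sixteen variables are the entries of a 4 x 4 matrix \<open>R\<close>, row by row,
  with the letter o skipped. The left side is 16 times the determinant of its partial transpose; the
  right side collects the squared trace of \<open>Q\<close>, the trace of \<open>Q * Q\<close> and
  the determinant of \<open>R\<close>, for the \<open>Q\<close> of
  \<open>det_partial_transpose\<close>. Written out in this way, it is settled by expanding in the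
  polynomial ring.\<close>

lemma partial_transpose_polynomial_identity:
  fixes a b c d e f g h i j k l m n p q :: complex
  shows "16 * (
      a * (f * (k * q - p * l) - d * (m * q - p * n) + h * (m * l - k * n))
      - e * (b * (k * q - p * l) - d * (i * q - p * j) + h * (i * l - k * j))
      + c * (b * (m * q - p * n) - f * (i * q - p * j) + h * (i * n - m * j))
      - g * (b * (m * l - k * n) - f * (i * l - k * j) + d * (i * n - m * j))) =
    ((a * q - b * p - c * n + d * m) + (- e * l + f * k + g * j - h * i) + (- i * h + j * g + k * f - l * e) + (m * d - n * c - p * b + q * a))\<^sup>2
    - 2 * (((a * q - b * p - c * n + d * m) * (a * q - b * p - c * n + d * m)
        + (- a * l + b * k + c * j - d * i) * (e * q - f * p - g * n + h * m)
        + (- a * h + b * g + c * f - d * e) * (i * q - j * p - k * n + l * m)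
        + (a * d - b * c - c * b + d * a) * (m * q - n * p - p * n + q * m))
      + ((e * q - f * p - g * n + h * m) * (- a * l + b * k + c * j - d * i)
        + (- e * l + f * k + g * j - h * i) * (- e * l + f * k + g * j - h * i)
        + (- e * h + f * g + g * f - h * e) * (- i * l + j * k + k * j - l * i)
        + (e * d - f * c - g * b + h * a) * (- m * l + n * k + p * j - q * i))
      + ((i * q - j * p - k * n + l * m) * (- a * h + b * g + c * f - d * e)
        + (- i * l + j * k + k * j - l * i) * (- e * h + f * g + g * f - h * e)
        + (- i * h + j * g + k * f - l * e) * (- i * h + j * g + k * f - l * e)
        + (i * d - j * c - k * b + l * a) * (- m * h + n * g + p * f - q * e))
      + ((m * q - n * p - p * n + q * m) * (a * d - b * c - c * b + d * a)
        + (- m * l + n * k + p * j - q * i) * (e * d - f * c - g * b + h * a)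
        + (- m * h + n * g + p * f - q * e) * (i * d - j * c - k * b + l * a)
        + (m * d - n * c - p * b + q * a) * (m * d - n * c - p * b + q * a)))
    + 8 * (
      a * (f * (k * q - l * p) - g * (j * q - l * n) + h * (j * p - k * n))
      - b * (e * (k * q - l * p) - g * (i * q - l * m) + h * (i * p - k * m))
      + c * (e * (j * q - l * n) - f * (i * q - l * m) + h * (i * n - j * m))
      - d * (e * (j * p - k * n) - f * (i * p - k * m) + g * (i * n - j * m)))"
  by (simp add: algebra_simps power2_eq_square)

text \<open>An identity between polynomials, valid for every complex matrix. Its use is that the
  right side contains only quantities that become symmetric polynomials in the \<open>l i\<close>
  once \<open>R\<close> is factored in Takagi form.\<close>

lemma det_partial_transpose:
  assumes R: "R \<in> carrier_mat 4 4"
  defines "Q \<equiv> R * (spin_flip * transpose_mat R * spin_flip)"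
  shows "16 * det (partial_transpose R) = (mat_trace Q)\<^sup>2 - 2 * mat_trace (Q * Q) + 8 * det R"
proof -
  have Q: "Q $$ (i, j) = (\<Sum>k<4. R $$ (i, k) * ((if k = 0 \<or> k = 3 then - 1 else 1) *
      (if j = 0 \<or> j = 3 then - 1 else 1) * R $$ (3 - j, 3 - k)))" if "i < 4" "j < 4" for i j
    using that R unfolding Q_def
    by (subst index_mult_mat_sum) (auto simp: index_spin_flipped simp del: index_mult_mat(1) intro!: sum.cong)
  have Qc: "Q \<in> carrier_mat 4 4" using R by (auto simp: Q_def)
  have t1: "mat_trace Q = (\<Sum>i<4. Q $$ (i, i))"
    using Qc by (simp add: mat_trace_def)
  have t2: "mat_trace (Q * Q) = (\<Sum>i<4. \<Sum>j<4. Q $$ (i, j) * Q $$ (j, i))"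
    using Qc by (auto simp: mat_trace_def index_mult_mat_sum simp del: index_mult_mat(1))
  have q:
    "Q $$ (0,0) = R $$ (0,0) * R $$ (3,3) - R $$ (0,1) * R $$ (3,2) - R $$ (0,2) * R $$ (3,1) + R $$ (0,3) * R $$ (3,0)"
    "Q $$ (0,1) = - R $$ (0,0) * R $$ (2,3) + R $$ (0,1) * R $$ (2,2) + R $$ (0,2) * R $$ (2,1) - R $$ (0,3) * R $$ (2,0)"
    "Q $$ (0,2) = - R $$ (0,0) * R $$ (1,3) + R $$ (0,1) * R $$ (1,2) + R $$ (0,2) * R $$ (1,1) - R $$ (0,3) * R $$ (1,0)"
    "Q $$ (0,3) = R $$ (0,0) * R $$ (0,3) - R $$ (0,1) * R $$ (0,2) - R $$ (0,2) * R $$ (0,1) + R $$ (0,3) * R $$ (0,0)"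
    "Q $$ (1,0) = R $$ (1,0) * R $$ (3,3) - R $$ (1,1) * R $$ (3,2) - R $$ (1,2) * R $$ (3,1) + R $$ (1,3) * R $$ (3,0)"
    "Q $$ (1,1) = - R $$ (1,0) * R $$ (2,3) + R $$ (1,1) * R $$ (2,2) + R $$ (1,2) * R $$ (2,1) - R $$ (1,3) * R $$ (2,0)"
    "Q $$ (1,2) = - R $$ (1,0) * R $$ (1,3) + R $$ (1,1) * R $$ (1,2) + R $$ (1,2) * R $$ (1,1) - R $$ (1,3) * R $$ (1,0)"
    "Q $$ (1,3) = R $$ (1,0) * R $$ (0,3) - R $$ (1,1) * R $$ (0,2) - R $$ (1,2) * R $$ (0,1) + R $$ (1,3) * R $$ (0,0)"
    "Q $$ (2,0) = R $$ (2,0) * R $$ (3,3) - R $$ (2,1) * R $$ (3,2) - R $$ (2,2) * R $$ (3,1) + R $$ (2,3) * R $$ (3,0)"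
    "Q $$ (2,1) = - R $$ (2,0) * R $$ (2,3) + R $$ (2,1) * R $$ (2,2) + R $$ (2,2) * R $$ (2,1) - R $$ (2,3) * R $$ (2,0)"
    "Q $$ (2,2) = - R $$ (2,0) * R $$ (1,3) + R $$ (2,1) * R $$ (1,2) + R $$ (2,2) * R $$ (1,1) - R $$ (2,3) * R $$ (1,0)"
    "Q $$ (2,3) = R $$ (2,0) * R $$ (0,3) - R $$ (2,1) * R $$ (0,2) - R $$ (2,2) * R $$ (0,1) + R $$ (2,3) * R $$ (0,0)"
    "Q $$ (3,0) = R $$ (3,0) * R $$ (3,3) - R $$ (3,1) * R $$ (3,2) - R $$ (3,2) * R $$ (3,1) + R $$ (3,3) * R $$ (3,0)"
    "Q $$ (3,1) = - R $$ (3,0) * R $$ (2,3) + R $$ (3,1) * R $$ (2,2) + R $$ (3,2) * R $$ (2,1) - R $$ (3,3) * R $$ (2,0)"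
    "Q $$ (3,2) = - R $$ (3,0) * R $$ (1,3) + R $$ (3,1) * R $$ (1,2) + R $$ (3,2) * R $$ (1,1) - R $$ (3,3) * R $$ (1,0)"
    "Q $$ (3,3) = R $$ (3,0) * R $$ (0,3) - R $$ (3,1) * R $$ (0,2) - R $$ (3,2) * R $$ (0,1) + R $$ (3,3) * R $$ (0,0)"
    by (simp_all add: Q sum_lessThan_4)
  have div_mod_2: "(1::nat) div 2 = 0" "(3::nat) div 2 = 1" "(3::nat) mod 2 = 1"
    by auto
  have pt:
    "partial_transpose R $$ (0,0) = R $$ (0,0)" "partial_transpose R $$ (0,1) = R $$ (1,0)" "partial_transpose R $$ (0,2) = R $$ (0,2)" "partial_transpose R $$ (0,3) = R $$ (1,2)"
    "partial_transpose R $$ (1,0) = R $$ (0,1)" "partial_transpose R $$ (1,1) = R $$ (1,1)" "partial_transpose R $$ (1,2) = R $$ (0,3)" "partial_transpose R $$ (1,3) = R $$ (1,3)"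
    "partial_transpose R $$ (2,0) = R $$ (2,0)" "partial_transpose R $$ (2,1) = R $$ (3,0)" "partial_transpose R $$ (2,2) = R $$ (2,2)" "partial_transpose R $$ (2,3) = R $$ (3,2)"
    "partial_transpose R $$ (3,0) = R $$ (2,1)" "partial_transpose R $$ (3,1) = R $$ (3,1)" "partial_transpose R $$ (3,2) = R $$ (2,3)" "partial_transpose R $$ (3,3) = R $$ (3,3)"
    by (simp_all add: partial_transpose_def div_mod_2) (simp_all flip: numeral_2_eq_2 numeral_3_eq_3)
  show ?thesis
    unfolding t1 t2 sum_lessThan_4 det_4[OF R] det_4[OF partial_transpose_carrier] q pt
    by (rule partial_transpose_polynomial_identity)
qed

section \<open>Wootters' decomposition\<close>

text \<open>A triangle with sides \<open>a\<close>, \<open>b\<close>, \<open>r\<close> is drawn in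
  the complex plane with \<open>r\<close> on the real axis; \<open>c\<close> and \<open>d\<close>
  are the directions of the other two sides.\<close>

lemma triangle_phases:
  fixes a b r :: real
  assumes "0 \<le> a" "0 \<le> b" "\<bar>a - b\<bar> \<le> r" "r \<le> a + b"
  obtains c d :: complex where "cmod c = 1" "cmod d = 1" "c * of_real a + d * of_real b = of_real r"
proof (cases "a = 0 \<or> r = 0")
  case True
  then consider "a = 0" "b = r" | "r = 0" "a = b" using assms by force
  then show ?thesis
  proof cases
    case 1
    then show ?thesis using that[of 1 1] by simp
  next
    case 2
    then show ?thesis using that[of 1 "-1"] by simp
  qed
next
  case False
  then have pos: "a > 0" "r > 0" using assms by auto
  \<comment> \<open>The law of cosines: \<open>x\<close> is the cosine of the angle between the
    sides \<open>a\<close> and \<open>r\<close>. The division explains why \<open>a = 0\<close> and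
    \<open>r = 0\<close> were treated separately.\<close>
  define x where "x = (a\<^sup>2 + r\<^sup>2 - b\<^sup>2) / (2 * a * r)"
  have "\<bar>a - r\<bar> \<le> \<bar>b\<bar>" "\<bar>b\<bar> \<le> \<bar>a + r\<bar>"
    using assms pos by linarith+
  then have "(a - r)\<^sup>2 \<le> b\<^sup>2" "b\<^sup>2 \<le> (a + r)\<^sup>2"
    by (simp_all add: abs_le_square_iff)
  then have "\<bar>x\<bar> \<le> 1"
    using pos by (simp add: x_def abs_le_iff field_simps power2_eq_square)
  then have x2: "x\<^sup>2 \<le> 1" by (simp add: abs_square_le_1)
  define c where "c = Complex x (sqrt (1 - x\<^sup>2))"
  have c: "cmod c = 1" using x2 by (simp add: c_def cmod_def)
  define e where "e = of_real r - c * of_real a"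
  have "(cmod e)\<^sup>2 = (r - x * a)\<^sup>2 + (1 - x\<^sup>2) * a\<^sup>2"
    using x2 by (simp add: e_def c_def cmod_power2 power_mult_distrib)
  also have "\<dots> = r\<^sup>2 + a\<^sup>2 - 2 * a * r * x"
    by (simp add: power2_eq_square algebra_simps)
  also have "\<dots> = b\<^sup>2" using pos by (simp add: x_def)
  finally have e: "cmod e = b" using assms(2) by (simp add: power2_eq_iff_nonneg)
  \<comment> \<open>The vector \<open>e\<close> is the third side, of length \<open>b\<close>; its
    direction is \<open>e\<close> divided by \<open>b\<close>, or arbitrary if \<open>b = 0\<close>,
    where \<open>e\<close> vanishes.\<close>
  show ?thesis
  proof (cases "b = 0")
    case True
    then show ?thesis using that[of c 1] c e by (simp add: e_def)
  next
    case False
    then show ?thesis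
      using that[of c "e / of_real b"] c e assms(2) by (simp add: e_def norm_divide)
  qed
qed

text \<open>A diagonal of length \<open>r\<close> cuts the quadrilateral into a triangle with sides
  \<open>l 0\<close>, \<open>l 1\<close>, \<open>r\<close> and one with sides \<open>l 2\<close>,
  \<open>l 3\<close>, \<open>r\<close>. The two triangles are glued by giving the second pair of
  sides opposite signs.\<close>

lemma quadrilateral_phases:
  fixes l :: "nat \<Rightarrow> real"
  assumes "\<forall>i<4. 0 \<le> l i" "\<forall>i<4. 2 * l i \<le> (\<Sum>j<4. l j)"
  obtains c :: "nat \<Rightarrow> complex" where "\<forall>i<4. cmod (c i) = 1" "(\<Sum>i<4. c i * of_real (l i)) = 0"
proof -
  \<comment> \<open>The smallest length that satisfies the lower bounds of both triangles. The four
    inequalities on the sides say that it also satisfies both upper bounds.\<close>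
  define r where "r = max \<bar>l 0 - l 1\<bar> \<bar>l 2 - l 3\<bar>"
  have l: "0 \<le> l 0" "0 \<le> l 1" "0 \<le> l 2" "0 \<le> l 3"
    "l 0 \<le> l 1 + l 2 + l 3" "l 1 \<le> l 0 + l 2 + l 3" "l 2 \<le> l 0 + l 1 + l 3" "l 3 \<le> l 0 + l 1 + l 2"
    using assms(1)[rule_format, of 0] assms(1)[rule_format, of 1]
      assms(1)[rule_format, of 2] assms(1)[rule_format, of 3]
      assms(2)[rule_format, of 0] assms(2)[rule_format, of 1]
      assms(2)[rule_format, of 2] assms(2)[rule_format, of 3]
    by (simp_all add: sum_lessThan_4)
  have "\<bar>l 0 - l 1\<bar> \<le> r" "r \<le> l 0 + l 1" "\<bar>l 2 - l 3\<bar> \<le> r" "r \<le> l 2 + l 3"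
    using l by (auto simp: r_def)
  note r = this
  obtain c d :: complex where cd: "cmod c = 1" "cmod d = 1" "c * of_real (l 0) + d * of_real (l 1) = of_real r"
    by (rule triangle_phases[OF l(1,2) r(1,2)])
  obtain e f :: complex where ef: "cmod e = 1" "cmod f = 1" "e * of_real (l 2) + f * of_real (l 3) = of_real r"
    by (rule triangle_phases[OF l(3,4) r(3,4)])
  show ?thesis
  proof (rule that[of "\<lambda>i. if i = 0 then c else if i = 1 then d else if i = 2 then - e else - f"])
    have "c * of_real (l 0) + d * of_real (l 1) - (e * of_real (l 2) + f * of_real (l 3)) = 0"
      unfolding cd ef by simp
    then show "(\<Sum>i<4. (if i = 0 then c else if i = 1 then d else if i = 2 then - e else - f) * of_real (l i)) = 0"
      by (simp add: sum_lessThan_4 algebra_simps)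
  qed (use cd ef in \<open>simp add: less_4_iff\<close>)
qed

text \<open>If the first factor were negative, the other three would be positive, and so the product
  negative.\<close>

lemma largest_le_sum_of_others:
  fixes a b c d :: real
  assumes "0 \<le> a" "0 \<le> b" "0 \<le> c" "0 \<le> d"
    "0 \<le> (b + c + d - a) * ((a + c + d - b) * ((a + b + d - c) * (a + b + c - d)))"
  shows "a \<le> b + c + d"
proof (rule ccontr)
  assume "\<not> a \<le> b + c + d"
  then have *: "b + c + d - a < 0" "a + c + d - b > 0" "a + b + d - c > 0" "a + b + c - d > 0"
    using assms by auto
  then have "(b + c + d - a) * ((a + c + d - b) * ((a + b + d - c) * (a + b + c - d))) < 0"
    by (intro mult_neg_pos mult_pos_pos)
  with assms(5) show False by simp
qed

lemma mat_trace_comm: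
  assumes "A \<in> carrier_mat m n" "B \<in> carrier_mat n m"
  shows "mat_trace (A * B) = mat_trace (B * A)"
proof -
  have "mat_trace (A * B) = (\<Sum>i<m. \<Sum>j<n. A $$ (i, j) * B $$ (j, i))"
    using assms by (auto simp: mat_trace_def index_mult_mat_sum simp del: index_mult_mat(1))
  also have "\<dots> = (\<Sum>j<n. \<Sum>i<m. B $$ (j, i) * A $$ (i, j))"
    by (subst sum.swap) (simp add: mult.commute)
  also have "\<dots> = mat_trace (B * A)"
    using assms by (auto simp: mat_trace_def index_mult_mat_sum simp del: index_mult_mat(1))
  finally show ?thesis .
qed

lemma dim_mat_diag [simp]: "dim_row (mat_diag n f) = n" "dim_col (mat_diag n f) = n"
  by (simp_all add: mat_diag_def)

lemma mat_trace_mat_diag: "mat_trace (mat_diag n f) = (\<Sum>i<n. f i)"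
  by (simp add: mat_trace_def mat_diag_def)

lemma transpose_adjoint: "transpose_mat (mat_adjoint A) = map_mat cnj (A :: complex mat)"
  by (rule eq_matI) auto

lemma map_cnj_mult:
  assumes "A \<in> carrier_mat m n" "B \<in> carrier_mat n p"
  shows "map_mat cnj (A * B) = map_mat cnj A * map_mat cnj B"
  using assms by (intro eq_matI) (auto simp: index_mult_mat_sum simp del: index_mult_mat(1))

text \<open>
  The numbers \<open>l i\<close> are Wootters' concurrence spectrum of \<open>N * mat_adjoint N\<close>, and
  \<open>16 det \<rho>\<^sup>\<Gamma>\<close> is the product of the four expressions \<open>(\<Sum>j. l j) - 2 * l i\<close>.
\<close>

lemma concurrence_bound:
  assumes N: "N \<in> carrier_mat 4 4" and l: "\<forall>i<4. 0 \<le> l i"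
    and tau: "transpose_mat N * spin_flip * N = mat_diag 4 (\<lambda>i. complex_of_real (l i))" (is "_ = ?L")
    and ppt: "pos_semidef 4 (partial_transpose (N * mat_adjoint N))"
  shows "\<forall>i<4. 2 * l i \<le> (\<Sum>j<4. l j)"
proof -
  define R where "R = N * mat_adjoint N"
  define T where "T = transpose_mat N * spin_flip"
  have Nc: "transpose_mat N \<in> carrier_mat 4 4" "mat_adjoint N \<in> carrier_mat 4 4"
    "map_mat cnj N \<in> carrier_mat 4 4" "T \<in> carrier_mat 4 4"
    using N by (auto simp: T_def)
  have L: "?L \<in> carrier_mat 4 4" by simp
  have TN: "T * N = ?L" using tau by (simp add: T_def)
  have Rc: "R \<in> carrier_mat 4 4" using N by (simp add: R_def)
  define Q where "Q = R * (spin_flip * transpose_mat R * spin_flip)"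
  \<comment> \<open>Conjugating \<open>tau\<close> entrywise gives the same diagonal matrix, because
    the \<open>l i\<close> are real. This produces the inner factor of \<open>Q\<close>.\<close>
  have "map_mat cnj (transpose_mat N) = mat_adjoint N"
    by (rule eq_matI) auto
  then have "mat_adjoint N * spin_flip * map_mat cnj N = map_mat cnj (transpose_mat N * spin_flip * N)"
    using N Nc by (simp only: map_cnj_mult[OF mult_carrier_mat[OF Nc(1) spin_flip_carrier] N]
        map_cnj_mult[OF Nc(1) spin_flip_carrier] conjugate_spin_flip)
  also have "\<dots> = ?L" unfolding tau by (rule eq_matI) (auto simp: mat_diag_def)
  finally have tau': "mat_adjoint N * spin_flip * map_mat cnj N = ?L" .
  have "transpose_mat R = map_mat cnj N * transpose_mat N"
    unfolding R_def using N Nc by (simp add: transpose_mult[of N 4 4 _ 4] transpose_adjoint)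
  then have "Q = N * (mat_adjoint N * spin_flip * map_mat cnj N) * T"
    unfolding Q_def R_def T_def using N Nc by (simp add: assoc_mult_mat[of _ 4 4 _ 4 _ 4])
  then have Q: "Q = N * (?L * T)"
    unfolding tau' using N Nc L by (simp add: assoc_mult_mat[of _ 4 4 _ 4 _ 4])
  \<comment> \<open>As \<open>Q = N * (?L * T)\<close> and \<open>T * N = ?L\<close>, moving
    \<open>N\<close> around cyclically turns the traces of \<open>Q\<close> and \<open>Q * Q\<close>
    into those of the second and fourth powers of \<open>?L\<close>.\<close>
  have "mat_trace Q = mat_trace (?L * T * N)"
    unfolding Q using N Nc L by (intro mat_trace_comm[of _ 4 4]) auto
  also have "?L * T * N = ?L * ?L"
    using N Nc L by (simp add: assoc_mult_mat[of _ 4 4 _ 4 _ 4] TN)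
  finally have t1: "mat_trace Q = complex_of_real (\<Sum>i<4. (l i)\<^sup>2)"
    by (simp add: mat_trace_mat_diag power2_eq_square)
  have "Q * Q = N * (?L * (T * N) * ?L * T)"
    unfolding Q using N Nc L by (simp add: assoc_mult_mat[of _ 4 4 _ 4 _ 4])
  then have "mat_trace (Q * Q) = mat_trace (?L * (T * N) * ?L * T * N)"
    using mat_trace_comm[of N 4 4 "?L * (T * N) * ?L * T"] N Nc L
    by (simp add: assoc_mult_mat[of _ 4 4 _ 4 _ 4])
  also have "?L * (T * N) * ?L * T * N = ?L * ?L * ?L * ?L"
    using N Nc L by (simp add: assoc_mult_mat[of _ 4 4 _ 4 _ 4] TN)
  finally have t2: "mat_trace (Q * Q) = complex_of_real (\<Sum>i<4. (l i) ^ 4)"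
    by (simp add: mat_trace_mat_diag power4_eq_xxxx mult_ac)
  have dL: "det ?L = complex_of_real (\<Prod>i<4. l i)"
    by (subst det_4) (auto simp: mat_diag_def eval_nat_numeral)
  \<comment> \<open>Since \<open>spin_flip\<close> has determinant 1, the product of the
    \<open>l i\<close> is the square of \<open>det N\<close>. Taking absolute values, it equals
    \<open>det R\<close>, the squared modulus of \<open>det N\<close>, so no square root of the
    \<open>l i\<close> appears.\<close>
  have "det ?L = det N * det N"
    using tau N Nc det_mult[of "transpose_mat N * spin_flip" 4 N] det_mult[of "transpose_mat N" 4 spin_flip]
    by (simp add: det_transpose[of N 4] det_spin_flip)
  then have "cmod (det N) ^ 2 = cmod (det ?L)"
    by (simp add: norm_mult power2_eq_square)
  also have "\<dots> = (\<Prod>i<4. l i)"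
    unfolding dL norm_of_real using l by (auto intro!: abs_of_nonneg prod_nonneg)
  finally have n2: "cmod (det N) ^ 2 = (\<Prod>i<4. l i)" .
  have "det (mat_adjoint N) = cnj (det N)"
    using N Nc by (simp add: det_4[of N] det_4[of "mat_adjoint N"]) (simp add: algebra_simps)
  then have "det R = complex_of_real (\<Prod>i<4. l i)"
    unfolding R_def using N Nc n2
    by (simp add: det_mult[of _ 4] complex_norm_square[symmetric] del: of_real_prod of_real_power)
  with t1 t2 have "16 * det (partial_transpose R) =
      complex_of_real ((\<Sum>i<4. (l i)\<^sup>2)\<^sup>2 - 2 * (\<Sum>i<4. (l i) ^ 4) + 8 * (\<Prod>i<4. l i))"
    using det_partial_transpose[OF Rc] by (simp add: Q_def)
  moreover have "0 \<le> det (partial_transpose R)"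
    using pos_semidef_det_nonneg[OF ppt] by (simp add: R_def)
  ultimately have "0 \<le> (\<Sum>i<4. (l i)\<^sup>2)\<^sup>2 - 2 * (\<Sum>i<4. (l i) ^ 4) + 8 * (\<Prod>i<4. l i)"
    by (auto simp: less_eq_complex_def complex_eq_iff simp del: of_real_prod)
  then have pr: "0 \<le> (l 0 ^ 2 + l 1 ^ 2 + l 2 ^ 2 + l 3 ^ 2)\<^sup>2 - 2 * (l 0 ^ 4 + l 1 ^ 4 + l 2 ^ 4 + l 3 ^ 4)
      + 8 * (l 0 * l 1 * l 2 * l 3)"
    by (simp add: sum_lessThan_4 eval_nat_numeral mult_ac)
  \<comment> \<open>A form of Heron's formula for cyclic quadrilaterals. The left side is symmetric,
    so each \<open>l i\<close> in turn can be put in the place of \<open>a\<close>.\<close>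
  have id: "(a\<^sup>2 + b\<^sup>2 + c\<^sup>2 + d\<^sup>2)\<^sup>2 - 2 * (a ^ 4 + b ^ 4 + c ^ 4 + d ^ 4) + 8 * (a * b * c * d) =
      (b + c + d - a) * ((a + c + d - b) * ((a + b + d - c) * (a + b + c - d)))" for a b c d :: real
    by (simp add: algebra_simps power2_eq_square power4_eq_xxxx)
  have l4: "0 \<le> l 0" "0 \<le> l 1" "0 \<le> l 2" "0 \<le> l 3" using l by auto
  have "l 0 \<le> l 1 + l 2 + l 3"
    by (rule largest_le_sum_of_others) (use l4 pr id[of "l 0" "l 1" "l 2" "l 3"] in simp_all)
  moreover have "l 1 \<le> l 0 + l 2 + l 3"
    by (rule largest_le_sum_of_others) (use l4 pr id[of "l 1" "l 0" "l 2" "l 3"] in \<open>simp_all add: ac_simps\<close>)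
  moreover have "l 2 \<le> l 0 + l 1 + l 3"
    by (rule largest_le_sum_of_others) (use l4 pr id[of "l 2" "l 0" "l 1" "l 3"] in \<open>simp_all add: ac_simps\<close>)
  moreover have "l 3 \<le> l 0 + l 1 + l 2"
    by (rule largest_le_sum_of_others) (use l4 pr id[of "l 3" "l 0" "l 1" "l 2"] in \<open>simp_all add: ac_simps\<close>)
  ultimately show ?thesis by (auto simp: less_4_iff sum_lessThan_4)
qed

section \<open>Product vectors and mixtures of them\<close>

lemma normalized_pair:
  fixes x y :: complex
  obtains r :: real and x' y' where "r \<ge> 0" "x = of_real r * x'" "y = of_real r * y'"
    "(cmod x')\<^sup>2 + (cmod y')\<^sup>2 = 1"
proof (cases "x = 0 \<and> y = 0")
  case True
  then show ?thesis using that[of 0 1 0] by simp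
next
  case False
  define s where "s = (cmod x)\<^sup>2 + (cmod y)\<^sup>2"
  have "s > 0" using False by (auto simp: s_def sum_power2_gt_zero_iff)
  moreover have "(cmod (w / of_real (sqrt s)))\<^sup>2 = (cmod w)\<^sup>2 / s" for w :: complex
    using \<open>s > 0\<close> by (simp add: norm_divide power_divide)
  then have "(cmod (x / of_real (sqrt s)))\<^sup>2 + (cmod (y / of_real (sqrt s)))\<^sup>2 = s / s"
    by (simp only: s_def add_divide_distrib)
  ultimately show ?thesis
    by (intro that[of "sqrt s" "x / of_real (sqrt s)" "y / of_real (sqrt s)"]) auto
qed

text \<open>Read as a 2 x 2 matrix, \<open>z\<close> has determinant zero, hence rank at most one,
  and is a column times a row. The lengths of both factors are collected in
  \<open>r\<close>.\<close>

lemma product_vector_of_zero_concurrence: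
  fixes z :: "nat \<Rightarrow> complex"
  assumes "z 0 * z 3 = z 1 * z 2"
  obtains r :: real and a b :: "nat \<Rightarrow> complex" where
    "r \<ge> 0" "(cmod (a 0))\<^sup>2 + (cmod (a 1))\<^sup>2 = 1" "(cmod (b 0))\<^sup>2 + (cmod (b 1))\<^sup>2 = 1"
    "\<forall>i<4. z i = of_real r * (a (i div 2) * b (i mod 2))"
proof -
  have "\<exists>x y u v. z 0 = x * u \<and> z 1 = x * v \<and> z 2 = y * u \<and> z 3 = y * v"
  proof (cases "z 0 = 0 \<and> z 1 = 0")
    case True
    then show ?thesis by (intro exI[of _ 0] exI[of _ 1] exI[of _ "z 2"] exI[of _ "z 3"]) simp
  next
    case False
    then consider "z 0 \<noteq> 0" | "z 1 \<noteq> 0" by blast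
    then show ?thesis
    proof cases
      case 1
      then show ?thesis using assms
        by (intro exI[of _ 1] exI[of _ "z 2 / z 0"] exI[of _ "z 0"] exI[of _ "z 1"]) (simp add: field_simps)
    next
      case 2
      then show ?thesis using assms
        by (intro exI[of _ 1] exI[of _ "z 3 / z 1"] exI[of _ "z 0"] exI[of _ "z 1"]) (simp add: field_simps)
    qed
  qed
  then obtain x y u v where z: "z 0 = x * u" "z 1 = x * v" "z 2 = y * u" "z 3 = y * v" by blast
  obtain r x' y' where 1: "r \<ge> 0" "x = complex_of_real r * x'" "y = of_real r * y'" "(cmod x')\<^sup>2 + (cmod y')\<^sup>2 = 1"
    using normalized_pair[of x y] by metis
  obtain s u' v' where 2: "s \<ge> 0" "u = complex_of_real s * u'" "v = of_real s * v'" "(cmod u')\<^sup>2 + (cmod v')\<^sup>2 = 1"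
    using normalized_pair[of u v] by metis
  show ?thesis
    using 1 2 z by (intro that[of "r * s" "\<lambda>i. if i = 0 then x' else y'" "\<lambda>i. if i = 0 then u' else v'"])
      (auto simp: less_4_iff)
qed

definition ket_bra :: "(nat \<Rightarrow> complex) \<Rightarrow> complex mat" where
  "ket_bra a = mat 2 2 (\<lambda>(i, j). a i * cnj (a j))"

lemma density_operator_ket_bra:
  assumes "(cmod (a 0))\<^sup>2 + (cmod (a 1))\<^sup>2 = 1"
  shows "density_operator 2 (ket_bra a)"
proof -
  define M where "M = mat 2 1 (\<lambda>(i, j). a i)"
  have "ket_bra a = M * mat_adjoint M"
    by (rule eq_matI) (auto simp: M_def ket_bra_def index_mult_mat_sum simp del: index_mult_mat(1))
  moreover have "pos_semidef 2 (M * mat_adjoint M)"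
    by (rule pos_semidef_gram[of _ _ 1]) (simp add: M_def)
  moreover have "mat_trace (ket_bra a) = complex_of_real ((cmod (a 0))\<^sup>2 + (cmod (a 1))\<^sup>2)"
    by (simp add: mat_trace_def ket_bra_def sum_lessThan_2 complex_norm_square del: of_real_power)
  ultimately show ?thesis using assms by (simp only: density_operator_def of_real_1)
qed

text \<open>\<open>Z * mat_adjoint Z\<close> is the sum of the unnormalized projectors onto the
  columns of \<open>Z\<close>, each of which is a product vector. The squared column lengths are the
  weights, and the trace condition makes them sum to 1.\<close>

lemma separable_of_product_columns:
  assumes Z: "Z \<in> carrier_mat 4 4" and prod: "\<forall>k<4. Z $$ (0, k) * Z $$ (3, k) = Z $$ (1, k) * Z $$ (2, k)"
    and tr: "mat_trace (Z * mat_adjoint Z) = 1"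
  shows "separable_state 2 2 (Z * mat_adjoint Z)"
proof -
  have "\<exists>r a b. r \<ge> 0 \<and> (cmod (a 0))\<^sup>2 + (cmod (a 1))\<^sup>2 = 1 \<and> (cmod (b 0))\<^sup>2 + (cmod (b 1))\<^sup>2 = 1 \<and>
    (\<forall>i<4. Z $$ (i, k) = complex_of_real r * (a (i div 2) * b (i mod 2)))" if "k < 4" for k
    using product_vector_of_zero_concurrence[of "\<lambda>i. Z $$ (i, k)"] prod that by metis
  then obtain r :: "nat \<Rightarrow> real" and a b :: "nat \<Rightarrow> nat \<Rightarrow> complex" where
    r: "\<And>k. k < 4 \<Longrightarrow> r k \<ge> 0"
    "\<And>k. k < 4 \<Longrightarrow> (cmod (a k 0))\<^sup>2 + (cmod (a k 1))\<^sup>2 = 1"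
    "\<And>k. k < 4 \<Longrightarrow> (cmod (b k 0))\<^sup>2 + (cmod (b k 1))\<^sup>2 = 1"
    "\<And>k i. k < 4 \<Longrightarrow> i < 4 \<Longrightarrow> Z $$ (i, k) = complex_of_real (r k) * (a k (i div 2) * b k (i mod 2))"
    by metis
  define p where "p k = (r k)\<^sup>2" for k
  define \<sigma> where "\<sigma> = mat_family_sum (2 * 2) (2 * 2)
      (\<lambda>k. complex_of_real (p k) \<cdot>\<^sub>m tensor_mat (ket_bra (a k)) (ket_bra (b k))) {..<4}"
  have eq: "Z * mat_adjoint Z = \<sigma>"
  proof (rule eq_matI)
    fix i j assume "i < dim_row \<sigma>" "j < dim_col \<sigma>"
    then have ij: "i < 4" "j < 4" by (auto simp: \<sigma>_def)
    have ij2: "i div 2 < 2" "j div 2 < 2" "i mod 2 < 2" "j mod 2 < 2" using ij by auto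
    have "(Z * mat_adjoint Z) $$ (i, j) = (\<Sum>k<4. Z $$ (i, k) * cnj (Z $$ (j, k)))"
      using Z ij by (simp add: index_mult_mat_sum del: index_mult_mat(1))
    also have "\<dots> = \<sigma> $$ (i, j)"
      using ij ij2 unfolding \<sigma>_def
      by (auto simp: r tensor_mat_def ket_bra_def p_def power2_eq_square intro!: sum.cong)
    finally show "(Z * mat_adjoint Z) $$ (i, j) = \<sigma> $$ (i, j)" .
  qed (use Z in \<open>auto simp: \<sigma>_def\<close>)
  have dens: "density_operator 2 (ket_bra (a k))" "density_operator 2 (ket_bra (b k))" if "k < 4" for k
    using r(2,3)[OF that] by (auto intro: density_operator_ket_bra)
  have "mat_trace \<sigma> = (\<Sum>i<4. \<Sum>k<4. complex_of_real (p k) *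
      (ket_bra (a k) $$ (i div 2, i div 2) * ket_bra (b k) $$ (i mod 2, i mod 2)))"
    by (auto simp: \<sigma>_def mat_trace_def tensor_mat_def ket_bra_def intro!: sum.cong)
  also have "\<dots> = (\<Sum>k<4. \<Sum>i<4. complex_of_real (p k) *
      (ket_bra (a k) $$ (i div 2, i div 2) * ket_bra (b k) $$ (i mod 2, i mod 2)))"
    by (rule sum.swap)
  also have "\<dots> = (\<Sum>k<4. complex_of_real (p k) * (mat_trace (ket_bra (a k)) * mat_trace (ket_bra (b k))))"
    by (intro sum.cong refl) (simp add: sum_lessThan_4 sum_lessThan_2 mat_trace_def ket_bra_def algebra_simps)
  also have "\<dots> = (\<Sum>k<4. complex_of_real (p k))"
    using dens by (intro sum.cong refl) (simp add: density_operator_def)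
  finally have "(\<Sum>k<4. p k) = 1"
    using tr unfolding eq by (simp flip: of_real_sum)
  moreover have "\<forall>k<4. 0 \<le> p k \<and> density_operator 2 (ket_bra (a k)) \<and> density_operator 2 (ket_bra (b k))"
    using dens by (simp add: p_def)
  ultimately show ?thesis
    unfolding separable_state_def eq
    by (intro exI[of _ 4] exI[of _ p] exI[of _ "\<lambda>k. ket_bra (a k)"] exI[of _ "\<lambda>k. ket_bra (b k)"])
      (simp add: \<sigma>_def)
qed

text \<open>A symmetric real Hadamard matrix of order 4, scaled to be orthogonal. What matters later
  is that every entry has the same square 1/4.\<close>

definition hadamard :: "nat \<Rightarrow> nat \<Rightarrow> complex" where
  "hadamard i k = (if i = 0 \<or> k = 0 \<or> i = k then 1 else - 1) / 2"

lemma hadamard_orthogonal: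
  "i < 4 \<Longrightarrow> j < 4 \<Longrightarrow> (\<Sum>k<4. hadamard k i * hadamard k j) = (if i = j then 1 else 0)"
  unfolding less_4_iff by (auto simp: sum_lessThan_4 hadamard_def)

text \<open>
  Wootters' construction: the phases \<open>c i\<close> close the quadrilateral with sides \<open>l i\<close>, and
  recombining the columns of \<open>N\<close> with the entries of a Hadamard matrix spreads the
  vanishing sum \<open>\<Sum>i. c i * l i\<close> equally over the concurrences of the new columns.
\<close>

theorem ppt_imp_separable:
  assumes rho: "density_operator 4 \<rho>" and ppt: "pos_semidef 4 (partial_transpose \<rho>)"
  shows "separable_state 2 2 \<rho>"
proof -
  obtain M where M: "M \<in> carrier_mat 4 4" "\<rho> = M * mat_adjoint M"
    using rho pos_semidef_factor unfolding density_operator_def by blast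
  define \<tau> where "\<tau> = transpose_mat M * spin_flip * M"
  have \<tau>: "\<tau> \<in> carrier_mat 4 4" using M by (simp add: \<tau>_def)
  have "transpose_mat \<tau> = \<tau>"
    unfolding \<tau>_def using M
    by (simp add: transpose_mult[of _ 4 4 _ 4] transpose_spin_flip assoc_mult_mat[of _ 4 4 _ 4 _ 4])
  then obtain U l where U: "unitary_mat 4 U" and l: "\<forall>i<4. 0 \<le> l i"
    and UU: "transpose_mat U * \<tau> * U = mat_diag 4 (\<lambda>i. complex_of_real (l i))"
    using takagi_factorization[OF \<tau>] by blast
  note Uc = unitary_matD[OF U]
  \<comment> \<open>The unitary freedom in \<open>\<rho> = M * mat_adjoint M\<close> is spent on
    bringing \<open>\<tau>\<close> into Takagi form.\<close>
  define N where "N = M * U"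
  have N: "N \<in> carrier_mat 4 4" using M Uc by (simp add: N_def)
  have "N * mat_adjoint N = M * (U * mat_adjoint U) * mat_adjoint M"
    unfolding N_def using M Uc(1) by (simp add: mat_adjoint_mult[of M 4 4 U 4] assoc_mult_mat[of _ 4 4 _ 4 _ 4])
  then have rhoN: "\<rho> = N * mat_adjoint N" using M Uc(3) by simp
  have tauN: "transpose_mat N * spin_flip * N = mat_diag 4 (\<lambda>i. complex_of_real (l i))"
    unfolding N_def UU[symmetric] \<tau>_def using M Uc(1)
    by (simp add: transpose_mult[of _ 4 4 _ 4] assoc_mult_mat[of _ 4 4 _ 4 _ 4])
  obtain c where c: "\<forall>i<4. cmod (c i) = 1" "(\<Sum>i<4. c i * of_real (l i)) = 0"
    using quadrilateral_phases[OF l] concurrence_bound[OF N l tauN] ppt rhoN by blast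
  \<comment> \<open>Square roots of the phases, because the congruence by \<open>V\<close> uses
    \<open>transpose_mat V\<close> and thus squares them: the diagonal entries become the sum of
    \<open>c i * l i\<close> times 1/4. Unitarity pairs each root with its conjugate, where the
    phases cancel.\<close>
  define V where "V = mat 4 4 (\<lambda>(i, k). csqrt (c i) * hadamard i k)"
  have sq: "csqrt (c i) * csqrt (c i) = c i" "cnj (csqrt (c i)) * csqrt (c i) = 1" if "i < 4" for i
  proof -
    show "csqrt (c i) * csqrt (c i) = c i" by (simp flip: power2_eq_square)
    have "cmod (csqrt (c i)) = 1" using c(1) that by (simp add: norm_csqrt)
    then show "cnj (csqrt (c i)) * csqrt (c i) = 1"
      using complex_norm_square[of "csqrt (c i)"] by (simp add: mult.commute)
  qed
  have "unitary_mat 4 V"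
  proof (rule unitary_matI)
    show "mat_adjoint V * V = 1\<^sub>m 4"
    proof (rule eq_matI)
      fix i j assume "i < dim_row (1\<^sub>m 4 :: complex mat)" "j < dim_col (1\<^sub>m 4 :: complex mat)"
      then have ij: "i < 4" "j < 4" by auto
      have "(mat_adjoint V * V) $$ (i, j) = (\<Sum>k<4. (cnj (csqrt (c k)) * csqrt (c k)) * (hadamard k i * hadamard k j))"
        using ij by (subst index_mult_mat_sum) (auto simp: V_def hadamard_def intro!: sum.cong)
      also have "\<dots> = (\<Sum>k<4. hadamard k i * hadamard k j)"
        using sq by (intro sum.cong refl) simp
      finally show "(mat_adjoint V * V) $$ (i, j) = 1\<^sub>m 4 $$ (i, j)"
        using ij by (simp add: hadamard_orthogonal)
    qed (auto simp: V_def)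
  qed (simp add: V_def)
  note Vc = unitary_matD[OF this]
  define Z where "Z = N * V"
  have Z: "Z \<in> carrier_mat 4 4" using N Vc by (simp add: Z_def)
  have "Z * mat_adjoint Z = N * (V * mat_adjoint V) * mat_adjoint N"
    unfolding Z_def using N Vc(1) by (simp add: mat_adjoint_mult[of N 4 4 V 4] assoc_mult_mat[of _ 4 4 _ 4 _ 4])
  then have rhoZ: "\<rho> = Z * mat_adjoint Z" using N Vc(3) rhoN by simp
  have tauZ: "transpose_mat Z * spin_flip * Z = transpose_mat V * mat_diag 4 (\<lambda>i. complex_of_real (l i)) * V"
    unfolding Z_def tauN[symmetric] using N Vc(1)
    by (simp add: transpose_mult[of _ 4 4 _ 4] assoc_mult_mat[of _ 4 4 _ 4 _ 4])
  have "Z $$ (0, k) * Z $$ (3, k) = Z $$ (1, k) * Z $$ (2, k)" if k: "k < 4" for k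
  proof -
    \<comment> \<open>The diagonal entry is the bilinear form of \<open>spin_flip\<close> on column
      \<open>k\<close>, up to sign and a factor 2 the determinant of that column read as a 2 x 2
      matrix.\<close>
    have "(transpose_mat Z * spin_flip * Z) $$ (k, k) = 2 * (Z $$ (1, k) * Z $$ (2, k) - Z $$ (0, k) * Z $$ (3, k))"
      using k Z by (simp add: index_mult_mat_sum sum_lessThan_4 spin_flip_def del: index_mult_mat(1) assoc_mult_mat)
    moreover have "(transpose_mat V * mat_diag 4 (\<lambda>i. complex_of_real (l i)) * V) $$ (k, k) =
        (\<Sum>i<4. csqrt (c i) * csqrt (c i) * l i * (hadamard i k * hadamard i k))"
      using k by (simp add: index_mult_mat_sum sum_lessThan_4 V_def mat_diag_def del: index_mult_mat(1) assoc_mult_mat)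
    moreover have "hadamard i k * hadamard i k = 1 / 4" for i
      by (simp add: hadamard_def)
    ultimately have "2 * (Z $$ (1, k) * Z $$ (2, k) - Z $$ (0, k) * Z $$ (3, k)) = (\<Sum>i<4. c i * l i * (1 / 4))"
      using sq(1) by (simp add: tauZ)
    then have "2 * (Z $$ (1, k) * Z $$ (2, k) - Z $$ (0, k) * Z $$ (3, k)) = (\<Sum>i<4. c i * l i) * (1 / 4)"
      by (simp only: sum_distrib_right)
    then show ?thesis using c(2) by simp
  qed
  then show ?thesis
    using separable_of_product_columns[OF Z] rho unfolding rhoZ density_operator_def by blast
qed

section \<open>LOCC preserves separability\<close>

lemma dim_tensor_mat [simp]:
  "dim_row (tensor_mat A B) = dim_row A * dim_row B" "dim_col (tensor_mat A B) = dim_col A * dim_col B"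
  by (simp_all add: tensor_mat_def)

lemma tensor_mat_carrier:
  "A \<in> carrier_mat m m' \<Longrightarrow> B \<in> carrier_mat n n' \<Longrightarrow> tensor_mat A B \<in> carrier_mat (m * n) (m' * n')"
  by auto

lemma index_tensor_mat [simp]:
  "i < dim_row A * dim_row B \<Longrightarrow> j < dim_col A * dim_col B \<Longrightarrow>
    tensor_mat A B $$ (i, j) = A $$ (i div dim_row B, j div dim_col B) * B $$ (i mod dim_row B, j mod dim_col B)"
  by (simp add: tensor_mat_def)

lemma pair_index_less:
  fixes a k m r :: nat
  assumes "a < m" "r < k"
  shows "a * k + r < m * k"
proof -
  have "a * k + r < Suc a * k" using assms(2) by simp
  also have "\<dots> \<le> m * k" using assms(1) by (intro mult_right_mono) auto
  finally show ?thesis .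
qed

lemma pair_index_bounds:
  fixes i k m :: nat
  assumes "i < m * k"
  shows "i div k < m" "i mod k < k"
proof -
  have "k > 0" using assms by (cases k) auto
  then show "i div k < m" "i mod k < k" using assms by (auto simp: less_mult_imp_div_less)
qed

lemma pair_index_bounds_right: "(i :: nat) < m * k \<Longrightarrow> i mod k < k"
  by (rule pair_index_bounds)

lemma sum_pair_index:
  fixes h :: "nat \<Rightarrow> 'a :: comm_monoid_add"
  shows "(\<Sum>i<m * k. h i) = (\<Sum>a<m. \<Sum>b<k. h (a * k + b))"
proof -
  have "(\<Sum>a<m. \<Sum>b<k. h (a * k + b)) = (\<Sum>(a, b)\<in>{..<m} \<times> {..<k}. h (a * k + b))"
    by (rule sum.cartesian_product)
  also have "\<dots> = (\<Sum>i<m * k. h i)"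
    by (rule sum.reindex_bij_witness[of _ "\<lambda>i. (i div k, i mod k)" "\<lambda>(a, b). a * k + b"])
      (auto simp: pair_index_less dest: pair_index_bounds)
  finally show ?thesis by simp
qed

lemma mat_trace_tensor:
  assumes "A \<in> carrier_mat m m" "B \<in> carrier_mat n n"
  shows "mat_trace (tensor_mat A B) = mat_trace A * mat_trace B"
proof -
  have "mat_trace (tensor_mat A B) = (\<Sum>a<m. \<Sum>b<n. A $$ (a, a) * B $$ (b, b))"
    using assms by (simp add: mat_trace_def sum_pair_index pair_index_less)
  then show ?thesis using assms by (simp add: mat_trace_def sum_product)
qed

lemma mat_trace_add:
  assumes "A \<in> carrier_mat n n" "B \<in> carrier_mat n n"
  shows "mat_trace (A + B) = mat_trace A + mat_trace B"
  using assms by (simp add: mat_trace_def sum.distrib)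

lemma mat_trace_zero: "mat_trace (0\<^sub>m n n) = 0"
  by (simp add: mat_trace_def)

lemma mat_trace_family_sum: "mat_trace (mat_family_sum n n A I) = (\<Sum>k\<in>I. \<Sum>i<n. A k $$ (i, i))"
  by (simp add: mat_trace_def sum.swap[of _ I])

section \<open>Local maps on tensor products\<close>

lemma dim_apply [simp]:
  "dim_row (apply_left m n k \<Phi> X) = n * k" "dim_col (apply_left m n k \<Phi> X) = n * k"
  "dim_row (apply_right k m n \<Phi> X) = k * n" "dim_col (apply_right k m n \<Phi> X) = k * n"
  by (simp_all add: apply_left_def apply_right_def)

lemma apply_carrier [simp]:
  "apply_left m n k \<Phi> X \<in> carrier_mat (n * k) (n * k)"
  "apply_right k m n \<Phi> X \<in> carrier_mat (k * n) (k * n)"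
  by (simp_all add: apply_left_def apply_right_def)

lemma linear_superopD:
  assumes "linear_superop m n \<Phi>"
  shows "X \<in> carrier_mat m m \<Longrightarrow> \<Phi> X \<in> carrier_mat n n"
    "X \<in> carrier_mat m m \<Longrightarrow> Y \<in> carrier_mat m m \<Longrightarrow> \<Phi> (X + Y) = \<Phi> X + \<Phi> Y"
    "X \<in> carrier_mat m m \<Longrightarrow> \<Phi> (c \<cdot>\<^sub>m X) = c \<cdot>\<^sub>m \<Phi> X"
  using assms by (auto simp: linear_superop_def)

lemma linear_superop_zero:
  assumes "linear_superop m n \<Phi>"
  shows "\<Phi> (0\<^sub>m m m) = 0\<^sub>m n n"
proof -
  have "0 \<cdot>\<^sub>m 0\<^sub>m m m = (0\<^sub>m m m :: complex mat)" by (rule eq_matI) auto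
  then have "\<Phi> (0\<^sub>m m m) = 0 \<cdot>\<^sub>m \<Phi> (0\<^sub>m m m)"
    using linear_superopD(3)[OF assms, of "0\<^sub>m m m" 0] by simp
  also have "\<dots> = 0\<^sub>m n n"
    using linear_superopD(1)[OF assms, of "0\<^sub>m m m"] by (intro eq_matI) auto
  finally show ?thesis .
qed

lemma apply_left_tensor:
  assumes "linear_superop m n \<Phi>" "A \<in> carrier_mat m m" "B \<in> carrier_mat k k"
  shows "apply_left m n k \<Phi> (tensor_mat A B) = tensor_mat (\<Phi> A) B"
proof (rule eq_matI)
  have PA: "\<Phi> A \<in> carrier_mat n n" using linear_superopD(1)[OF assms(1,2)] .
  then show "dim_row (apply_left m n k \<Phi> (tensor_mat A B)) = dim_row (tensor_mat (\<Phi> A) B)"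
    "dim_col (apply_left m n k \<Phi> (tensor_mat A B)) = dim_col (tensor_mat (\<Phi> A) B)"
    using assms by auto
  fix r s assume "r < dim_row (tensor_mat (\<Phi> A) B)" "s < dim_col (tensor_mat (\<Phi> A) B)"
  then have rs: "r < n * k" "s < n * k" using PA assms by auto
  note b = pair_index_bounds[OF rs(1)] pair_index_bounds[OF rs(2)]
  have "mat m m (\<lambda>(i, j). tensor_mat A B $$ (i * k + r mod k, j * k + s mod k)) = B $$ (r mod k, s mod k) \<cdot>\<^sub>m A"
    using assms b by (intro eq_matI) (auto simp: pair_index_less)
  then show "apply_left m n k \<Phi> (tensor_mat A B) $$ (r, s) = tensor_mat (\<Phi> A) B $$ (r, s)"
    using rs PA assms b by (simp add: apply_left_def linear_superopD(3)[OF assms(1,2)] mult.commute)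
qed

lemma apply_right_tensor:
  assumes "linear_superop m n \<Phi>" "A \<in> carrier_mat k k" "B \<in> carrier_mat m m"
  shows "apply_right k m n \<Phi> (tensor_mat A B) = tensor_mat A (\<Phi> B)"
proof (rule eq_matI)
  have PB: "\<Phi> B \<in> carrier_mat n n" using linear_superopD(1)[OF assms(1,3)] .
  then show "dim_row (apply_right k m n \<Phi> (tensor_mat A B)) = dim_row (tensor_mat A (\<Phi> B))"
    "dim_col (apply_right k m n \<Phi> (tensor_mat A B)) = dim_col (tensor_mat A (\<Phi> B))"
    using assms by auto
  fix r s assume "r < dim_row (tensor_mat A (\<Phi> B))" "s < dim_col (tensor_mat A (\<Phi> B))"
  then have rs: "r < k * n" "s < k * n" using PB assms by auto
  note b = pair_index_bounds[OF rs(1)] pair_index_bounds[OF rs(2)]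
  have "mat m m (\<lambda>(i, j). tensor_mat A B $$ (r div n * m + i, s div n * m + j)) = A $$ (r div n, s div n) \<cdot>\<^sub>m B"
    using assms b by (intro eq_matI) (auto simp: pair_index_less)
  then show "apply_right k m n \<Phi> (tensor_mat A B) $$ (r, s) = tensor_mat A (\<Phi> B) $$ (r, s)"
    using rs PB assms b by (simp add: apply_right_def linear_superopD(3)[OF assms(1,3)])
qed

lemma apply_left_add:
  assumes "linear_superop m n \<Phi>" "X \<in> carrier_mat (m * k) (m * k)" "Y \<in> carrier_mat (m * k) (m * k)"
  shows "apply_left m n k \<Phi> (X + Y) = apply_left m n k \<Phi> X + apply_left m n k \<Phi> Y"
proof (rule eq_matI)
  fix r s assume "r < dim_row (apply_left m n k \<Phi> X + apply_left m n k \<Phi> Y)"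
    "s < dim_col (apply_left m n k \<Phi> X + apply_left m n k \<Phi> Y)"
  then have rs: "r < n * k" "s < n * k" by auto
  note b = pair_index_bounds[OF rs(1)] pair_index_bounds[OF rs(2)]
  let ?B = "\<lambda>X. mat m m (\<lambda>(i, j). X $$ (i * k + r mod k, j * k + s mod k))"
  have "?B (X + Y) = ?B X + ?B Y"
    using assms b by (intro eq_matI) (auto simp: pair_index_less)
  then have "\<Phi> (?B (X + Y)) = \<Phi> (?B X) + \<Phi> (?B Y)"
    using linear_superopD(2)[OF assms(1)] by simp
  moreover have "\<Phi> (?B X) \<in> carrier_mat n n" "\<Phi> (?B Y) \<in> carrier_mat n n"
    using linear_superopD(1)[OF assms(1)] by simp_all
  ultimately show "apply_left m n k \<Phi> (X + Y) $$ (r, s) = (apply_left m n k \<Phi> X + apply_left m n k \<Phi> Y) $$ (r, s)"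
    using rs b by (simp add: apply_left_def)
qed auto

lemma apply_right_add:
  assumes "linear_superop m n \<Phi>" "X \<in> carrier_mat (k * m) (k * m)" "Y \<in> carrier_mat (k * m) (k * m)"
  shows "apply_right k m n \<Phi> (X + Y) = apply_right k m n \<Phi> X + apply_right k m n \<Phi> Y"
proof (rule eq_matI)
  fix r s assume "r < dim_row (apply_right k m n \<Phi> X + apply_right k m n \<Phi> Y)"
    "s < dim_col (apply_right k m n \<Phi> X + apply_right k m n \<Phi> Y)"
  then have rs: "r < k * n" "s < k * n" by auto
  note b = pair_index_bounds[OF rs(1)] pair_index_bounds[OF rs(2)]
  let ?B = "\<lambda>X. mat m m (\<lambda>(i, j). X $$ (r div n * m + i, s div n * m + j))"
  have "?B (X + Y) = ?B X + ?B Y"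
    using assms b by (intro eq_matI) (auto simp: pair_index_less)
  then have "\<Phi> (?B (X + Y)) = \<Phi> (?B X) + \<Phi> (?B Y)"
    using linear_superopD(2)[OF assms(1)] by simp
  moreover have "\<Phi> (?B X) \<in> carrier_mat n n" "\<Phi> (?B Y) \<in> carrier_mat n n"
    using linear_superopD(1)[OF assms(1)] by simp_all
  ultimately show "apply_right k m n \<Phi> (X + Y) $$ (r, s) = (apply_right k m n \<Phi> X + apply_right k m n \<Phi> Y) $$ (r, s)"
    using rs b by (simp add: apply_right_def)
qed auto

lemma apply_left_zero:
  assumes "linear_superop m n \<Phi>"
  shows "apply_left m n k \<Phi> (0\<^sub>m (m * k) (m * k)) = 0\<^sub>m (n * k) (n * k)"
proof -
  have "mat m m (\<lambda>(i, j). 0\<^sub>m (m * k) (m * k) $$ (i * k + r mod k, j * k + s mod k)) = (0\<^sub>m m m :: complex mat)"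
    if "r < n * k" "s < n * k" for r s
    using pair_index_bounds[OF that(1)] pair_index_bounds[OF that(2)] by (intro eq_matI) (auto simp: pair_index_less)
  then show ?thesis
    by (intro eq_matI) (auto simp: apply_left_def linear_superop_zero[OF assms] pair_index_bounds(1))
qed

lemma apply_right_zero:
  assumes "linear_superop m n \<Phi>"
  shows "apply_right k m n \<Phi> (0\<^sub>m (k * m) (k * m)) = 0\<^sub>m (k * n) (k * n)"
proof -
  have "mat m m (\<lambda>(i, j). 0\<^sub>m (k * m) (k * m) $$ (r div n * m + i, s div n * m + j)) = (0\<^sub>m m m :: complex mat)"
    if "r < k * n" "s < k * n" for r s
    using pair_index_bounds[OF that(1)] pair_index_bounds[OF that(2)] by (intro eq_matI) (auto simp: pair_index_less)
  then show ?thesis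
    by (intro eq_matI) (auto simp: apply_right_def linear_superop_zero[OF assms] pair_index_bounds_right)
qed

text \<open>Complete positivity with the trivial ancilla \<open>k = 1\<close>.\<close>

lemma completely_positive_pos_semidef:
  assumes "completely_positive m n \<Phi>" "pos_semidef m A"
  shows "pos_semidef n (\<Phi> A)"
proof -
  have A: "A \<in> carrier_mat m m" using assms(2) by (simp add: pos_semidef_def)
  have lin: "linear_superop m n \<Phi>" using assms(1) by (simp add: completely_positive_def)
  have "mat m m (\<lambda>(i, j). A $$ (i, j)) = A" using A by (intro eq_matI) auto
  then have "apply_left m n 1 \<Phi> A = \<Phi> A"
    using linear_superopD(1)[OF lin A] by (intro eq_matI) (auto simp: apply_left_def)
  then show ?thesis using assms by (metis completely_positive_def mult.right_neutral)
qed

text \<open>Unnormalized on purpose: a single measurement branch carries its probability as its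
  trace, so a trace condition would not survive the individual outcomes of a protocol. The
  dimensions are parameters because the rounds may change them.\<close>

inductive sep_cone :: "nat \<Rightarrow> nat \<Rightarrow> complex mat \<Rightarrow> bool" for dA dB where
  zero: "sep_cone dA dB (0\<^sub>m (dA * dB) (dA * dB))"
| add_tensor: "pos_semidef dA \<alpha> \<Longrightarrow> pos_semidef dB \<beta> \<Longrightarrow> sep_cone dA dB X \<Longrightarrow>
    sep_cone dA dB (tensor_mat \<alpha> \<beta> + X)"

lemma tensor_carrier_pos_semidef:
  "pos_semidef m A \<Longrightarrow> pos_semidef n B \<Longrightarrow> tensor_mat A B \<in> carrier_mat (m * n) (m * n)"
  by (simp add: pos_semidef_def tensor_mat_carrier)

lemma sep_cone_carrier: "sep_cone dA dB X \<Longrightarrow> X \<in> carrier_mat (dA * dB) (dA * dB)"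
  by (induction rule: sep_cone.induct) (simp_all add: tensor_carrier_pos_semidef)

lemma sep_cone_add:
  assumes "sep_cone dA dB X" "sep_cone dA dB Y"
  shows "sep_cone dA dB (X + Y)"
  using assms
proof (induction rule: sep_cone.induct)
  case zero
  then show ?case using sep_cone_carrier by simp
next
  case (add_tensor \<alpha> \<beta> X)
  have eq: "tensor_mat \<alpha> \<beta> + X + Y = tensor_mat \<alpha> \<beta> + (X + Y)"
    using add_tensor sep_cone_carrier tensor_carrier_pos_semidef by (intro assoc_add_mat[of _ "dA * dB" "dA * dB"]) blast+
  show ?case unfolding eq by (rule sep_cone.add_tensor) (use add_tensor in blast)+
qed

lemma sep_cone_tensor:
  assumes "pos_semidef dA \<alpha>" "pos_semidef dB \<beta>"
  shows "sep_cone dA dB (tensor_mat \<alpha> \<beta>)"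
  using sep_cone.add_tensor[OF assms sep_cone.zero] tensor_carrier_pos_semidef[OF assms] by simp

lemma sep_cone_family_sum:
  assumes "finite I" "\<And>k. k \<in> I \<Longrightarrow> sep_cone dA dB (A k)"
  shows "sep_cone dA dB (mat_family_sum (dA * dB) (dA * dB) A I)"
  using assms
proof (induction I)
  case empty
  then show ?case by (simp add: mat_family_sum_empty sep_cone.zero)
next
  case (insert k I)
  then have "mat_family_sum (dA * dB) (dA * dB) A (insert k I) = A k + mat_family_sum (dA * dB) (dA * dB) A I"
    by (intro mat_family_sum_insert) (auto simp: sep_cone_carrier)
  with insert show ?case by (simp add: sep_cone_add)
qed

lemma pos_semidef_smult:
  assumes "pos_semidef n A" "0 \<le> c"
  shows "pos_semidef n (complex_of_real c \<cdot>\<^sub>m A)"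
proof -
  have A: "A \<in> carrier_mat n n" "mat_adjoint A = A"
    using assms by (auto simp: pos_semidef_def)
  have "mat_adjoint (complex_of_real c \<cdot>\<^sub>m A) = complex_of_real c \<cdot>\<^sub>m mat_adjoint A"
    using A(1) by (intro eq_matI) auto
  moreover have "quad_form (complex_of_real c \<cdot>\<^sub>m A) v = complex_of_real c * quad_form A v" if "v \<in> carrier_vec n" for v
    using A that by (simp add: quad_form_sum[of _ n] sum_distrib_left mult_ac)
  ultimately show ?thesis
    using assms by (auto simp: pos_semidef_def less_eq_complex_def)
qed

lemma separable_imp_sep_cone:
  assumes "separable_state dA dB \<rho>"
  shows "sep_cone dA dB \<rho>"
proof -
  obtain N :: nat and p :: "nat \<Rightarrow> real" and \<alpha> \<beta> where
    *: "\<forall>k<N. 0 \<le> p k \<and> density_operator dA (\<alpha> k) \<and> density_operator dB (\<beta> k)" and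
    rho: "\<rho> = mat_family_sum (dA * dB) (dA * dB)
      (\<lambda>k. complex_of_real (p k) \<cdot>\<^sub>m tensor_mat (\<alpha> k) (\<beta> k)) {..<N}"
    using assms unfolding separable_state_def by blast
  have "sep_cone dA dB (complex_of_real (p k) \<cdot>\<^sub>m tensor_mat (\<alpha> k) (\<beta> k))" if "k < N" for k
  proof -
    \<comment> \<open>The weight is absorbed into the first factor, since the cone has no
      coefficients of its own.\<close>
    have "complex_of_real (p k) \<cdot>\<^sub>m tensor_mat (\<alpha> k) (\<beta> k) = tensor_mat (complex_of_real (p k) \<cdot>\<^sub>m \<alpha> k) (\<beta> k)"
      by (rule eq_matI) (auto simp: pair_index_bounds(1))
    then show ?thesis
      using * that by (auto simp: density_operator_def intro: sep_cone_tensor pos_semidef_smult)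
  qed
  then show ?thesis unfolding rho by (intro sep_cone_family_sum) auto
qed

lemma sep_cone_apply_left:
  assumes "completely_positive m n \<Phi>" "sep_cone m k X"
  shows "sep_cone n k (apply_left m n k \<Phi> X)"
  using assms(2)
proof (induction rule: sep_cone.induct)
  have lin: "linear_superop m n \<Phi>" using assms(1) by (simp add: completely_positive_def)
  case zero
  show ?case by (simp add: apply_left_zero[OF lin] sep_cone.zero)
next
  have lin: "linear_superop m n \<Phi>" using assms(1) by (simp add: completely_positive_def)
  case (add_tensor \<alpha> \<beta> X)
  have "\<alpha> \<in> carrier_mat m m" "\<beta> \<in> carrier_mat k k"
    using add_tensor by (auto simp: pos_semidef_def)
  then have "apply_left m n k \<Phi> (tensor_mat \<alpha> \<beta> + X) = tensor_mat (\<Phi> \<alpha>) \<beta> + apply_left m n k \<Phi> X"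
    using add_tensor lin
    by (simp add: apply_left_add[OF lin] apply_left_tensor[OF lin] tensor_carrier_pos_semidef sep_cone_carrier)
  then show ?case
    using add_tensor completely_positive_pos_semidef[OF assms(1)] by (simp add: sep_cone.add_tensor)
qed

lemma sep_cone_apply_right:
  assumes "completely_positive m n \<Phi>" "sep_cone k m X"
  shows "sep_cone k n (apply_right k m n \<Phi> X)"
  using assms(2)
proof (induction rule: sep_cone.induct)
  have lin: "linear_superop m n \<Phi>" using assms(1) by (simp add: completely_positive_def)
  case zero
  show ?case by (simp add: apply_right_zero[OF lin] sep_cone.zero)
next
  have lin: "linear_superop m n \<Phi>" using assms(1) by (simp add: completely_positive_def)
  case (add_tensor \<alpha> \<beta> X)
  have "\<alpha> \<in> carrier_mat k k" "\<beta> \<in> carrier_mat m m"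
    using add_tensor by (auto simp: pos_semidef_def)
  then have "apply_right k m n \<Phi> (tensor_mat \<alpha> \<beta> + X) = tensor_mat \<alpha> (\<Phi> \<beta>) + apply_right k m n \<Phi> X"
    using add_tensor lin
    by (simp add: apply_right_add[OF lin] apply_right_tensor[OF lin] tensor_carrier_pos_semidef sep_cone_carrier)
  then show ?case
    using add_tensor completely_positive_pos_semidef[OF assms(1)] by (simp add: sep_cone.add_tensor)
qed

text \<open>Local completely positive maps send products to products, and a round only adds up its
  branches; both operations stay inside the cone.\<close>

lemma sep_cone_locc_protocol:
  assumes "locc_protocol eA eB dA dB \<Lambda>" "sep_cone dA dB X"
  shows "sep_cone eA eB (\<Lambda> X)"
  using assms
proof (induction arbitrary: X rule: locc_protocol.induct)
  case finish
  then show ?case .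
next
  case (alice dA dA' N E dB \<Lambda>)
  then have "sep_cone eA eB (\<Lambda> j (apply_left dA dA' dB (E j) X))" if "j < N" for j
    using that sep_cone_apply_left by (auto simp: instrument_def)
  then show ?case by (intro sep_cone_family_sum) auto
next
  case (bob dB dB' N E dA \<Lambda>)
  then have "sep_cone eA eB (\<Lambda> j (apply_right dA dB dB' (E j) X))" if "j < N" for j
    using that sep_cone_apply_right by (auto simp: instrument_def)
  then show ?case by (intro sep_cone_family_sum) auto
qed

section \<open>Maximally entangled vectors have expectation at most half the trace on the
  cone\<close>

lemma pos_semidef_diag_nonneg:
  assumes "pos_semidef n A" "i < n"
  shows "0 \<le> A $$ (i, i)"
proof -
  have A: "A \<in> carrier_mat n n" using assms by (simp add: pos_semidef_def)
  have "quad_form A (unit_vec n i) = (\<Sum>k<n. \<Sum>j<n. if k = i \<and> j = i then A $$ (i, i) else 0)"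
    using A assms(2) by (subst quad_form_sum[of _ n]) (auto simp: unit_vec_def intro!: sum.cong)
  also have "\<dots> = (\<Sum>k<n. if k = i then A $$ (i, i) else 0)"
    using assms(2) by (intro sum.cong) auto
  also have "\<dots> = A $$ (i, i)" using assms(2) by simp
  finally show ?thesis
    using assms(1) unfolding pos_semidef_def by (metis unit_vec_carrier)
qed

lemma pos_semidef_2_entries:
  assumes "pos_semidef 2 P"
  obtains a b :: real and p :: complex where "0 \<le> a" "0 \<le> b" "(cmod p)\<^sup>2 \<le> a * b"
    "P $$ (0, 0) = of_real a" "P $$ (1, 1) = of_real b" "P $$ (0, 1) = p" "P $$ (1, 0) = cnj p"
proof -
  have P: "P \<in> carrier_mat 2 2" "mat_adjoint P = P" using assms by (auto simp: pos_semidef_def)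
  have d: "0 \<le> P $$ (0, 0)" "0 \<le> P $$ (1, 1)"
    using pos_semidef_diag_nonneg[OF assms] by auto
  then have r: "P $$ (0, 0) = of_real (Re (P $$ (0, 0)))" "P $$ (1, 1) = of_real (Re (P $$ (1, 1)))"
    by (auto simp: less_eq_complex_def complex_eq_iff)
  have h: "P $$ (1, 0) = cnj (P $$ (0, 1))"
    using index_mat_adjoint[of 1 P 0] P by simp
  have "mat 2 2 (\<lambda>ij. P $$ ij) = P" using P by (intro eq_matI) auto
  then have "det P = P $$ (0, 0) * P $$ (1, 1) - P $$ (0, 1) * P $$ (1, 0)"
    using det_2[of "\<lambda>ij. P $$ ij"] by simp
  also have "P $$ (0, 1) * P $$ (1, 0) = of_real ((cmod (P $$ (0, 1)))\<^sup>2)"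
    unfolding h by (rule complex_norm_square[symmetric])
  also have "P $$ (0, 0) * P $$ (1, 1) = of_real (Re (P $$ (0, 0)) * Re (P $$ (1, 1)))"
    using r by (metis of_real_mult)
  finally have "(cmod (P $$ (0, 1)))\<^sup>2 \<le> Re (P $$ (0, 0)) * Re (P $$ (1, 1))"
    using pos_semidef_det_nonneg[OF assms] by (simp add: less_eq_complex_def)
  then show ?thesis
    using that[OF _ _ _ r _ h] d by (simp add: less_eq_complex_def)
qed

text \<open>The left side is the trace of \<open>P\<close> times the transpose of \<open>Q\<close>.
  In terms of the entries the claim reduces to \<open>2 * Re (p * q) \<le> a * d + b * c\<close>.
  The determinants bound the moduli of \<open>p\<close> and \<open>q\<close>, and the inequality of
  arithmetic and geometric means for \<open>a * d\<close> and \<open>b * c\<close> does the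
  rest.\<close>

lemma trace_product_bound:
  assumes "pos_semidef 2 P" "pos_semidef 2 Q"
  shows "Re (\<Sum>i<2. \<Sum>j<2. P $$ (i, j) * Q $$ (i, j)) \<le> Re (mat_trace P * mat_trace Q)"
proof -
  obtain a b p where P: "0 \<le> a" "0 \<le> b" "(cmod p)\<^sup>2 \<le> a * b" "P $$ (0, 0) = of_real a"
    "P $$ (1, 1) = of_real b" "P $$ (0, 1) = p" "P $$ (1, 0) = cnj p"
    using pos_semidef_2_entries[OF assms(1)] by metis
  obtain c d q where Q: "0 \<le> c" "0 \<le> d" "(cmod q)\<^sup>2 \<le> c * d" "Q $$ (0, 0) = of_real c"
    "Q $$ (1, 1) = of_real d" "Q $$ (0, 1) = q" "Q $$ (1, 0) = cnj q"
    using pos_semidef_2_entries[OF assms(2)] by metis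
  have "(2 * (cmod p * cmod q))\<^sup>2 = 4 * ((cmod p)\<^sup>2 * (cmod q)\<^sup>2)"
    by (simp add: power_mult_distrib)
  also have "\<dots> \<le> 4 * ((a * b) * (c * d))"
    using P Q by (intro mult_left_mono mult_mono) auto
  also have "\<dots> \<le> (a * d + b * c)\<^sup>2"
    using sum_squares_ge_zero[of "a * d - b * c" 0] by (simp add: power2_eq_square algebra_simps)
  finally have "2 * (cmod p * cmod q) \<le> a * d + b * c"
    by (rule power2_le_imp_le) (use P Q in simp)
  moreover have "Re (p * q) \<le> cmod p * cmod q"
    using complex_Re_le_cmod[of "p * q"] by (simp add: norm_mult)
  moreover have "dim_row P = 2" "dim_row Q = 2" using assms by (auto simp: pos_semidef_def)
  moreover have "Re (cnj p * cnj q) = Re (p * q)" by simp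
  ultimately show ?thesis
    using P Q by (simp add: sum_lessThan_2 mat_trace_def algebra_simps)
qed

lemma unitary_mat_transpose:
  assumes "unitary_mat n U"
  shows "unitary_mat n (transpose_mat U)"
proof -
  note U = unitary_matD[OF assms]
  have "mat_adjoint (transpose_mat U) * transpose_mat U = transpose_mat (U * mat_adjoint U)"
    using U(1) by (subst transpose_mult[of _ n n _ n]) (auto simp: transpose_adjoint intro!: arg_cong2[of _ _ _ _ "(*)"])
  then show ?thesis
    using U by (intro unitary_matI) auto
qed

text \<open>A vector of two qubits is read as a 2 x 2 coefficient matrix. The Bell vector is the
  identity divided by the square root of 2, and local unitaries turn it into
  \<open>U * transpose_mat V\<close> with the same factor.\<close>

lemma max_entangled_vec_entries:
  assumes "\<psi> \<in> max_entangled_vecs"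
  obtains W where "unitary_mat 2 W"
    "\<psi> = vec 4 (\<lambda>i. complex_of_real (1 / sqrt 2) * W $$ (i div 2, i mod 2))"
proof -
  obtain U V where UV: "unitary_mat 2 U" "unitary_mat 2 V" "\<psi> = tensor_mat U V *\<^sub>v bell_vec"
    using assms by (auto simp: max_entangled_vecs_def)
  note U = unitary_matD(1)[OF UV(1)] and V = unitary_matD(1)[OF UV(2)]
  have bell: "bell_vec \<in> carrier_vec 4" "bell_vec $ 0 = complex_of_real (1 / sqrt 2)" "bell_vec $ 1 = 0"
    "bell_vec $ 2 = 0" "bell_vec $ 3 = complex_of_real (1 / sqrt 2)"
    by (auto simp: bell_vec_def tensor_vec_def unit_vec_def intro!: carrier_vecI)
  have "\<psi> $ i = complex_of_real (1 / sqrt 2) * (U * transpose_mat V) $$ (i div 2, i mod 2)" if "i < 4" for i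
  proof -
    have "i div 2 < 2" "i mod 2 < 2" using that by auto
    moreover have "\<psi> $ i = (\<Sum>k<4. tensor_mat U V $$ (i, k) * bell_vec $ k)"
      unfolding UV(3) using U V bell(1) that by (subst index_mult_mat_vec_sum) auto
    ultimately show ?thesis
      using U V bell that
      by (simp add: sum_lessThan_4 sum_lessThan_2 index_mult_mat_sum algebra_simps del: index_mult_mat(1))
  qed
  then have "\<psi> = vec 4 (\<lambda>i. complex_of_real (1 / sqrt 2) * (U * transpose_mat V) $$ (i div 2, i mod 2))"
    using U V by (intro eq_vecI) (auto simp: UV(3))
  then show ?thesis
    using that unitary_mat_mult[OF UV(1) unitary_mat_transpose[OF UV(2)]] by blast
qed

lemma Re_two_mult: "Re (2 * z) = 2 * Re z"
  by simp

text \<open>With \<open>W\<close> the coefficient matrix of \<open>\<psi>\<close>, the expectation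
  is half the trace of \<open>mat_adjoint W * \<alpha> * W\<close> times the transpose of
  \<open>\<beta>\<close>. Conjugation by \<open>W\<close> preserves positivity and trace, so
  \<open>trace_product_bound\<close> applies.\<close>

lemma quad_form_tensor_max_entangled:
  assumes psd: "pos_semidef 2 \<alpha>" "pos_semidef 2 \<beta>" and psi: "\<psi> \<in> max_entangled_vecs"
  shows "2 * Re (quad_form (tensor_mat \<alpha> \<beta>) \<psi>) \<le> Re (mat_trace (tensor_mat \<alpha> \<beta>))"
proof -
  obtain W where W: "unitary_mat 2 W"
    and psi: "\<psi> = vec 4 (\<lambda>i. complex_of_real (1 / sqrt 2) * W $$ (i div 2, i mod 2))"
    using max_entangled_vec_entries[OF psi] by blast
  note Wc = unitary_matD[OF W]
  have c: "\<alpha> \<in> carrier_mat 2 2" "\<beta> \<in> carrier_mat 2 2" using psd by (auto simp: pos_semidef_def)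
  define P where "P = mat_adjoint W * \<alpha> * W"
  have Pc: "P \<in> carrier_mat 2 2" using Wc by (simp add: P_def)
  have P: "pos_semidef 2 P"
    using pos_semidef_conjugation[OF psd(1), of "mat_adjoint W" 2] Wc(1) by (simp add: P_def)
  have "mat_trace P = mat_trace (W * (mat_adjoint W * \<alpha>))"
    unfolding P_def using Wc c by (intro mat_trace_comm) auto
  also have "W * (mat_adjoint W * \<alpha>) = (W * mat_adjoint W) * \<alpha>"
    using Wc(1) c by (intro assoc_mult_mat[symmetric]) auto
  finally have trP: "mat_trace P = mat_trace \<alpha>" using Wc c by simp
  have Pe: "P $$ (j, l) = (\<Sum>k<2. (\<Sum>i<2. cnj (W $$ (i, j)) * \<alpha> $$ (i, k)) * W $$ (k, l))" if "j < 2" "l < 2" for j l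
    using that Wc(1) c unfolding P_def
    by (simp add: index_mult_mat_sum[of j "mat_adjoint W * \<alpha>" l W] index_mult_mat_sum[of j "mat_adjoint W" _ \<alpha>]
        del: index_mult_mat(1) assoc_mult_mat)
  define s where "s = complex_of_real (1 / sqrt 2)"
  have s: "cnj s = s" "s * s = 1 / 2"
    by (simp_all add: s_def flip: of_real_mult)
  have half: "s * (s * x) = x / 2" for x
    using s(2) by (simp add: mult.assoc[symmetric])
  have "quad_form (tensor_mat \<alpha> \<beta>) \<psi> =
      (\<Sum>I<4. \<Sum>J<4. cnj (\<psi> $ I) * tensor_mat \<alpha> \<beta> $$ (I, J) * \<psi> $ J)"
    using c by (intro quad_form_sum) (auto simp: psi)
  also have "\<dots> = (\<Sum>I<4. \<Sum>J<4. (s * s) * (cnj (W $$ (I div 2, I mod 2)) *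
      (\<alpha> $$ (I div 2, J div 2) * \<beta> $$ (I mod 2, J mod 2)) * W $$ (J div 2, J mod 2)))"
    using c by (intro sum.cong refl) (auto simp: psi s_def)
  also have "\<dots> = (s * s) * (\<Sum>I<4. \<Sum>J<4. cnj (W $$ (I div 2, I mod 2)) *
      (\<alpha> $$ (I div 2, J div 2) * \<beta> $$ (I mod 2, J mod 2)) * W $$ (J div 2, J mod 2))"
    by (simp only: sum_distrib_left)
  also have "(\<Sum>I<4. \<Sum>J<4. cnj (W $$ (I div 2, I mod 2)) *
      (\<alpha> $$ (I div 2, J div 2) * \<beta> $$ (I mod 2, J mod 2)) * W $$ (J div 2, J mod 2)) =
      (\<Sum>j<2. \<Sum>l<2. P $$ (j, l) * \<beta> $$ (j, l))"
    by (simp add: sum_lessThan_4 sum_lessThan_2 Pe algebra_simps)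
  finally have eq: "quad_form (tensor_mat \<alpha> \<beta>) \<psi> =
      (s * s) * (\<Sum>j<2. \<Sum>l<2. P $$ (j, l) * \<beta> $$ (j, l))" .
  have "2 * quad_form (tensor_mat \<alpha> \<beta>) \<psi> = (\<Sum>j<2. \<Sum>l<2. P $$ (j, l) * \<beta> $$ (j, l))"
    unfolding eq s(2) by simp
  then have "2 * Re (quad_form (tensor_mat \<alpha> \<beta>) \<psi>) = Re (\<Sum>j<2. \<Sum>l<2. P $$ (j, l) * \<beta> $$ (j, l))"
    by (metis Re_two_mult)
  also have "\<dots> \<le> Re (mat_trace P * mat_trace \<beta>)"
    by (rule trace_product_bound[OF P psd(2)])
  also have "\<dots> = Re (mat_trace (tensor_mat \<alpha> \<beta>))"
    using c by (simp only: trP mat_trace_tensor)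
  finally show ?thesis .
qed

lemma quad_form_add:
  assumes "A \<in> carrier_mat n n" "B \<in> carrier_mat n n" "v \<in> carrier_vec n"
  shows "quad_form (A + B) v = quad_form A v + quad_form B v"
  using assms by (simp add: quad_form_sum[of _ n] ring_distribs sum.distrib)

lemma max_entangled_carrier: "\<psi> \<in> max_entangled_vecs \<Longrightarrow> \<psi> \<in> carrier_vec 4"
  by (erule max_entangled_vec_entries) simp

lemma quad_form_sep_cone_max_entangled:
  assumes "sep_cone 2 2 X" "\<psi> \<in> max_entangled_vecs"
  shows "2 * Re (quad_form X \<psi>) \<le> Re (mat_trace X)"
  using assms(1)
proof (induction rule: sep_cone.induct)
  case zero
  then show ?case
    using max_entangled_carrier[OF assms(2)] by (simp add: quad_form_sum[of _ 4] mat_trace_zero)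
next
  case (add_tensor \<alpha> \<beta> X)
  have c: "tensor_mat \<alpha> \<beta> \<in> carrier_mat 4 4" "X \<in> carrier_mat 4 4"
    using tensor_carrier_pos_semidef[OF add_tensor(1,2)] sep_cone_carrier[OF add_tensor(3)] by simp_all
  show ?case
    using add_tensor.IH quad_form_tensor_max_entangled[OF add_tensor(1,2) assms(2)]
      quad_form_add[OF c max_entangled_carrier[OF assms(2)]] mat_trace_add[OF c]
    by simp
qed

lemma bell_vec_max_entangled: "tensor_mat (1\<^sub>m 2) (1\<^sub>m 2) *\<^sub>v bell_vec \<in> max_entangled_vecs"
  unfolding max_entangled_vecs_def by (auto simp: unitary_mat_def intro!: exI[of _ "1\<^sub>m 2"])

lemma fidelity_separable_le:
  assumes "sep_cone 2 2 \<sigma>" "mat_trace \<sigma> = 1"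
  shows "fidelity \<sigma> \<le> 1 / 2"
  unfolding fidelity_def
proof (rule cSUP_least)
  show "max_entangled_vecs \<noteq> {}" using bell_vec_max_entangled by blast
  fix \<psi> assume "\<psi> \<in> max_entangled_vecs"
  then show "Re (quad_form \<sigma> \<psi>) \<le> 1 / 2"
    using quad_form_sep_cone_max_entangled[OF assms(1)] assms(2) by force
qed

lemma fidelity_locc_separable_le:
  assumes "separable_state 2 2 \<rho>" "density_operator (2 * 2) \<rho>" "tp_locc 2 2 2 2 \<Lambda>"
  shows "fidelity (\<Lambda> \<rho>) \<le> 1 / 2"
proof (rule fidelity_separable_le)
  show "sep_cone 2 2 (\<Lambda> \<rho>)"
    using assms sep_cone_locc_protocol separable_imp_sep_cone unfolding tp_locc_def by blast
  show "mat_trace (\<Lambda> \<rho>) = 1"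
    using assms by (simp add: tp_locc_def cptp_def density_operator_def pos_semidef_def)
qed

section \<open>The filtering protocol\<close>

definition kraus :: "complex mat \<Rightarrow> complex mat \<Rightarrow> complex mat" where
  "kraus K X = K * X * mat_adjoint K"

lemma dim_kraus [simp]: "dim_row (kraus K X) = dim_row K" "dim_col (kraus K X) = dim_row K"
  by (simp_all add: kraus_def)

lemma index_kraus:
  assumes "K \<in> carrier_mat n m" "X \<in> carrier_mat m m" "i < n" "j < n"
  shows "kraus K X $$ (i, j) = (\<Sum>p<m. \<Sum>q<m. K $$ (i, p) * X $$ (p, q) * cnj (K $$ (j, q)))"
proof -
  have "kraus K X $$ (i, j) = (\<Sum>q<m. \<Sum>p<m. K $$ (i, p) * X $$ (p, q) * cnj (K $$ (j, q)))"
    unfolding kraus_def using assms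
    by (subst index_mult_mat_sum) (auto simp: index_mult_mat_sum sum_distrib_right simp del: index_mult_mat(1) intro!: sum.cong)
  then show ?thesis by (subst sum.swap)
qed

lemma kraus_carrier: "K \<in> carrier_mat n m \<Longrightarrow> kraus K X \<in> carrier_mat n n"
  by (simp add: kraus_def)

lemma kraus_mult:
  assumes "K \<in> carrier_mat n m" "L \<in> carrier_mat p n" "X \<in> carrier_mat m m"
  shows "kraus L (kraus K X) = kraus (L * K) X"
  unfolding kraus_def using assms
  by (simp add: mat_adjoint_mult[of L p n K m] assoc_mult_mat[of _ p n _ _ _ p] assoc_mult_mat[of _ p n _ m _ m]
      assoc_mult_mat[of _ p m _ _ _ p] assoc_mult_mat[of _ n m _ m _ n] assoc_mult_mat[of _ n m _ n _ p]
      assoc_mult_mat[of _ m m _ n _ p])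

lemma linear_superop_kraus:
  assumes "K \<in> carrier_mat n m"
  shows "linear_superop m n (kraus K)"
  unfolding linear_superop_def
proof (intro conjI ballI allI)
  fix X Y :: "complex mat" and c assume X: "X \<in> carrier_mat m m"
  show "kraus K X \<in> carrier_mat n n" using assms by (simp add: kraus_def)
  show "kraus K (c \<cdot>\<^sub>m X) = c \<cdot>\<^sub>m kraus K X"
    using assms X by (intro eq_matI) (auto simp: index_kraus[of K n m] sum_distrib_left mult_ac)
  assume Y: "Y \<in> carrier_mat m m"
  show "kraus K (X + Y) = kraus K X + kraus K Y"
    using assms X Y by (intro eq_matI) (auto simp: index_kraus[of K n m] sum.distrib ring_distribs)
qed

lemma index_apply_left_kraus:
  assumes "K \<in> carrier_mat n m" "r < n * k" "s < n * k"
  shows "apply_left m n k (kraus K) X $$ (r, s) =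
    (\<Sum>p<m. \<Sum>q<m. K $$ (r div k, p) * X $$ (p * k + r mod k, q * k + s mod k) * cnj (K $$ (s div k, q)))"
  using assms by (simp add: apply_left_def index_kraus[OF assms(1)] pair_index_bounds(1))

lemma index_apply_right_kraus:
  assumes "K \<in> carrier_mat n m" "r < k * n" "s < k * n"
  shows "apply_right k m n (kraus K) X $$ (r, s) =
    (\<Sum>p<m. \<Sum>q<m. K $$ (r mod n, p) * X $$ (r div n * m + p, s div n * m + q) * cnj (K $$ (s mod n, q)))"
  using assms by (simp add: apply_right_def index_kraus[OF assms(1)] pair_index_bounds_right)

text \<open>Reduces positivity of the extended map to conjugation by a single matrix. The identity
  factor contributes two Kronecker deltas, which collapse the sums over the ancilla.\<close>

lemma apply_left_kraus:
  assumes K: "K \<in> carrier_mat n m" and X: "X \<in> carrier_mat (m * k) (m * k)"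
  shows "apply_left m n k (kraus K) X = kraus (tensor_mat K (1\<^sub>m k)) X"
proof (rule eq_matI)
  have T: "tensor_mat K (1\<^sub>m k) \<in> carrier_mat (n * k) (m * k)" using K by (simp add: tensor_mat_carrier)
  then show "dim_row (apply_left m n k (kraus K) X) = dim_row (kraus (tensor_mat K (1\<^sub>m k)) X)"
    "dim_col (apply_left m n k (kraus K) X) = dim_col (kraus (tensor_mat K (1\<^sub>m k)) X)" using K by auto
  fix r s assume "r < dim_row (kraus (tensor_mat K (1\<^sub>m k)) X)" "s < dim_col (kraus (tensor_mat K (1\<^sub>m k)) X)"
  then have rs: "r < n * k" "s < n * k" using K by auto
  note b = pair_index_bounds[OF rs(1)] pair_index_bounds[OF rs(2)]
  have "kraus (tensor_mat K (1\<^sub>m k)) X $$ (r, s) = (\<Sum>a<m. \<Sum>c<k. \<Sum>a'<m. \<Sum>c'<k.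
      if c' = s mod k then if c = r mod k then K $$ (r div k, a) * X $$ (a * k + c, a' * k + c') * cnj (K $$ (s div k, a')) else 0 else 0)"
    unfolding index_kraus[OF T X rs] sum_pair_index using K b rs
    by (intro sum.cong refl) (auto simp: pair_index_less)
  also have "\<dots> = (\<Sum>a<m. \<Sum>c<k. if c = r mod k then
      \<Sum>a'<m. K $$ (r div k, a) * X $$ (a * k + c, a' * k + s mod k) * cnj (K $$ (s div k, a')) else 0)"
    using b by (intro sum.cong refl) (auto simp: sum.delta)
  also have "\<dots> = (\<Sum>a<m. \<Sum>a'<m. K $$ (r div k, a) * X $$ (a * k + r mod k, a' * k + s mod k) * cnj (K $$ (s div k, a')))"
    by (rule sum.cong[OF refl]) (use b in \<open>auto simp: sum.delta\<close>)
  finally show "apply_left m n k (kraus K) X $$ (r, s) = kraus (tensor_mat K (1\<^sub>m k)) X $$ (r, s)"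
    by (simp add: index_apply_left_kraus[OF K rs])
qed

lemma apply_right_kraus:
  assumes K: "K \<in> carrier_mat n m" and X: "X \<in> carrier_mat (k * m) (k * m)"
  shows "apply_right k m n (kraus K) X = kraus (tensor_mat (1\<^sub>m k) K) X"
proof (rule eq_matI)
  have T: "tensor_mat (1\<^sub>m k) K \<in> carrier_mat (k * n) (k * m)" using K by (simp add: tensor_mat_carrier)
  then show "dim_row (apply_right k m n (kraus K) X) = dim_row (kraus (tensor_mat (1\<^sub>m k) K) X)"
    "dim_col (apply_right k m n (kraus K) X) = dim_col (kraus (tensor_mat (1\<^sub>m k) K) X)" using K by auto
  fix r s assume "r < dim_row (kraus (tensor_mat (1\<^sub>m k) K) X)" "s < dim_col (kraus (tensor_mat (1\<^sub>m k) K) X)"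
  then have rs: "r < k * n" "s < k * n" using K by auto
  note b = pair_index_bounds[OF rs(1)] pair_index_bounds[OF rs(2)]
  have "kraus (tensor_mat (1\<^sub>m k) K) X $$ (r, s) = (\<Sum>c<k. \<Sum>a<m. \<Sum>c'<k. \<Sum>a'<m.
      if c' = s div n then if c = r div n then K $$ (r mod n, a) * X $$ (c * m + a, c' * m + a') * cnj (K $$ (s mod n, a')) else 0 else 0)"
    unfolding index_kraus[OF T X rs] sum_pair_index using K b rs
    by (intro sum.cong refl) (auto simp: pair_index_less)
  also have "\<dots> = (\<Sum>c<k. \<Sum>a<m. if c = r div n then
      \<Sum>a'<m. K $$ (r mod n, a) * X $$ (c * m + a, s div n * m + a') * cnj (K $$ (s mod n, a')) else 0)"
    by (rule sum.cong[OF refl], rule sum.cong[OF refl], subst sum.swap) (use b in \<open>auto simp: sum.delta\<close>)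
  also have "\<dots> = (\<Sum>a<m. \<Sum>a'<m. K $$ (r mod n, a) * X $$ (r div n * m + a, s div n * m + a') * cnj (K $$ (s mod n, a')))"
    by (subst sum.swap) (use b in \<open>auto simp: sum.delta\<close>)
  finally show "apply_right k m n (kraus K) X $$ (r, s) = kraus (tensor_mat (1\<^sub>m k) K) X $$ (r, s)"
    by (simp add: index_apply_right_kraus[OF K rs])
qed

lemma completely_positive_kraus:
  assumes "K \<in> carrier_mat n m"
  shows "completely_positive m n (kraus K)"
  unfolding completely_positive_def
proof (intro conjI allI impI)
  show "linear_superop m n (kraus K)" by (rule linear_superop_kraus[OF assms])
  fix k X assume X: "pos_semidef (m * k) X"
  then have "apply_left m n k (kraus K) X = kraus (tensor_mat K (1\<^sub>m k)) X"
    using assms by (intro apply_left_kraus) (auto simp: pos_semidef_def)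
  also have "pos_semidef (n * k) \<dots>"
    unfolding kraus_def using assms by (intro pos_semidef_conjugation[OF X]) (simp add: tensor_mat_carrier)
  finally show "pos_semidef (n * k) (apply_left m n k (kraus K) X)" .
qed

text \<open>\<open>apply_left\<close> evaluates the map only at \<open>m x m\<close> blocks, so
  agreement there suffices. This matters because the Kraus forms of the protocol branches are proved
  only for matrices of the right size.\<close>

lemma completely_positive_cong:
  assumes "completely_positive m n \<Phi>" "\<And>X. X \<in> carrier_mat m m \<Longrightarrow> \<Psi> X = \<Phi> X"
  shows "completely_positive m n \<Psi>"
proof -
  have "apply_left m n k \<Psi> X = apply_left m n k \<Phi> X" for k X
    by (simp add: apply_left_def assms(2))
  moreover have "linear_superop m n \<Psi>"
    using assms by (auto simp: completely_positive_def linear_superop_def)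
  ultimately show ?thesis using assms(1) by (simp add: completely_positive_def)
qed

lemma completely_positive_family_sum:
  assumes "finite I" "\<And>j. j \<in> I \<Longrightarrow> completely_positive m n (\<Phi> j)"
  shows "completely_positive m n (\<lambda>X. mat_family_sum n n (\<lambda>j. \<Phi> j X) I)"
  unfolding completely_positive_def
proof (intro conjI allI impI)
  have lin: "linear_superop m n (\<Phi> j)" if "j \<in> I" for j
    using assms(2)[OF that] by (simp add: completely_positive_def)
  have c: "dim_row (\<Phi> j X) = n" "dim_col (\<Phi> j X) = n" if "j \<in> I" "X \<in> carrier_mat m m" for j X
    using linear_superopD(1)[OF lin] that by auto
  show "linear_superop m n (\<lambda>X. mat_family_sum n n (\<lambda>j. \<Phi> j X) I)"
    unfolding linear_superop_def
    by (intro conjI ballI allI eq_matI)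
      (auto simp: linear_superopD[OF lin] c sum.distrib sum_distrib_left)
  fix k X assume X: "pos_semidef (m * k) X"
  have "apply_left m n k (\<lambda>X. mat_family_sum n n (\<lambda>j. \<Phi> j X) I) X =
      mat_family_sum (n * k) (n * k) (\<lambda>j. apply_left m n k (\<Phi> j) X) I"
    by (intro eq_matI) (auto simp: apply_left_def pair_index_bounds(1))
  then show "pos_semidef (n * k) (apply_left m n k (\<lambda>X. mat_family_sum n n (\<lambda>j. \<Phi> j X) I) X)"
    using assms X by (auto simp: completely_positive_def intro: pos_semidef_family_sum)
qed

section \<open>Instruments and conservation of the trace\<close>

lemma mat_trace_sum: "A \<in> carrier_mat n n \<Longrightarrow> mat_trace A = (\<Sum>i<n. A $$ (i, i))"
  by (simp add: mat_trace_def)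

lemma instrument_kraus:
  assumes K: "\<And>j. j < N \<Longrightarrow> K j \<in> carrier_mat n m"
    and sum1: "mat_family_sum m m (\<lambda>j. mat_adjoint (K j) * K j) {..<N} = 1\<^sub>m m"
  shows "instrument m n N (\<lambda>j. kraus (K j))"
  unfolding instrument_def
proof (intro conjI allI impI ballI)
  show "completely_positive m n (kraus (K j))" if "j < N" for j
    by (rule completely_positive_kraus[OF K[OF that]])
  fix X :: "complex mat" assume X: "X \<in> carrier_mat m m"
  have *: "mat_trace (kraus (K j) X) = (\<Sum>i<m. \<Sum>p<m. (mat_adjoint (K j) * K j) $$ (i, p) * X $$ (p, i))" if "j < N" for j
  proof -
    note Kj = K[OF that]
    have "mat_trace (kraus (K j) X) = mat_trace (mat_adjoint (K j) * (K j * X))"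
      unfolding kraus_def using Kj X by (intro mat_trace_comm) auto
    also have "mat_adjoint (K j) * (K j * X) = mat_adjoint (K j) * K j * X"
      using Kj X by (intro assoc_mult_mat[symmetric]) auto
    finally show ?thesis
      using Kj X by (auto simp: mat_trace_sum[of _ m] index_mult_mat_sum[of _ "mat_adjoint (K j) * K j"]
          simp del: index_mult_mat(1) assoc_mult_mat)
  qed
  have "(\<Sum>j<N. mat_trace (kraus (K j) X)) =
      (\<Sum>j<N. \<Sum>i<m. \<Sum>p<m. (mat_adjoint (K j) * K j) $$ (i, p) * X $$ (p, i))"
    by (intro sum.cong refl *) simp
  also have "\<dots> = (\<Sum>i<m. \<Sum>p<m. \<Sum>j<N. (mat_adjoint (K j) * K j) $$ (i, p) * X $$ (p, i))"
    by (rule trans[OF sum.swap], rule sum.cong[OF refl], rule sum.swap)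
  also have "\<dots> = (\<Sum>i<m. \<Sum>p<m. mat_family_sum m m (\<lambda>j. mat_adjoint (K j) * K j) {..<N} $$ (i, p) * X $$ (p, i))"
    by (intro sum.cong refl) (simp add: sum_distrib_right)
  also have "\<dots> = (\<Sum>i<m. \<Sum>p<m. if p = i then X $$ (p, i) else 0)"
    unfolding sum1 by (intro sum.cong refl) auto
  also have "\<dots> = mat_trace X" using X by (simp add: mat_trace_sum)
  finally show "(\<Sum>j<N. mat_trace (kraus (K j) X)) = mat_trace X" .
qed

text \<open>The trace of the extended map is the sum of the traces of its values at the diagonal
  blocks, and the instrument conserves each of these after summing over the outcomes.\<close>

lemma mat_trace_apply_left:
  assumes "instrument m n N E" "X \<in> carrier_mat (m * k) (m * k)"
  shows "(\<Sum>j<N. mat_trace (apply_left m n k (E j) X)) = mat_trace X"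
proof -
  let ?B = "\<lambda>b. mat m m (\<lambda>(i, j). X $$ (i * k + b, j * k + b))"
  have "mat_trace (apply_left m n k (E j) X) = (\<Sum>b<k. mat_trace (E j (?B b)))" if "j < N" for j
  proof -
    have "E j (?B b) \<in> carrier_mat n n" for b
      using assms(1) that by (auto simp: instrument_def completely_positive_def linear_superop_def)
    then have "(\<Sum>b<k. mat_trace (E j (?B b))) = (\<Sum>b<k. \<Sum>a<n. E j (?B b) $$ (a, a))"
      by (intro sum.cong refl mat_trace_sum)
    also have "\<dots> = (\<Sum>a<n. \<Sum>b<k. E j (?B b) $$ (a, a))" by (rule sum.swap)
    also have "\<dots> = mat_trace (apply_left m n k (E j) X)"
      by (auto simp: mat_trace_sum[of _ "n * k"] sum_pair_index apply_left_def pair_index_less intro!: sum.cong)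
    finally show ?thesis ..
  qed
  then have "(\<Sum>j<N. mat_trace (apply_left m n k (E j) X)) = (\<Sum>b<k. \<Sum>j<N. mat_trace (E j (?B b)))"
    by (simp add: sum.swap[of _ "{..<k}"])
  also have "\<dots> = (\<Sum>b<k. mat_trace (?B b))"
    using assms(1) by (simp add: instrument_def)
  also have "\<dots> = (\<Sum>b<k. \<Sum>a<m. X $$ (a * k + b, a * k + b))"
    by (simp add: mat_trace_sum[of _ m])
  also have "\<dots> = (\<Sum>a<m. \<Sum>b<k. X $$ (a * k + b, a * k + b))" by (rule sum.swap)
  also have "\<dots> = mat_trace X"
    using assms(2) by (simp add: mat_trace_sum[of X "m * k"] sum_pair_index)
  finally show ?thesis .
qed

lemma mat_trace_apply_right:
  assumes "instrument m n N E" "X \<in> carrier_mat (k * m) (k * m)"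
  shows "(\<Sum>j<N. mat_trace (apply_right k m n (E j) X)) = mat_trace X"
proof -
  let ?B = "\<lambda>b. mat m m (\<lambda>(i, j). X $$ (b * m + i, b * m + j))"
  have "mat_trace (apply_right k m n (E j) X) = (\<Sum>b<k. mat_trace (E j (?B b)))" if "j < N" for j
  proof -
    have "E j (?B b) \<in> carrier_mat n n" for b
      using assms(1) that by (auto simp: instrument_def completely_positive_def linear_superop_def)
    then have "(\<Sum>b<k. mat_trace (E j (?B b))) = (\<Sum>b<k. \<Sum>a<n. E j (?B b) $$ (a, a))"
      by (intro sum.cong refl mat_trace_sum)
    also have "\<dots> = mat_trace (apply_right k m n (E j) X)"
      by (auto simp: mat_trace_sum[of _ "k * n"] sum_pair_index apply_right_def pair_index_less intro!: sum.cong)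
    finally show ?thesis ..
  qed
  then have "(\<Sum>j<N. mat_trace (apply_right k m n (E j) X)) = (\<Sum>b<k. \<Sum>j<N. mat_trace (E j (?B b)))"
    by (simp add: sum.swap[of _ "{..<k}"])
  also have "\<dots> = (\<Sum>b<k. mat_trace (?B b))"
    using assms(1) by (simp add: instrument_def)
  also have "\<dots> = (\<Sum>b<k. \<Sum>a<m. X $$ (b * m + a, b * m + a))"
    by (simp add: mat_trace_sum[of _ m])
  also have "\<dots> = mat_trace X"
    using assms(2) by (simp add: mat_trace_sum[of X "k * m"] sum_pair_index)
  finally show ?thesis .
qed

text \<open>The size of the output is carried through the induction, because the diagonal sum over
  \<open>eA * eB\<close> entries is the trace of a branch only if the branch has that size.\<close>

lemma mat_trace_locc_protocol:
  assumes "locc_protocol eA eB dA dB \<Lambda>" "X \<in> carrier_mat (dA * dB) (dA * dB)"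
  shows "\<Lambda> X \<in> carrier_mat (eA * eB) (eA * eB) \<and> mat_trace (\<Lambda> X) = mat_trace X"
  using assms
proof (induction arbitrary: X rule: locc_protocol.induct)
  case finish
  then show ?case by simp
next
  case (alice dA dA' N E dB \<Lambda>)
  have *: "\<Lambda> j (apply_left dA dA' dB (E j) X) \<in> carrier_mat (eA * eB) (eA * eB) \<and>
      mat_trace (\<Lambda> j (apply_left dA dA' dB (E j) X)) = mat_trace (apply_left dA dA' dB (E j) X)" if "j < N" for j
    using alice.IH[OF that] by simp
  then have "mat_trace (mat_family_sum (eA * eB) (eA * eB) (\<lambda>j. \<Lambda> j (apply_left dA dA' dB (E j) X)) {..<N})
      = (\<Sum>j<N. mat_trace (apply_left dA dA' dB (E j) X))"
    unfolding mat_trace_family_sum by (intro sum.cong refl) (metis lessThan_iff mat_trace_sum)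
  then show ?case
    using mat_trace_apply_left[OF alice.hyps(1) alice.prems] by simp
next
  case (bob dB dB' N E dA \<Lambda>)
  have *: "\<Lambda> j (apply_right dA dB dB' (E j) X) \<in> carrier_mat (eA * eB) (eA * eB) \<and>
      mat_trace (\<Lambda> j (apply_right dA dB dB' (E j) X)) = mat_trace (apply_right dA dB dB' (E j) X)" if "j < N" for j
    using bob.IH[OF that] by simp
  then have "mat_trace (mat_family_sum (eA * eB) (eA * eB) (\<lambda>j. \<Lambda> j (apply_right dA dB dB' (E j) X)) {..<N})
      = (\<Sum>j<N. mat_trace (apply_right dA dB dB' (E j) X))"
    unfolding mat_trace_family_sum by (intro sum.cong refl) (metis lessThan_iff mat_trace_sum)
  then show ?case
    using mat_trace_apply_right[OF bob.hyps(1) bob.prems] by simp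
qed

text \<open>
  Alice measures the filter \<open>K\<close>; the other two outcomes are the rows of the conjugate transpose
  of the adjugate of \<open>K\<close>, which completes \<open>K\<close> to an instrument because
  \<open>mat_adjoint K * K + adj K * mat_adjoint (adj K)\<close> is the squared Frobenius norm of \<open>K\<close> times
  the identity. On failure both parties reset their qubits, to the product state with index 1.
\<close>

definition alice_op :: "complex mat \<Rightarrow> nat \<Rightarrow> complex mat" where
  "alice_op K j = (if j = 0 then K else mat 2 2 (\<lambda>(a, b).
     if a \<noteq> 0 then 0
     else if j = 1 then if b = 0 then cnj (K $$ (1, 1)) else - cnj (K $$ (1, 0))
     else if b = 0 then - cnj (K $$ (0, 1)) else cnj (K $$ (0, 0))))"

text \<open>The Kraus operator \<open>|1><l|\<close>. Summed over \<open>l\<close>, it discards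
  Bob's qubit and prepares \<open>|1>\<close>. Alice's failure operators have only row 0, so she is
  left in \<open>|0>\<close>, and the joint state has index \<open>0 * 2 + 1\<close>.\<close>

definition bob_reset :: "nat \<Rightarrow> complex mat" where
  "bob_reset l = mat 2 2 (\<lambda>(a, b). if a = 1 \<and> b = l then 1 else 0)"

definition reset_bob :: "complex mat \<Rightarrow> complex mat" where
  "reset_bob X = mat_family_sum (2 * 2) (2 * 2) (\<lambda>l. apply_right 2 2 2 (kraus (bob_reset l)) X) {..<2}"

definition filter_protocol :: "complex mat \<Rightarrow> complex mat \<Rightarrow> complex mat" where
  "filter_protocol K X = mat_family_sum (2 * 2) (2 * 2)
     (\<lambda>j. (if j = 0 then (\<lambda>X. X) else reset_bob) (apply_left 2 2 2 (kraus (alice_op K j)) X)) {..<3}"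

lemma sum_lessThan_3: "(\<Sum>i<(3::nat). g i) = g 0 + g 1 + (g 2 :: 'a :: comm_monoid_add)"
  by (simp add: eval_nat_numeral)

lemma less_2_iff: "i < (2::nat) \<longleftrightarrow> i = 0 \<or> i = 1"
  by auto

lemma alice_op_carrier: "K \<in> carrier_mat 2 2 \<Longrightarrow> alice_op K j \<in> carrier_mat 2 2"
  by (simp add: alice_op_def)

lemma bob_reset_carrier: "bob_reset l \<in> carrier_mat 2 2"
  by (simp add: bob_reset_def)

lemma instrument_alice:
  assumes K: "K \<in> carrier_mat 2 2" and norm: "(\<Sum>a<2. \<Sum>b<2. (cmod (K $$ (a, b)))\<^sup>2) = 1"
  shows "instrument 2 2 3 (\<lambda>j. kraus (alice_op K j))"
proof (rule instrument_kraus)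
  show "alice_op K j \<in> carrier_mat 2 2" for j by (rule alice_op_carrier[OF K])
  have "complex_of_real (\<Sum>a<2. \<Sum>b<2. (cmod (K $$ (a, b)))\<^sup>2) = 1" by (simp only: norm of_real_1)
  then have n: "K $$ (0, 0) * cnj (K $$ (0, 0)) + K $$ (0, 1) * cnj (K $$ (0, 1)) +
      (K $$ (1, 0) * cnj (K $$ (1, 0)) + K $$ (1, 1) * cnj (K $$ (1, 1))) = 1"
    by (simp add: sum_lessThan_2 complex_norm_square del: of_real_power)
  show "mat_family_sum 2 2 (\<lambda>j. mat_adjoint (alice_op K j) * alice_op K j) {..<3} = 1\<^sub>m 2"
  proof (rule eq_matI)
    fix i j assume "i < dim_row (1\<^sub>m 2 :: complex mat)" "j < dim_col (1\<^sub>m 2 :: complex mat)"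
    then have ij: "i < 2" "j < 2" by auto
    have d: "dim_row (alice_op K j) = 2" "dim_col (alice_op K j) = 2" for j
      using alice_op_carrier[OF K] by auto
    have "mat_family_sum 2 2 (\<lambda>j. mat_adjoint (alice_op K j) * alice_op K j) {..<3} $$ (i, j) =
        (\<Sum>l<3. \<Sum>k<2. cnj (alice_op K l $$ (k, i)) * alice_op K l $$ (k, j))"
      using ij by (simp add: index_mult_mat_sum d del: index_mult_mat(1))
    then show "mat_family_sum 2 2 (\<lambda>j. mat_adjoint (alice_op K j) * alice_op K j) {..<3} $$ (i, j) = 1\<^sub>m 2 $$ (i, j)"
      using ij n unfolding less_2_iff
      by (auto simp: sum_lessThan_3 sum_lessThan_2 alice_op_def algebra_simps)
  qed auto
qed

lemma instrument_bob: "instrument 2 2 2 (\<lambda>l. kraus (bob_reset l))"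
proof (rule instrument_kraus)
  show "bob_reset l \<in> carrier_mat 2 2" for l by (rule bob_reset_carrier)
  show "mat_family_sum 2 2 (\<lambda>j. mat_adjoint (bob_reset j) * bob_reset j) {..<2} = 1\<^sub>m 2"
    by (rule eq_matI)
      (auto simp: index_mult_mat_sum sum_lessThan_2 bob_reset_def less_2_iff simp del: index_mult_mat(1))
qed

lemma locc_protocol_filter:
  assumes "K \<in> carrier_mat 2 2" "(\<Sum>a<2. \<Sum>b<2. (cmod (K $$ (a, b)))\<^sup>2) = 1"
  shows "locc_protocol 2 2 2 2 (filter_protocol K)"
proof -
  have "locc_protocol 2 2 2 2 reset_bob"
    using locc_protocol.bob[OF instrument_bob, of 2 2 2 "\<lambda>_ X. X"] locc_protocol.finish
    unfolding reset_bob_def[abs_def] by blast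
  then have "locc_protocol 2 2 2 2 (if j = 0 then (\<lambda>X. X) else reset_bob)" for j :: nat
    by (simp add: locc_protocol.finish)
  then show ?thesis
    unfolding filter_protocol_def[abs_def] by (intro locc_protocol.alice[OF instrument_alice[OF assms]])
qed

text \<open>Fuses Alice's and Bob's operations into one Kraus operator on the joint system for each
  \<open>l\<close>, the form in which complete positivity on the joint system is immediate.\<close>

lemma filter_protocol_branch:
  assumes K: "K \<in> carrier_mat 2 2" and X: "X \<in> carrier_mat 4 4"
  shows "reset_bob (apply_left 2 2 2 (kraus (alice_op K j)) X) =
    mat_family_sum 4 4 (\<lambda>l. kraus (tensor_mat (1\<^sub>m 2) (bob_reset l) * tensor_mat (alice_op K j) (1\<^sub>m 2)) X) {..<2}"
proof -
  let ?A = "tensor_mat (alice_op K j) (1\<^sub>m 2)"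
  let ?B = "\<lambda>l. tensor_mat (1\<^sub>m 2) (bob_reset l)"
  have A: "?A \<in> carrier_mat 4 4" using tensor_mat_carrier[OF alice_op_carrier[OF K], of "1\<^sub>m 2" 2 2] by simp
  have B: "?B l \<in> carrier_mat 4 4" for l using tensor_mat_carrier[OF _ bob_reset_carrier, of "1\<^sub>m 2" 2 2] by simp
  have AX: "apply_left 2 2 2 (kraus (alice_op K j)) X = kraus ?A X"
    using apply_left_kraus[OF alice_op_carrier[OF K], of X 2] X by simp
  have "kraus ?A X \<in> carrier_mat 4 4" by (rule kraus_carrier[OF A])
  then have "apply_right 2 2 2 (kraus (bob_reset l)) (kraus ?A X) = kraus (?B l * ?A) X" for l
    using apply_right_kraus[OF bob_reset_carrier, of "kraus ?A X" 2] kraus_mult[OF A B X] by simp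
  then show ?thesis unfolding reset_bob_def AX by simp
qed

text \<open>Conservation of the trace is inherited from the protocol structure; complete positivity
  comes from the joint Kraus form of the three branches, a single operator on success and two on
  each failure.\<close>

lemma cptp_filter_protocol:
  assumes K: "K \<in> carrier_mat 2 2" and norm: "(\<Sum>a<2. \<Sum>b<2. (cmod (K $$ (a, b)))\<^sup>2) = 1"
  shows "cptp (2 * 2) (2 * 2) (filter_protocol K)"
  unfolding cptp_def
proof (intro conjI ballI)
  show "mat_trace (filter_protocol K X) = mat_trace X" if "X \<in> carrier_mat (2 * 2) (2 * 2)" for X
    using mat_trace_locc_protocol[OF locc_protocol_filter[OF assms] that] by simp
  have A: "tensor_mat (alice_op K j) (1\<^sub>m 2) \<in> carrier_mat 4 4" for j
    using tensor_mat_carrier[OF alice_op_carrier[OF K], of "1\<^sub>m 2" 2 2] by simp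
  have B: "tensor_mat (1\<^sub>m 2) (bob_reset l) \<in> carrier_mat 4 4" for l
    using tensor_mat_carrier[OF _ bob_reset_carrier, of "1\<^sub>m 2" 2 2] by simp
  have "completely_positive 4 4 (\<lambda>X. (if j = 0 then (\<lambda>X. X) else reset_bob) (apply_left 2 2 2 (kraus (alice_op K j)) X))" for j :: nat
  proof (cases "j = 0")
    case True
    show ?thesis
    proof (rule completely_positive_cong)
      show "completely_positive 4 4 (kraus (tensor_mat (alice_op K j) (1\<^sub>m 2)))"
        by (rule completely_positive_kraus[OF A])
    qed (use True apply_left_kraus[OF alice_op_carrier[OF K], of _ 2] in simp)
  next
    case False
    show ?thesis
    proof (rule completely_positive_cong)
      show "completely_positive 4 4 (\<lambda>X. mat_family_sum 4 4
          (\<lambda>l. kraus (tensor_mat (1\<^sub>m 2) (bob_reset l) * tensor_mat (alice_op K j) (1\<^sub>m 2)) X) {..<2})"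
        by (intro completely_positive_family_sum completely_positive_kraus mult_carrier_mat[OF B A]) auto
    qed (use False filter_protocol_branch[OF K] in simp)
  qed
  then show "completely_positive (2 * 2) (2 * 2) (filter_protocol K)"
    unfolding filter_protocol_def[abs_def] by (intro completely_positive_family_sum) auto
qed

text \<open>After a failure the qubits are in \<open>|0>\<close> and \<open>|1>\<close>, so only the
  entry \<open>(1, 1)\<close> can survive: row or column indices from 2 on belong to Alice's
  \<open>|1>\<close>, which her failure operators never produce, and even indices to Bob's
  \<open>|0>\<close>.\<close>

lemma reset_branch_entries:
  assumes K: "K \<in> carrier_mat 2 2" and X: "X \<in> carrier_mat 4 4" and "j \<noteq> 0" "r < 4" "s < 4" "r \<noteq> 1 \<or> s \<noteq> 1"
  shows "reset_bob (apply_left 2 2 2 (kraus (alice_op K j)) X) $$ (r, s) = 0"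
proof -
  let ?Y = "apply_left 2 2 2 (kraus (alice_op K j)) X"
  have Y: "?Y $$ (a, b) = 0" if "a < 4" "b < 4" "2 \<le> a \<or> 2 \<le> b" for a b
  proof -
    have "a div 2 = 1 \<or> b div 2 = 1" "a div 2 < 2" "b div 2 < 2" using that by auto
    moreover have "alice_op K j $$ (1, q) = 0" if "q < 2" for q
      using that \<open>j \<noteq> 0\<close> by (simp add: alice_op_def)
    ultimately have "alice_op K j $$ (a div 2, p) = 0 \<or> alice_op K j $$ (b div 2, q) = 0" if "p < 2" "q < 2" for p q
      using that by auto
    then have "alice_op K j $$ (a div 2, p) * X $$ (p * 2 + a mod 2, q * 2 + b mod 2) *
        cnj (alice_op K j $$ (b div 2, q)) = 0" if "p < 2" "q < 2" for p q
      using that by fastforce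
    then show ?thesis
      using that index_apply_left_kraus[OF alice_op_carrier[OF K], of a 2 b j X]
      by (simp del: mult_eq_0_iff)
  qed
  have "bob_reset l $$ (r mod 2, p) * ?Y $$ (r div 2 * 2 + p, s div 2 * 2 + q) * cnj (bob_reset l $$ (s mod 2, q)) = 0"
    if pq: "p < 2" "q < 2" for l p q
  proof (cases "r mod 2 = 1 \<and> s mod 2 = 1")
    case True
    then have "2 \<le> r div 2 * 2 + p \<or> 2 \<le> s div 2 * 2 + q"
      using assms(4-6) by (auto simp: less_4_iff)
    moreover have "r div 2 < 2" "s div 2 < 2" using assms(4,5) by auto
    then have "r div 2 * 2 + p < 4" "s div 2 * 2 + q < 4"
      using pair_index_less[of "r div 2" 2 p 2] pair_index_less[of "s div 2" 2 q 2] pq by simp_all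
    ultimately show ?thesis using Y by simp
  next
    case False
    then have "bob_reset l $$ (r mod 2, p) = 0 \<or> bob_reset l $$ (s mod 2, q) = 0"
      using pq by (auto simp: bob_reset_def)
    then show ?thesis by auto
  qed
  then have "apply_right 2 2 2 (kraus (bob_reset l)) ?Y $$ (r, s) = 0" for l
    using assms(4,5) index_apply_right_kraus[OF bob_reset_carrier, of r 2 s l ?Y]
    by (simp del: mult_eq_0_iff)
  then show ?thesis
    using assms(4,5) by (simp add: reset_bob_def)
qed

section \<open>Singlet expectation after filtering\<close>

definition singlet :: "complex vec" where
  "singlet = vec 4 (\<lambda>i. complex_of_real (1 / sqrt 2) * (if i = 1 then 1 else if i = 2 then - 1 else 0))"

lemma singlet_max_entangled: "singlet \<in> max_entangled_vecs"
proof -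
  \<comment> \<open>Applied to Bob's half of the Bell vector, it sends \<open>|0>\<close> to
    \<open>|1>\<close> and \<open>|1>\<close> to \<open>-|0>\<close>, which gives the
    singlet.\<close>
  define V where "V = mat 2 2 (\<lambda>(a, b). if a = 0 \<and> b = 1 then - 1 else if a = 1 \<and> b = 0 then 1 else 0 :: complex)"
  have "unitary_mat 2 V"
    by (intro unitary_matI eq_matI)
      (auto simp: V_def index_mult_mat_sum sum_lessThan_2 less_2_iff simp del: index_mult_mat(1))
  moreover have "unitary_mat 2 (1\<^sub>m 2)" by (simp add: unitary_mat_def)
  moreover have "singlet = tensor_mat (1\<^sub>m 2) V *\<^sub>v bell_vec"
    by (rule eq_vecI)
      (auto simp: singlet_def V_def bell_vec_def tensor_vec_def index_mult_mat_vec_sum sum_lessThan_4 less_4_iff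
        simp del: index_mult_mat_vec)
  ultimately show ?thesis unfolding max_entangled_vecs_def by blast
qed

lemma quad_form_singlet:
  assumes "X \<in> carrier_mat 4 4"
  shows "2 * quad_form X singlet = X $$ (1, 1) + X $$ (2, 2) - X $$ (1, 2) - X $$ (2, 1)"
proof -
  define s where "s = complex_of_real (1 / sqrt 2)"
  have s: "cnj s = s" "s * s = 1 / 2"
    by (simp_all add: s_def flip: of_real_mult)
  have sing: "singlet = vec 4 (\<lambda>i. s * (if i = 1 then 1 else if i = 2 then - 1 else 0))"
    by (simp only: singlet_def s_def)
  have eq: "quad_form X singlet = (s * s) * (X $$ (1, 1) + X $$ (2, 2) - X $$ (1, 2) - X $$ (2, 1))"
    unfolding sing using assms s(1)
    by (subst quad_form_sum[of _ 4]) (auto simp: sum_lessThan_4 algebra_simps)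
  show ?thesis unfolding eq s(2) by simp
qed

text \<open>The successful branch contributes its trace minus the swap expectation to twice the
  singlet expectation. A failed branch sits entirely in entry \<open>(1, 1)\<close> and contributes
  exactly its trace, as its singlet fraction is 1/2. The traces add up to 1.\<close>

lemma quad_form_filter_protocol:
  assumes rho: "density_operator 4 \<rho>" and K: "K \<in> carrier_mat 2 2"
    and norm: "(\<Sum>a<2. \<Sum>b<2. (cmod (K $$ (a, b)))\<^sup>2) = 1"
  shows "2 * quad_form (filter_protocol K \<rho>) singlet =
    1 - quad_form (partial_transpose \<rho>) (vec 4 (\<lambda>i. cnj (K $$ (i mod 2, i div 2))))"
proof -
  have r: "\<rho> \<in> carrier_mat 4 4" using rho by (simp add: density_operator_def pos_semidef_def)
  let ?S = "apply_left 2 2 2 (kraus K) \<rho>"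
  define R where "R j = reset_bob (apply_left 2 2 2 (kraus (alice_op K j)) \<rho>)" for j
  let ?F = "filter_protocol K \<rho>"
  have F: "?F \<in> carrier_mat 4 4" by (simp add: filter_protocol_def)
  have Fe: "?F $$ (a, b) = ?S $$ (a, b) + R 1 $$ (a, b) + R 2 $$ (a, b)" if "a < 4" "b < 4" for a b
    using that by (simp add: filter_protocol_def sum_lessThan_3 R_def alice_op_def[of K 0])
  have R0: "R j $$ (a, b) = 0" if "j \<noteq> 0" "a < 4" "b < 4" "a \<noteq> 1 \<or> b \<noteq> 1" for j a b
    unfolding R_def by (rule reset_branch_entries[OF K r that])
  have "mat_trace ?F = 1"
    using mat_trace_locc_protocol[OF locc_protocol_filter[OF K norm], of \<rho>] r rho
    by (simp add: density_operator_def)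
  then have tr: "?S $$ (0, 0) + ?S $$ (1, 1) + ?S $$ (2, 2) + ?S $$ (3, 3) + (R 1 $$ (1, 1) + R 2 $$ (1, 1)) = 1"
    using F by (simp add: mat_trace_sum[of _ 4] sum_lessThan_4 Fe R0 algebra_simps)
  have sing: "2 * quad_form ?F singlet =
      ?S $$ (1, 1) + ?S $$ (2, 2) - ?S $$ (1, 2) - ?S $$ (2, 1) + (R 1 $$ (1, 1) + R 2 $$ (1, 1))"
    unfolding quad_form_singlet[OF F] by (simp add: Fe R0)
  \<comment> \<open>The bracket is the swap expectation of the filtered state: swap fixes the basis
    vectors 0 and 3 and exchanges 1 and 2.\<close>
  have "2 * quad_form ?F singlet = 1 - (?S $$ (0, 0) + ?S $$ (3, 3) + ?S $$ (1, 2) + ?S $$ (2, 1))"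
    unfolding sing by (subst tr[symmetric]) (simp add: algebra_simps)
  \<comment> \<open>Partial transposition exchanges Bob's row and column indices. With Alice's
    indices contracted against \<open>K\<close> and its conjugate, the sum runs over the entries of
    \<open>?S\<close> whose row \<open>(x, y)\<close> meets the column
    \<open>(y, x)\<close>.\<close>
  moreover have "quad_form (partial_transpose \<rho>) (vec 4 (\<lambda>i. cnj (K $$ (i mod 2, i div 2)))) =
      ?S $$ (0, 0) + ?S $$ (3, 3) + ?S $$ (1, 2) + ?S $$ (2, 1)"
    by (subst quad_form_sum[of _ 4])
      (auto simp: sum_lessThan_4 sum_lessThan_2 partial_transpose_def index_apply_left_kraus[OF K] algebra_simps)
  ultimately show ?thesis by simp
qed

text \<open>A supremum of reals dominates its members only for a set bounded above. The crude bound
  suffices: the components of a maximally entangled vector have modulus at most 1.\<close>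

lemma fidelity_bdd_above: "bdd_above ((\<lambda>\<psi>. Re (quad_form X \<psi>)) ` max_entangled_vecs)"
  if X: "X \<in> carrier_mat 4 4"
proof (rule bdd_aboveI2)
  fix \<psi> assume psi: "\<psi> \<in> max_entangled_vecs"
  obtain W where W: "unitary_mat 2 W"
    and eq: "\<psi> = vec 4 (\<lambda>i. complex_of_real (1 / sqrt 2) * W $$ (i div 2, i mod 2))"
    using max_entangled_vec_entries[OF psi] by blast
  note Wc = unitary_matD[OF W]
  have W1: "cmod (W $$ (i, j)) \<le> 1" if "i < 2" "j < 2" for i j
  proof -
    have "(mat_adjoint W * W) $$ (j, j) = complex_of_real (\<Sum>k<2. (cmod (W $$ (k, j)))\<^sup>2)"
      using that Wc(1) by (simp add: index_mult_mat_sum complex_norm_square mult.commute del: index_mult_mat(1) of_real_power)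
    then have "complex_of_real (\<Sum>k<2. (cmod (W $$ (k, j)))\<^sup>2) = complex_of_real 1"
      unfolding Wc(2) using that by simp
    then have "(\<Sum>k<2. (cmod (W $$ (k, j)))\<^sup>2) = 1" by (simp only: of_real_eq_iff)
    moreover have "(cmod (W $$ (i, j)))\<^sup>2 \<le> (\<Sum>k<2. (cmod (W $$ (k, j)))\<^sup>2)"
      using that by (intro member_le_sum) auto
    ultimately show ?thesis by (simp add: abs_square_le_1)
  qed
  have psi1: "cmod (\<psi> $ i) \<le> 1" if "i < 4" for i
  proof -
    have "cmod (\<psi> $ i) = 1 / sqrt 2 * cmod (W $$ (i div 2, i mod 2))"
      using that by (simp add: eq norm_mult norm_divide)
    also have "\<dots> \<le> 1 * 1" using that by (intro mult_mono W1) auto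
    finally show ?thesis by simp
  qed
  have "Re (quad_form X \<psi>) \<le> cmod (\<Sum>i<4. \<Sum>j<4. cnj (\<psi> $ i) * X $$ (i, j) * \<psi> $ j)"
    unfolding quad_form_sum[OF X max_entangled_carrier[OF psi]] by (rule complex_Re_le_cmod)
  also have "\<dots> \<le> (\<Sum>i<4. \<Sum>j<4. cmod (cnj (\<psi> $ i) * X $$ (i, j) * \<psi> $ j))"
    by (intro order_trans[OF norm_sum] sum_mono norm_sum)
  also have "\<dots> \<le> (\<Sum>i<4. \<Sum>j<4. cmod (X $$ (i, j)))"
  proof (intro sum_mono)
    fix i j :: nat assume "i \<in> {..<4}" "j \<in> {..<4}"
    then have "cmod (\<psi> $ i) * cmod (X $$ (i, j)) * cmod (\<psi> $ j) \<le> 1 * cmod (X $$ (i, j)) * 1"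
      by (intro mult_mono psi1) auto
    then show "cmod (cnj (\<psi> $ i) * X $$ (i, j) * \<psi> $ j) \<le> cmod (X $$ (i, j))"
      by (simp add: norm_mult)
  qed
  finally show "Re (quad_form X \<psi>) \<le> (\<Sum>i<4. \<Sum>j<4. cmod (X $$ (i, j)))" .
qed

section \<open>From a negative partial transpose to a filter\<close>

lemma hermitian_quad_form_real:
  assumes "A \<in> carrier_mat n n" "mat_adjoint A = A" "v \<in> carrier_vec n"
  shows "Im (quad_form A v) = 0"
proof -
  have h: "cnj (A $$ (i, j)) = A $$ (j, i)" if "i < n" "j < n" for i j
    using index_mat_adjoint[of j A i] assms(1,2) that by simp
  have "cnj (quad_form A v) = (\<Sum>i<n. \<Sum>j<n. cnj (v $ j) * A $$ (j, i) * v $ i)"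
    using assms(1,3) by (auto simp: quad_form_sum[of _ n] h mult_ac intro!: sum.cong)
  also have "\<dots> = quad_form A v"
    using assms(1,3) by (subst sum.swap) (simp add: quad_form_sum[of _ n])
  finally show ?thesis by (simp add: complex_eq_iff)
qed

lemma hermitian_partial_transpose:
  assumes "\<rho> \<in> carrier_mat 4 4" "mat_adjoint \<rho> = \<rho>"
  shows "mat_adjoint (partial_transpose \<rho>) = partial_transpose \<rho>"
proof -
  have h: "cnj (\<rho> $$ (i, j)) = \<rho> $$ (j, i)" if "i < 4" "j < 4" for i j
    using index_mat_adjoint[of j \<rho> i] assms that by simp
  have b: "a div 2 * 2 + b mod 2 < 4" if "a < 4" "b < 4" for a b :: nat
    using that by (auto simp: less_4_iff)
  show ?thesis
    by (rule eq_matI) (auto simp: partial_transpose_def h b)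
qed

text \<open>In the order on \<open>complex\<close>, failure of \<open>0 \<le> z\<close> could also
  mean that \<open>z\<close> is not real; Hermiticity of the partial transpose rules this out. The
  vector is normalized so that the filter built from it has Frobenius norm 1.\<close>

lemma not_ppt_negative_direction:
  assumes rho: "density_operator 4 \<rho>" and npt: "\<not> pos_semidef 4 (partial_transpose \<rho>)"
  obtains \<phi> where "\<phi> \<in> carrier_vec 4" "\<phi> \<bullet>c \<phi> = 1" "Re (quad_form (partial_transpose \<rho>) \<phi>) < 0"
proof -
  let ?P = "partial_transpose \<rho>"
  have h: "mat_adjoint ?P = ?P"
    using rho by (intro hermitian_partial_transpose) (auto simp: density_operator_def pos_semidef_def)
  then obtain v where v: "v \<in> carrier_vec 4" "\<not> 0 \<le> quad_form ?P v"
    using npt by (auto simp: pos_semidef_def)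
  then have neg: "Re (quad_form ?P v) < 0"
    using hermitian_quad_form_real[OF partial_transpose_carrier h v(1)] by (auto simp: less_eq_complex_def)
  then have "v \<noteq> 0\<^sub>v 4" by (auto simp: quad_form_sum[of _ 4])
  then obtain r :: real where r: "r > 0" "(complex_of_real r \<cdot>\<^sub>v v) \<bullet>c (complex_of_real r \<cdot>\<^sub>v v) = 1"
    using normalize_vec[OF v(1)] by blast
  have "quad_form ?P (complex_of_real r \<cdot>\<^sub>v v) = complex_of_real (r * r) * quad_form ?P v"
    using v(1) by (simp add: quad_form_sum[of _ 4] sum_distrib_left mult_ac)
  then have "Re (quad_form ?P (complex_of_real r \<cdot>\<^sub>v v)) = (r * r) * Re (quad_form ?P v)"
    by (simp del: of_real_mult)
  also have "\<dots> < 0" using neg r(1) by (intro mult_pos_neg) auto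
  finally have "Re (quad_form ?P (complex_of_real r \<cdot>\<^sub>v v)) < 0" .
  then show ?thesis
    using that[OF _ r(2)] v(1) by simp
qed

theorem mainTheorem3:
  fixes \<rho> :: "complex mat"
  assumes "density_operator (2 * 2) \<rho>"
  shows "entangled_state 2 2 \<rho> \<longleftrightarrow>
    (\<exists>\<Lambda>. tp_locc 2 2 2 2 \<Lambda> \<and> fidelity (\<Lambda> \<rho>) > 1 / 2)"
proof
  assume "\<exists>\<Lambda>. tp_locc 2 2 2 2 \<Lambda> \<and> fidelity (\<Lambda> \<rho>) > 1 / 2"
  then show "entangled_state 2 2 \<rho>"
    using fidelity_locc_separable_le[OF _ assms] assms unfolding entangled_state_def by force
next
  assume ent: "entangled_state 2 2 \<rho>"
  have rho: "density_operator 4 \<rho>" using assms by simp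
  have "\<not> pos_semidef 4 (partial_transpose \<rho>)"
    using ent ppt_imp_separable[OF rho] by (auto simp: entangled_state_def)
  then obtain \<phi> where phi: "\<phi> \<in> carrier_vec 4" "\<phi> \<bullet>c \<phi> = 1" "Re (quad_form (partial_transpose \<rho>) \<phi>) < 0"
    using not_ppt_negative_direction[OF rho] by blast
  \<comment> \<open>The inverse of the reshaping in \<open>quad_form_filter_protocol\<close>:
    conjugated, with Alice's index as the column, since \<open>K\<close> acts on her input, and
    Bob's index as the row. The norm of \<open>\<phi>\<close> becomes the Frobenius norm of
    \<open>K\<close>, which makes \<open>K\<close> part of an instrument.\<close>
  define K where "K = mat 2 2 (\<lambda>(b, a). cnj (\<phi> $ (a * 2 + b)))"
  have K: "K \<in> carrier_mat 2 2" by (simp add: K_def)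
  have "complex_of_real (\<Sum>i<4. (cmod (\<phi> $ i))\<^sup>2) = complex_of_real 1"
    using phi(1,2) by (simp add: inner_self_eq del: of_real_sum)
  then have "(\<Sum>i<4. (cmod (\<phi> $ i))\<^sup>2) = 1" by (simp only: of_real_eq_iff)
  then have norm: "(\<Sum>a<2. \<Sum>b<2. (cmod (K $$ (a, b)))\<^sup>2) = 1"
    by (simp add: sum_lessThan_4 sum_lessThan_2 K_def) (simp add: numeral_2_eq_2 numeral_3_eq_3)
  have locc: "tp_locc 2 2 2 2 (filter_protocol K)"
    unfolding tp_locc_def using cptp_filter_protocol[OF K norm] locc_protocol_filter[OF K norm] by simp
  have "vec 4 (\<lambda>i. cnj (K $$ (i mod 2, i div 2))) = \<phi>"
    using phi(1) by (intro eq_vecI) (auto simp: K_def)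
  then have "2 * quad_form (filter_protocol K \<rho>) singlet = 1 - quad_form (partial_transpose \<rho>) \<phi>"
    using quad_form_filter_protocol[OF rho K norm] by simp
  then have "2 * Re (quad_form (filter_protocol K \<rho>) singlet) > 1"
    using phi(3) Re_two_mult[of "quad_form (filter_protocol K \<rho>) singlet"] by simp
  moreover have "Re (quad_form (filter_protocol K \<rho>) singlet) \<le> fidelity (filter_protocol K \<rho>)"
    unfolding fidelity_def
    by (intro cSUP_upper fidelity_bdd_above singlet_max_entangled) (simp add: filter_protocol_def)
  ultimately have "fidelity (filter_protocol K \<rho>) > 1 / 2" by simp
  with locc show "\<exists>\<Lambda>. tp_locc 2 2 2 2 \<Lambda> \<and> fidelity (\<Lambda> \<rho>) > 1 / 2" by blast
qed

end
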